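(* Let $(X,S,\phi)$ be a system such that the interaction $\phi$ is irreducibly quantified, and suppose that the locale $X$ has a free action of a group $G$. Assume that either $X$ is transferable, or $\phi$ is simple and $X$ is weakly transferable. Let $\mathcal C=(Z^1_{\mathrm{unif}}(S^X))^G$ and $\mathcal E=\partial\bigl(C^0_{\mathrm{unif}}(S^X)^G\bigr)$. Suppose moreover that the maximal abelian quotient $G^{\mathrm{ab}}$ of $G$ is of finite rank $d$. If we fix a set of generators of the free part of $G^{\mathrm{ab}}$, then we have an isomorphism $$\mathrm{Hom}(G,\mathrm{Consv}^\phi(S))\cong\bigoplus_{j=1}^d\mathrm{Consv}^\phi(S),$$ and a choice of a fundamental domain of $X$ for the action of $G$ gives a decomposition of $\mathbb R$-linear spaces $$\mathcal C\cong\mathcal E\oplus\bigoplus_{j=1}^d\mathrm{Consv}^\phi(S).$$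
   Context: Locales. A locale $X=(X,E)$, $E\subset X\times X$, is a directed graph that is symmetric ($(x,y)\in E\Rightarrow(y,x)\in E$), simple ($(x,x)\notin E$), locally finite (each vertex lies on finitely many edges) and connected. Write $e=(o(e),t(e))$, $\bar e=(t(e),o(e))$. Paths are finite sequences of consecutive edges (length $0$ allowed); $d_X$ is the graph distance; a subset of $X$ is connected if the induced subgraph is connected. A ball is a set $B(x,R)=\{x'\in X: d_X(x,x')\le R\}$ with $x\in X$, $R>0$ ($R$ is its radius); $B(\Lambda,R)=\bigcup_{x\in\Lambda}B(x,R)$, and $B(e,R)=B(o(e),R)\cup B(t(e),R)$. $X$ is weakly transferable if for every ball $B$ the complement $X\setminus B$ is a nonempty finite disjoint union of connected infinite graphs. $X$ is transferable if it is weakly transferable and either (a) there is a ball $B$ such that $X\setminus B$ has three or more connected components, or (b) for any $r\in\mathbb N$ there is a ball $B$ of radius at least $r$ with $X\setminus B$ connected. Systems. $S$ is a nonempty set with a designated base state $*\in S$. An interaction is a map $\phi\colon S\times S\to S\times S$ such that $\hat\imath\circ\phi\circ\hat\imath\circ\phi(s_1,s_2)=(s_1,s_2)$ whenever $\phi(s_1,s_2)\ne(s_1,s_2)$, where $\hat\imath$ swaps the components. A system is a triple $(X,S,\phi)$ of a locale, a set of states and an interaction. $S^X=\prod_{x\in X}S$; $\star$ is the configuration with all components $*$; $S^X_*$ is the set of $\eta=(\eta_x)\in S^X$ with $\eta_x=*$ for all but finitely many $x$. For $e\in E$, $\eta^e$ is obtained from $\eta$ by replacing $(\eta_{o(e)},\eta_{t(e)})$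 by $\phi(\eta_{o(e)},\eta_{t(e)})$. $\Phi=\{(\eta,\eta^e):\eta\in S^X,e\in E\}$, $\Phi_*=\Phi\cap(S^X_*\times S^X_* )$; $(S^X,\Phi)$ and $(S^X_*,\Phi_* )$ are symmetric directed graphs. Conserved quantities. A conserved quantity is $\xi\colon S\to\mathbb R$ with $\xi( * )=0$ and $\xi(s_1)+\xi(s_2)=\xi(s_1')+\xi(s_2')$ for all $(s_1,s_2)$, where $(s_1',s_2')=\phi(s_1,s_2)$; $\mathrm{Consv}^\phi(S)$ is the $\mathbb R$-linear space of these, $c_\phi$ its dimension. For $W\subset X$, $\xi_W(\eta)=\sum_{x\in W}\xi(\eta_x)$ for $\eta\in S^X_*$. $\phi$ is irreducibly quantified if for any finite locale $Y$ and $\eta,\eta'\in S^Y$ with $\xi_Y(\eta)=\xi_Y(\eta')$ for all $\xi\in\mathrm{Consv}^\phi(S)$ there is a finite path from $\eta$ to $\eta'$ in $(S^Y,\Phi)$. $\phi$ is simple if $c_\phi=1$ and for any nonzero $\xi\in\mathrm{Consv}^\phi(S)$ the additive submonoid of $\mathbb R$ generated by $\xi(S)$ is isomorphic to $\mathbb N=\{0,1,\dots\}$ or $\mathbb Z$. Functions and forms. $C(A)$ is the space of functions $A\to\mathbb R$. For finite $\Lambda\subset X$, $C(S^\Lambda)$ is regarded as the subspace of $C(S^X_* )$ of functions depending only on $\eta|_\Lambda$; $C_\Lambda(S^X)$ is the space of $f\in C(S^\Lambda)$ with $f(\eta)=0$ whenever $\eta_x=*$ for some $x\in\Lambda$. Every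 $f\in C(S^X_* )$ has a unique expansion $f=\sum_{\Lambda\subset X,|\Lambda|<\infty}f_\Lambda$ with $f_\Lambda\in C_\Lambda(S^X)$; $f$ is uniform if there is $R>0$ with $f_\Lambda=0$ whenever $\mathrm{diam}(\Lambda)=\sup_{x,x'\in\Lambda}d_X(x,x')>R$. $C^0_{\mathrm{unif}}(S^X)$ is the space of uniform $f$ with $f(\star)=0$. A form is a function $\omega\colon\Phi_*\to\mathbb R$ with $\omega(\bar\varphi)=-\omega(\varphi)$ ($\bar\varphi$ the reversed transition), identified with $(\omega_e)_{e\in E}$, $\omega_e(\eta)=\omega((\eta,\eta^e))$. It is closed if its sum along every closed path of $(S^X_*,\Phi_* )$ is $0$, and uniform if there is $R>0$ such that $\omega_e\in C(S^{B(e,R)})$ for all $e\in E$. $Z^1_{\mathrm{unif}}(S^X)$ is the space of closed uniform forms. $\partial f=(\nabla_ef)_{e\in E}$, $\nabla_ef(\eta)=f(\eta^e)-f(\eta)$; $\partial$ maps $C^0_{\mathrm{unif}}(S^X)$ to $Z^1_{\mathrm{unif}}(S^X)$. Group action. An action of $G$ on $X$ is a homomorphism from $G$ to the group of bijections $X\to X$ preserving $E$; it is free if $\sigma(x)=\tau(x)$ for some $x\in X$ implies $\sigma=\tau$. A fundamental domain is a subset $\Lambda_0\subset X$ containing exactly one vertex of each $G$-orbit. $G$ acts by $\eta^\sigma=(\eta_{\sigma(x)})_{x}$, $(\sigma f)(\eta)=f(\eta^\sigma)$, and $(\sigma\omega)((\eta,\eta'))=\omega((\eta^\sigma,\eta'^\sigma))$;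 $U^G$ denotes the $G$-invariant subspace. $\mathrm{Hom}(G,V)$ is the space of group homomorphisms. The first isomorphism evaluates a homomorphism on the fixed generators of the free part of $G^{\mathrm{ab}}$. The decomposition given by a fundamental domain $\Lambda_0$ is the one in which $\psi\in\mathrm{Hom}(G,\mathrm{Consv}^\phi(S))\cong\bigoplus_{j=1}^d\mathrm{Consv}^\phi(S)$ corresponds to the form $\omega_\psi=\partial\bigl(\sum_{\tau\in G}\psi(\tau)_{\tau(\Lambda_0)}\bigr)\in\mathcal C$. *)

theory Defs
  imports
    "HOL-Analysis.Analysis"
    "HOL-Library.Function_Algebras"
    "HOL-Algebra.Group_Action"
    "HOL-Algebra.Generated_Groups"
    "HOL-Algebra.Multiplicative_Group"
begin

section \<open>Linear spaces of real functions\<close>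

instantiation "fun" :: (type, real_vector) real_vector
begin

definition scaleR_fun_def: "c *\<^sub>R f = (\<lambda>x. c *\<^sub>R f x)"

instance
  by standard (auto simp: scaleR_fun_def plus_fun_def algebra_simps)

end

definition linear_iso_on ::
  "'u::real_vector set \<Rightarrow> 'w::real_vector set \<Rightarrow> ('u \<Rightarrow> 'w) \<Rightarrow> bool" where
  "linear_iso_on V W T \<longleftrightarrow>
     subspace V \<and> subspace W \<and> bij_betw T V W \<and>
     (\<forall>u\<in>V. \<forall>v\<in>V. T (u + v) = T u + T v) \<and>
     (\<forall>c. \<forall>v\<in>V. T (c *\<^sub>R v) = c *\<^sub>R T v)"

text \<open>The external direct sum of \<open>d\<close> copies of \<open>U\<close>, indexed by \<open>0, \<dots>, d - 1\<close>.\<close>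

definition direct_power :: "nat \<Rightarrow> 'u::real_vector set \<Rightarrow> (nat \<Rightarrow> 'u) set" where
  "direct_power d U = {v. (\<forall>j<d. v j \<in> U) \<and> (\<forall>j\<ge>d. v j = 0)}"


section \<open>Locales\<close>

definition connected_in :: "'x rel \<Rightarrow> 'x set \<Rightarrow> bool" where
  "connected_in E A \<longleftrightarrow> (\<forall>x\<in>A. \<forall>y\<in>A. (x, y) \<in> (Restr E A)\<^sup>*)"

text \<open>The vertex set of a locale is nonempty: the empty graph does not count as connected.\<close>

definition is_locale :: "'x set \<Rightarrow> 'x rel \<Rightarrow> bool" where
  "is_locale V E \<longleftrightarrow>
     V \<noteq> {} \<and> E \<subseteq> V \<times> V \<and> sym E \<and> irrefl E \<and>
     (\<forall>x\<in>V. finite {e \<in> E. fst e = x \<or> snd e = x}) \<and>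
     connected_in E V"

text \<open>From here on, notions that mention only the edge set \<open>E\<close> refer to a locale
  whose vertex set is the whole type \<open>'x\<close>.\<close>

definition graph_dist :: "'x rel \<Rightarrow> 'x \<Rightarrow> 'x \<Rightarrow> nat" where
  "graph_dist E x y = (LEAST n. (x, y) \<in> E ^^ n)"

definition graph_ball :: "'x rel \<Rightarrow> 'x \<Rightarrow> real \<Rightarrow> 'x set" where
  "graph_ball E x R = {y. real (graph_dist E x y) \<le> R}"

definition edge_ball :: "'x rel \<Rightarrow> 'x \<times> 'x \<Rightarrow> real \<Rightarrow> 'x set" where
  "edge_ball E e R = graph_ball E (fst e) R \<union> graph_ball E (snd e) R"

text \<open>Only used for finite sets. The diameter of the empty set is \<open>0\<close>.\<close>

definition graph_diam :: "'x rel \<Rightarrow> 'x set \<Rightarrow> nat" where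
  "graph_diam E A = Sup {graph_dist E x y | x y. x \<in> A \<and> y \<in> A}"

definition graph_components :: "'x rel \<Rightarrow> 'x set \<Rightarrow> 'x set set" where
  "graph_components E A = {(Restr E A)\<^sup>* `` {x} | x. x \<in> A}"

definition weakly_transferable :: "'x rel \<Rightarrow> bool" where
  "weakly_transferable E \<longleftrightarrow>
     (\<forall>x. \<forall>R>0. let K = graph_components E (- graph_ball E x R)
                  in K \<noteq> {} \<and> finite K \<and> (\<forall>C\<in>K. infinite C))"

definition transferable :: "'x rel \<Rightarrow> bool" where
  "transferable E \<longleftrightarrow>
     weakly_transferable E \<and>
     ((\<exists>x. \<exists>R>0. card (graph_components E (- graph_ball E x R)) \<ge> 3) \<or>
      (\<forall>r::nat. \<exists>x. \<exists>R>0. R \<ge> real r \<and> connected_in E (- graph_ball E x R)))"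


section \<open>Interactions and configurations\<close>

text \<open>The set of states is the type \<open>'s\<close>, with base state \<open>b\<close>.\<close>

definition interaction :: "('s \<times> 's \<Rightarrow> 's \<times> 's) \<Rightarrow> bool" where
  "interaction \<phi> \<longleftrightarrow> (\<forall>p. \<phi> p \<noteq> p \<longrightarrow> prod.swap (\<phi> (prod.swap (\<phi> p))) = p)"

definition configs :: "'x set \<Rightarrow> ('x \<Rightarrow> 's) set" where
  "configs V = V \<rightarrow>\<^sub>E UNIV"

definition exchange :: "('s \<times> 's \<Rightarrow> 's \<times> 's) \<Rightarrow> 'x \<times> 'x \<Rightarrow> ('x \<Rightarrow> 's) \<Rightarrow> 'x \<Rightarrow> 's" where
  "exchange \<phi> e \<eta> =
     (let s = \<phi> (\<eta> (fst e), \<eta> (snd e)) in \<eta>(fst e := fst s, snd e := snd s))"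

definition transitions ::
  "'x set \<Rightarrow> 'x rel \<Rightarrow> ('s \<times> 's \<Rightarrow> 's \<times> 's) \<Rightarrow> ('x \<Rightarrow> 's) rel" where
  "transitions V E \<phi> = {(\<eta>, exchange \<phi> e \<eta>) | \<eta> e. \<eta> \<in> configs V \<and> e \<in> E}"

definition fin_configs :: "'s \<Rightarrow> ('x \<Rightarrow> 's) set" where
  "fin_configs b = {\<eta>. finite {x. \<eta> x \<noteq> b}}"

definition fin_transitions ::
  "'s \<Rightarrow> 'x rel \<Rightarrow> ('s \<times> 's \<Rightarrow> 's \<times> 's) \<Rightarrow> ('x \<Rightarrow> 's) rel" where
  "fin_transitions b E \<phi> = transitions UNIV E \<phi> \<inter> fin_configs b \<times> fin_configs b"


section \<open>Conserved quantities\<close>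

definition consv :: "'s \<Rightarrow> ('s \<times> 's \<Rightarrow> 's \<times> 's) \<Rightarrow> ('s \<Rightarrow> real) set" where
  "consv b \<phi> =
     {\<xi>. \<xi> b = 0 \<and>
          (\<forall>s1 s2. \<xi> s1 + \<xi> s2 = \<xi> (fst (\<phi> (s1, s2))) + \<xi> (snd (\<phi> (s1, s2))))}"

text \<open>All infinite sums have only finitely many nonzero terms where they are used:
  \<open>\<xi> b = 0\<close> and \<open>\<eta>\<close> is \<open>b\<close> off a finite set.\<close>

definition site_sum :: "('s \<Rightarrow> real) \<Rightarrow> 'x set \<Rightarrow> ('x \<Rightarrow> 's) \<Rightarrow> real" where
  "site_sum \<xi> W \<eta> = (\<Sum>\<^sub>\<infinity>x\<in>W. \<xi> (\<eta> x))"

text \<open>Every finite locale is isomorphic to one whose vertices are natural numbers.\<close>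

definition irreducibly_quantified :: "'s \<Rightarrow> ('s \<times> 's \<Rightarrow> 's \<times> 's) \<Rightarrow> bool" where
  "irreducibly_quantified b \<phi> \<longleftrightarrow>
     (\<forall>(Y::nat set) F. finite Y \<and> is_locale Y F \<longrightarrow>
        (\<forall>\<eta>\<in>configs Y. \<forall>\<eta>'\<in>configs Y.
           (\<forall>\<xi>\<in>consv b \<phi>. site_sum \<xi> Y \<eta> = site_sum \<xi> Y \<eta>') \<longrightarrow>
           (\<eta>, \<eta>') \<in> (transitions Y F \<phi>)\<^sup>*))"

definition additive_structure :: "'u::monoid_add set \<Rightarrow> 'u monoid" where
  "additive_structure M = \<lparr>carrier = M, monoid.mult = (+), one = 0\<rparr>"

definition additive_submonoid :: "'u::monoid_add set \<Rightarrow> bool" where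
  "additive_submonoid M \<longleftrightarrow> 0 \<in> M \<and> (\<forall>u\<in>M. \<forall>v\<in>M. u + v \<in> M)"

text \<open>The library \<open>dim\<close> of an infinite-dimensional space is \<open>0\<close>, so \<open>dim = 1\<close> is unambiguous.\<close>

definition simple_interaction :: "'s \<Rightarrow> ('s \<times> 's \<Rightarrow> 's \<times> 's) \<Rightarrow> bool" where
  "simple_interaction b \<phi> \<longleftrightarrow>
     dim (consv b \<phi>) = 1 \<and>
     (\<forall>\<xi>\<in>consv b \<phi>. \<xi> \<noteq> 0 \<longrightarrow>
        (let M = additive_structure (additive_submonoid hull range \<xi>)
         in M \<cong> additive_structure (UNIV :: nat set) \<or>
            M \<cong> additive_structure (UNIV :: int set)))"


section \<open>Uniform functions and closed uniform forms\<close>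

text \<open>Functions on finitely supported configurations are represented by total functions that
  vanish on all other configurations; forms likewise vanish off \<open>fin_transitions\<close>.\<close>

definition local_funs :: "'s \<Rightarrow> 'x set \<Rightarrow> (('x \<Rightarrow> 's) \<Rightarrow> real) set" where
  "local_funs b A =
     {f. (\<forall>\<eta>. \<eta> \<notin> fin_configs b \<longrightarrow> f \<eta> = 0) \<and>
         (\<forall>\<eta>\<in>fin_configs b. \<forall>\<eta>'\<in>fin_configs b. (\<forall>x\<in>A. \<eta> x = \<eta>' x) \<longrightarrow> f \<eta> = f \<eta>')}"

definition exact_local_funs :: "'s \<Rightarrow> 'x set \<Rightarrow> (('x \<Rightarrow> 's) \<Rightarrow> real) set" where
  "exact_local_funs b A = {f \<in> local_funs b A. \<forall>\<eta>. (\<exists>x\<in>A. \<eta> x = b) \<longrightarrow> f \<eta> = 0}"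

text \<open>A term \<open>F A \<eta>\<close> of the expansion vanishes unless \<open>A\<close> is contained in the support of \<open>\<eta>\<close>,
  so the sum over all finite \<open>A\<close> reduces to a sum over the subsets of the support.\<close>

definition is_expansion ::
  "'s \<Rightarrow> (('x \<Rightarrow> 's) \<Rightarrow> real) \<Rightarrow> ('x set \<Rightarrow> ('x \<Rightarrow> 's) \<Rightarrow> real) \<Rightarrow> bool" where
  "is_expansion b f F \<longleftrightarrow>
     (\<forall>A. finite A \<longrightarrow> F A \<in> exact_local_funs b A) \<and>
     (\<forall>\<eta>\<in>fin_configs b. f \<eta> = (\<Sum>A\<in>Pow {x. \<eta> x \<noteq> b}. F A \<eta>))"

text \<open>The expansion \<open>F\<close> exists and is unique on finite sets for each \<open>f\<close>.\<close>

definition uniform_fun :: "'s \<Rightarrow> 'x rel \<Rightarrow> (('x \<Rightarrow> 's) \<Rightarrow> real) \<Rightarrow> bool" where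
  "uniform_fun b E f \<longleftrightarrow>
     (\<exists>F. is_expansion b f F \<and>
        (\<exists>R>0. \<forall>A. finite A \<and> real (graph_diam E A) > R \<longrightarrow> F A = 0))"

definition C0_unif :: "'s \<Rightarrow> 'x rel \<Rightarrow> (('x \<Rightarrow> 's) \<Rightarrow> real) set" where
  "C0_unif b E =
     {f. (\<forall>\<eta>. \<eta> \<notin> fin_configs b \<longrightarrow> f \<eta> = 0) \<and> uniform_fun b E f \<and> f (\<lambda>_. b) = 0}"

type_synonym ('x, 's) form = "('x \<Rightarrow> 's) \<times> ('x \<Rightarrow> 's) \<Rightarrow> real"

definition forms :: "'s \<Rightarrow> 'x rel \<Rightarrow> ('s \<times> 's \<Rightarrow> 's \<times> 's) \<Rightarrow> ('x, 's) form set" where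
  "forms b E \<phi> =
     {\<omega>. (\<forall>t. t \<notin> fin_transitions b E \<phi> \<longrightarrow> \<omega> t = 0) \<and>
          (\<forall>t\<in>fin_transitions b E \<phi>. \<omega> (prod.swap t) = - \<omega> t)}"

definition closed_edge_path :: "'v rel \<Rightarrow> ('v \<times> 'v) list \<Rightarrow> bool" where
  "closed_edge_path T p \<longleftrightarrow>
     set p \<subseteq> T \<and> successively (\<lambda>e e'. snd e = fst e') p \<and>
     (p \<noteq> [] \<longrightarrow> snd (last p) = fst (hd p))"

definition closed_form ::
  "'s \<Rightarrow> 'x rel \<Rightarrow> ('s \<times> 's \<Rightarrow> 's \<times> 's) \<Rightarrow> ('x, 's) form \<Rightarrow> bool" where
  "closed_form b E \<phi> \<omega> \<longleftrightarrow>
     (\<forall>p. closed_edge_path (fin_transitions b E \<phi>) p \<longrightarrow> sum_list (map \<omega> p) = 0)"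

definition form_at ::
  "('s \<times> 's \<Rightarrow> 's \<times> 's) \<Rightarrow> ('x, 's) form \<Rightarrow> 'x \<times> 'x \<Rightarrow> ('x \<Rightarrow> 's) \<Rightarrow> real" where
  "form_at \<phi> \<omega> e \<eta> = \<omega> (\<eta>, exchange \<phi> e \<eta>)"

definition uniform_form ::
  "'s \<Rightarrow> 'x rel \<Rightarrow> ('s \<times> 's \<Rightarrow> 's \<times> 's) \<Rightarrow> ('x, 's) form \<Rightarrow> bool" where
  "uniform_form b E \<phi> \<omega> \<longleftrightarrow>
     (\<exists>R>0. \<forall>e\<in>E. form_at \<phi> \<omega> e \<in> local_funs b (edge_ball E e R))"

definition Z1_unif :: "'s \<Rightarrow> 'x rel \<Rightarrow> ('s \<times> 's \<Rightarrow> 's \<times> 's) \<Rightarrow> ('x, 's) form set" where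
  "Z1_unif b E \<phi> = {\<omega> \<in> forms b E \<phi>. closed_form b E \<phi> \<omega> \<and> uniform_form b E \<phi> \<omega>}"

definition differential ::
  "'s \<Rightarrow> 'x rel \<Rightarrow> ('s \<times> 's \<Rightarrow> 's \<times> 's) \<Rightarrow> (('x \<Rightarrow> 's) \<Rightarrow> real) \<Rightarrow> ('x, 's) form" where
  "differential b E \<phi> f =
     (\<lambda>t. if t \<in> fin_transitions b E \<phi> then f (snd t) - f (fst t) else 0)"


section \<open>Group actions\<close>

definition locale_action ::
  "('g, 'm) monoid_scheme \<Rightarrow> 'x rel \<Rightarrow> ('g \<Rightarrow> 'x \<Rightarrow> 'x) \<Rightarrow> bool" where
  "locale_action G E \<alpha> \<longleftrightarrow>
     group_action G UNIV \<alpha> \<and>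
     (\<forall>\<sigma>\<in>carrier G. \<forall>x y. (x, y) \<in> E \<longrightarrow> (\<alpha> \<sigma> x, \<alpha> \<sigma> y) \<in> E)"

definition free_action :: "('g, 'm) monoid_scheme \<Rightarrow> ('g \<Rightarrow> 'x \<Rightarrow> 'x) \<Rightarrow> bool" where
  "free_action G \<alpha> \<longleftrightarrow>
     (\<forall>\<sigma>\<in>carrier G. \<forall>\<tau>\<in>carrier G. (\<exists>x. \<alpha> \<sigma> x = \<alpha> \<tau> x) \<longrightarrow> \<sigma> = \<tau>)"

definition fundamental_domain ::
  "('g, 'm) monoid_scheme \<Rightarrow> ('g \<Rightarrow> 'x \<Rightarrow> 'x) \<Rightarrow> 'x set \<Rightarrow> bool" where
  "fundamental_domain G \<alpha> D \<longleftrightarrow> (\<forall>Q\<in>orbits G UNIV \<alpha>. \<exists>!x. x \<in> D \<inter> Q)"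

definition invariant_funs ::
  "('g, 'm) monoid_scheme \<Rightarrow> ('g \<Rightarrow> 'x \<Rightarrow> 'x) \<Rightarrow>
     (('x \<Rightarrow> 's) \<Rightarrow> real) set \<Rightarrow> (('x \<Rightarrow> 's) \<Rightarrow> real) set" where
  "invariant_funs G \<alpha> U = {f \<in> U. \<forall>\<sigma>\<in>carrier G. (\<lambda>\<eta>. f (\<eta> \<circ> \<alpha> \<sigma>)) = f}"

definition invariant_forms ::
  "('g, 'm) monoid_scheme \<Rightarrow> ('g \<Rightarrow> 'x \<Rightarrow> 'x) \<Rightarrow> ('x, 's) form set \<Rightarrow> ('x, 's) form set" where
  "invariant_forms G \<alpha> U =
     {\<omega> \<in> U. \<forall>\<sigma>\<in>carrier G. (\<lambda>(\<eta>, \<eta>'). \<omega> (\<eta> \<circ> \<alpha> \<sigma>, \<eta>' \<circ> \<alpha> \<sigma>)) = \<omega>}"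

definition inv_closed_forms ::
  "'s \<Rightarrow> 'x rel \<Rightarrow> ('s \<times> 's \<Rightarrow> 's \<times> 's) \<Rightarrow>
     ('g, 'm) monoid_scheme \<Rightarrow> ('g \<Rightarrow> 'x \<Rightarrow> 'x) \<Rightarrow> ('x, 's) form set" where
  "inv_closed_forms b E \<phi> G \<alpha> = invariant_forms G \<alpha> (Z1_unif b E \<phi>)"

definition inv_exact_forms ::
  "'s \<Rightarrow> 'x rel \<Rightarrow> ('s \<times> 's \<Rightarrow> 's \<times> 's) \<Rightarrow>
     ('g, 'm) monoid_scheme \<Rightarrow> ('g \<Rightarrow> 'x \<Rightarrow> 'x) \<Rightarrow> ('x, 's) form set" where
  "inv_exact_forms b E \<phi> G \<alpha> = differential b E \<phi> ` invariant_funs G \<alpha> (C0_unif b E)"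


section \<open>The abelianization and homomorphisms to conserved quantities\<close>

definition abelianization :: "('g, 'm) monoid_scheme \<Rightarrow> 'g set monoid" where
  "abelianization G = G Mod derived G (carrier G)"

text \<open>For a commutative group \<open>A\<close>: independence over the integers, and the rank,
  i.e. the maximal size of an independent set.\<close>

definition int_independent :: "('a, 'm) monoid_scheme \<Rightarrow> 'a set \<Rightarrow> bool" where
  "int_independent A B \<longleftrightarrow>
     finite B \<and> B \<subseteq> carrier A \<and>
     (\<forall>n::'a \<Rightarrow> int. (\<Otimes>\<^bsub>A\<^esub>a\<in>B. a [^]\<^bsub>A\<^esub> n a) = \<one>\<^bsub>A\<^esub> \<longrightarrow> (\<forall>a\<in>B. n a = 0))"

definition has_rank :: "('a, 'm) monoid_scheme \<Rightarrow> nat \<Rightarrow> bool" where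
  "has_rank A d \<longleftrightarrow>
     (\<exists>B. int_independent A B \<and> card B = d) \<and> (\<forall>B. int_independent A B \<longrightarrow> card B \<le> d)"

definition torsion_part :: "('a, 'm) monoid_scheme \<Rightarrow> 'a set" where
  "torsion_part A = {a \<in> carrier A. \<exists>n::nat. n > 0 \<and> a [^]\<^bsub>A\<^esub> n = \<one>\<^bsub>A\<^esub>}"

text \<open>Elements \<open>\<gamma> 0, \<dots>, \<gamma> (d - 1)\<close> of \<open>A\<close> whose classes generate \<open>A\<close> modulo torsion.
  If \<open>A\<close> has rank \<open>d\<close>, they are then a basis of a free complement of the torsion subgroup.\<close>

definition free_part_generators :: "('a, 'm) monoid_scheme \<Rightarrow> nat \<Rightarrow> (nat \<Rightarrow> 'a) \<Rightarrow> bool" where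
  "free_part_generators A d \<gamma> \<longleftrightarrow>
     (\<forall>j<d. \<gamma> j \<in> carrier A) \<and> generate A (\<gamma> ` {..<d} \<union> torsion_part A) = carrier A"

text \<open>Homomorphisms are normalized to vanish off the carrier of the group.\<close>

definition Hom :: "('g, 'm) monoid_scheme \<Rightarrow> 'u::real_vector set \<Rightarrow> ('g \<Rightarrow> 'u) set" where
  "Hom G U = {\<psi> \<in> hom G (additive_structure U). \<forall>\<sigma>. \<sigma> \<notin> carrier G \<longrightarrow> \<psi> \<sigma> = 0}"

text \<open>Elements of the abelianization are cosets, on each of which \<open>\<psi>\<close> is constant; the common
  value is that of the homomorphism induced by \<open>\<psi>\<close> on the abelianization.\<close>

definition eval_gens :: "nat \<Rightarrow> (nat \<Rightarrow> 'g set) \<Rightarrow> ('g \<Rightarrow> 'u::real_vector) \<Rightarrow> nat \<Rightarrow> 'u" where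
  "eval_gens d \<gamma> \<psi> = (\<lambda>j. if j < d then the_elem (\<psi> ` \<gamma> j) else 0)"

definition hom_form ::
  "'s \<Rightarrow> 'x rel \<Rightarrow> ('s \<times> 's \<Rightarrow> 's \<times> 's) \<Rightarrow>
     ('g, 'm) monoid_scheme \<Rightarrow> ('g \<Rightarrow> 'x \<Rightarrow> 'x) \<Rightarrow> 'x set \<Rightarrow>
     ('g \<Rightarrow> 's \<Rightarrow> real) \<Rightarrow> ('x, 's) form" where
  "hom_form b E \<phi> G \<alpha> D \<psi> =
     differential b E \<phi> (\<lambda>\<eta>. \<Sum>\<^sub>\<infinity>\<tau>\<in>carrier G. site_sum (\<psi> \<tau>) (\<alpha> \<tau> ` D) \<eta>)"

end

theory Submission
  imports Defs "HOL-Library.Multiset"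
begin

text \<open>
  The theorem comes from the exact sequence \<open>0 \<rightarrow> Consv \<rightarrow> C\<^sup>0 \<rightarrow> Z\<^sup>1 \<rightarrow> 0\<close> of \<open>G\<close>-modules, where a
  conserved quantity \<open>\<xi>\<close> is sent to its total \<open>\<xi>\<^sub>X\<close> and a uniform function \<open>f\<close> to \<open>\<partial>f\<close>. The group acts
  trivially on the totals. So if \<open>\<partial>f\<close> is invariant, then \<open>\<sigma>f - f = \<psi>(\<sigma>)\<^sub>X\<close> for a homomorphism \<open>\<psi>\<close> from
  \<open>G\<close> to the conserved quantities. A fundamental domain gives the uniform function
  \<open>\<theta> = \<Sum>\<^sub>\<tau> \<psi>(\<tau>)\<^bsub>\<tau>D\<^esub>\<close>, for which \<open>\<sigma>\<theta> - \<theta> = - \<psi>(\<sigma>)\<^sub>X\<close>. Hence \<open>f + \<theta>\<close> is invariant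
  (\<open>invariant_form_decomposition\<close>), and \<open>\<psi>\<close> is unique, because a function in the kernel of \<open>\<partial>\<close> is a
  total and hence invariant (\<open>exact_plus_hom_form_eq_0\<close>).

  The main point is that every closed uniform form \<open>\<omega>\<close> is \<open>\<partial>f\<close> for a uniform \<open>f\<close>
  (\<open>closed_uniform_form_exact\<close>). There is some potential \<open>f\<close>. Two configurations that agree off a
  connected set and have the same total conserved quantities, the same charge, can be transformed
  into each other by exchanges in that set. The resulting change of \<open>f\<close> does not depend on the
  states far away from the set (\<open>moves_effect_local\<close>). So if \<open>\<alpha>\<close> is a configuration near a base
  vertex and \<open>\<beta>\<close> one far out in an end of the locale, the defect \<open>f(\<alpha> \<union> \<beta>) - f(\<alpha>) - f(\<beta>)\<close> only
  depends on the charges of \<open>\<alpha>\<close> and \<open>\<beta>\<close>. This defines for each end a function of two charges, the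
  pairing, and it is always a two-cocycle (\<open>pairing_cocycle\<close>).

  The pairings of two different ends are the transposes of each other (\<open>pairing_swap\<close>). Hence they
  all agree as soon as they are symmetric. The symmetry is where the assumption on the locale and
  the interaction enters. It is clear if there are three ends. If large balls have connected
  complements, either there is only one end, and two configurations can change their roles by going
  around each other, or charges can be moved from one end to the other around a large ball, so that
  the pairings agree and are also transposes of each other. If the interaction is simple, the
  charges form a monoid like the natural numbers or the integers, on which every cocycle is
  symmetric.

  A symmetric cocycle with real values is a coboundary, since the additive group of the reals is
  divisible (\<open>symmetric_cocycle_splits\<close>). So the defect is removed by adding to \<open>f\<close> a function of the
  charge. After that, states far from a vertex \<open>x\<close> can be moved away to infinity, where they do not
  interact with \<open>x\<close> (\<open>erasing_local\<close>), and this makes \<open>f\<close> uniform.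

  For the first isomorphism, homomorphisms to a vector space vanish on torsion, and \<open>d\<close> elements that
  generate an abelian group of rank \<open>d\<close> modulo torsion are independent modulo torsion
  (\<open>torsion_coords_zero\<close>). So they may be given arbitrary values.\<close>

section \<open>Symmetric cocycles on commutative monoids\<close>

text \<open>The additive group of the reals is divisible, so an additive map on a subgroup extends to the
  whole group. The map is given by its graph, because the union of a chain of graphs is again a
  graph. In a maximal graph nothing is missing: if \<open>a\<close> is not in the domain, the value at \<open>a\<close> may be
  chosen freely if no nonzero multiple of \<open>a\<close> is in the domain, and is forced to be \<open>s / n\<close> if \<open>n a\<close>
  has the value \<open>s\<close>.\<close>

lemma additive_graph_extends:
  fixes P :: "('a::real_vector \<times> real) set"
  assumes P0: "0 \<in> P" and Pd: "\<And>p q. p \<in> P \<Longrightarrow> q \<in> P \<Longrightarrow> p - q \<in> P"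
    and Pf: "\<And>r. (0, r) \<in> P \<Longrightarrow> r = 0"
  obtains K where "\<And>x y. K (x + y) = K x + K y" and "\<And>x r. (x, r) \<in> P \<Longrightarrow> K x = r"
proof -
  define \<S>
    where "\<S> = {Q::('a \<times> real) set. P \<subseteq> Q \<and> (\<forall>p\<in>Q. \<forall>q\<in>Q. p - q \<in> Q) \<and> (\<forall>r. (0, r) \<in> Q \<longrightarrow> r = 0)}"
  have "\<exists>M\<in>\<S>. \<forall>X\<in>\<S>. M \<subseteq> X \<longrightarrow> X = M"
  proof (rule subset_Zorn_nonempty)
    show "\<S> \<noteq> {}" using assms by (auto simp: \<S>_def)
    fix \<C> assume ne: "\<C> \<noteq> {}" and ch: "subset.chain \<S> \<C>"
    have sub: "\<C> \<subseteq> \<S>" and tot: "\<And>A B. A \<in> \<C> \<Longrightarrow> B \<in> \<C> \<Longrightarrow> A \<subseteq> B \<or> B \<subseteq> A"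
      using ch by (auto simp: subset_chain_def)
    have "p - q \<in> \<Union>\<C>" if pq: "p \<in> \<Union>\<C>" "q \<in> \<Union>\<C>" for p q
    proof -
      obtain A B where AB: "p \<in> A" "A \<in> \<C>" "q \<in> B" "B \<in> \<C>" using pq by blast
      define U where "U = (if A \<subseteq> B then B else A)"
      have "U \<in> \<C>" "p \<in> U" "q \<in> U" using AB tot[of A B] by (auto simp: U_def)
      then show ?thesis using sub by (auto simp: \<S>_def)
    qed
    moreover have "P \<subseteq> \<Union>\<C>" using ne sub unfolding \<S>_def by blast
    moreover have "\<And>r. (0, r) \<in> \<Union>\<C> \<Longrightarrow> r = 0" using sub by (auto simp: \<S>_def)
    ultimately show "\<Union>\<C> \<in> \<S>" by (auto simp: \<S>_def)
  qed
  then obtain Q where Q: "Q \<in> \<S>" and max: "\<And>X. X \<in> \<S> \<Longrightarrow> Q \<subseteq> X \<Longrightarrow> X = Q" by blast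
  have PQ: "P \<subseteq> Q" and Qd: "\<And>p q. p \<in> Q \<Longrightarrow> q \<in> Q \<Longrightarrow> p - q \<in> Q"
    and Qf: "\<And>r. (0, r) \<in> Q \<Longrightarrow> r = 0"
    using Q by (auto simp: \<S>_def)
  have Q0: "0 \<in> Q" using P0 PQ by auto
  have Qm: "- p \<in> Q" if "p \<in> Q" for p using Qd[OF Q0 that] by simp
  have Qa: "p + q \<in> Q" if "p \<in> Q" "q \<in> Q" for p q using Qd[OF that(1) Qm[OF that(2)]] by simp
  have Qn: "real n *\<^sub>R p \<in> Q" if "p \<in> Q" for p and n :: nat
  proof (induction n)
    case (Suc n)
    then show ?case using Qa[OF that Suc] by (simp add: scaleR_left_distrib)
  qed (use Q0 in simp)
  have Qz: "of_int n *\<^sub>R p \<in> Q" if "p \<in> Q" for p and n :: int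
  proof (cases "n \<ge> 0")
    case True
    then show ?thesis using Qn[OF that, of "nat n"] by simp
  next
    case False
    then show ?thesis using Qm[OF Qn[OF that, of "nat (-n)"]] by simp
  qed
  have uniq: "r = s" if "(x, r) \<in> Q" "(x, s) \<in> Q" for x r s
    using Qf[of "r - s"] Qd[OF that] by simp
  have total: "\<exists>r. (a, r) \<in> Q" for a
  proof -
    define t where "t = (if \<exists>n s. n \<noteq> (0::int) \<and> (of_int n *\<^sub>R a, s) \<in> Q
      then (SOME u. \<exists>n s. n \<noteq> (0::int) \<and> (of_int n *\<^sub>R a, s) \<in> Q \<and> u = s / of_int n) else 0)"
    have t: "r = of_int n * t" if "(of_int n *\<^sub>R a, r) \<in> Q" for n :: int and r
    proof (cases "n = 0")
      case True
      then show ?thesis using that Qf by simp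
    next
      case False
      then have ex: "\<exists>n s. n \<noteq> (0::int) \<and> (of_int n *\<^sub>R a, s) \<in> Q" using that by blast
      then have "\<exists>u n s. n \<noteq> (0::int) \<and> (of_int n *\<^sub>R a, s) \<in> Q \<and> u = s / of_int n" by blast
      from someI_ex[OF this] ex obtain n0 :: int and s0
        where n0: "n0 \<noteq> 0" "(of_int n0 *\<^sub>R a, s0) \<in> Q" "t = s0 / of_int n0"
        unfolding t_def by (auto simp del: scaleR_Pair)
      have "of_int n0 *\<^sub>R (of_int n *\<^sub>R a, r) - of_int n *\<^sub>R (of_int n0 *\<^sub>R a, s0) \<in> Q"
        by (intro Qd Qz that n0)
      then have "(0, of_int n0 * r - of_int n * s0) \<in> Q" by (simp add: mult.commute)
      then have eq: "of_int n0 * r = of_int n * s0" using Qf by fastforce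
      have "r = of_int n0 * r / of_int n0" using n0(1) by simp
      also have "\<dots> = of_int n * t" unfolding eq by (simp add: n0(3))
      finally show ?thesis .
    qed
    define X where "X = {p + of_int n *\<^sub>R (a, t) | p n. p \<in> Q}"
    have "X = Q"
    proof (rule max)
      show "Q \<subseteq> X"
      proof
        fix p assume "p \<in> Q"
        then have "p = p + of_int 0 *\<^sub>R (a, t) \<and> p \<in> Q" by (simp add: prod_eq_iff)
        then show "p \<in> X" unfolding X_def by blast
      qed
      then have "P \<subseteq> X" using PQ by blast
      moreover have "p - q \<in> X" if pq: "p \<in> X" "q \<in> X" for p q
      proof -
        obtain p' q' and n m :: int where *: "p' \<in> Q" "q' \<in> Q" "p = p' + of_int n *\<^sub>R (a, t)"
          "q = q' + of_int m *\<^sub>R (a, t)" using pq unfolding X_def by blast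
        have "p - q = (p' - q') + of_int (n - m) *\<^sub>R (a, t)"
          using * by (simp add: prod_eq_iff algebra_simps)
        then show ?thesis unfolding X_def using Qd[OF *(1,2)] by blast
      qed
      moreover have "r = 0" if r: "(0, r) \<in> X" for r
      proof -
        obtain p n where p: "p \<in> Q" "(0, r) = p + of_int n *\<^sub>R (a, t)" using r unfolding X_def
          by blast
        have "p = (of_int (- n) *\<^sub>R a, r - of_int n * t)"
          using p(2) by (cases p) (auto simp: eq_neg_iff_add_eq_0)
        then show ?thesis using t[of "- n" "r - of_int n * t"] p(1) by simp
      qed
      ultimately show "X \<in> \<S>" by (auto simp: \<S>_def)
    qed
    moreover have "0 + of_int 1 *\<^sub>R (a, t) \<in> X" unfolding X_def using Q0 by blast
    ultimately show ?thesis by auto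
  qed
  define K where "K = (\<lambda>x. SOME r. (x, r) \<in> Q)"
  have K: "(x, K x) \<in> Q" for x unfolding K_def using total by (rule someI_ex)
  show ?thesis
  proof (rule that)
    show "K (x + y) = K x + K y" for x y
      using uniq[OF K[of "x + y"]] Qa[OF K[of x] K[of y]] by simp
    show "K x = r" if "(x, r) \<in> P" for x r using uniq[OF K] that PQ by blast
  qed
qed

text \<open>Two-cocycles with trivial real coefficients on a submonoid \<open>M\<close> of an abelian group,
  normalized to vanish at the neutral element.\<close>

locale monoid_cocycle =
  fixes M :: "'v::ab_group_add set" and h :: "'v \<Rightarrow> 'v \<Rightarrow> real"
  assumes zero_in: "0 \<in> M" and add_in: "\<And>m n. m \<in> M \<Longrightarrow> n \<in> M \<Longrightarrow> m + n \<in> M"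
    and cocycle: "\<And>m n p. m \<in> M \<Longrightarrow> n \<in> M \<Longrightarrow> p \<in> M \<Longrightarrow>
      h m n + h (m + n) p = h n p + h m (n + p)"
    and zero_left: "\<And>m. m \<in> M \<Longrightarrow> h 0 m = 0"
begin

text \<open>The left-hand side is the commutator pairing of the central extension defined by the cocycle, and
  commutators in a central extension are biadditive.\<close>

lemma commutator_add:
  assumes "a \<in> M" "b \<in> M" "c \<in> M"
  shows "h a (b + c) - h (b + c) a = (h a b - h b a) + (h a c - h c a)"
  using cocycle[of a b c] cocycle[of b c a] cocycle[of b a c] assms
  by (simp add: add.commute)

lemma zero_right: "m \<in> M \<Longrightarrow> h m 0 = 0"
  using cocycle[of m 0 0] zero_in zero_left[of 0] by simp

text \<open>If \<open>M\<close> is generated by one element \<open>u\<close>, together with its inverse if that lies in \<open>M\<close>, the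
  biadditive antisymmetrization is determined by its value at \<open>(u, u)\<close>, which is zero.\<close>

lemma symmetric_if_cyclic:
  assumes u: "u \<in> M"
    and gen: "\<And>S. 0 \<in> S \<Longrightarrow> (\<And>m. m \<in> M \<Longrightarrow> m \<in> S \<longleftrightarrow> m + u \<in> S) \<Longrightarrow> M \<subseteq> S"
    and ab: "a \<in> M" "b \<in> M"
  shows "h a b = h b a"
proof -
  have ext: "h c m - h m c = 0" if "c \<in> M" "h c u - h u c = 0" "m \<in> M" for c m
  proof -
    have "M \<subseteq> {m. h c m - h m c = 0}"
    proof (rule gen)
      show "0 \<in> {m. h c m - h m c = 0}" using that zero_left zero_right by simp
      show "m \<in> {m. h c m - h m c = 0} \<longleftrightarrow> m + u \<in> {m. h c m - h m c = 0}" if "m \<in> M" for m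
        using commutator_add[OF \<open>c \<in> M\<close> that u] \<open>h c u - h u c = 0\<close> unfolding mem_Collect_eq
        by linarith
    qed
    then show ?thesis using that by auto
  qed
  have "h u a - h a u = 0" using ext[OF u _ ab(1)] by simp
  then have "h a u - h u a = 0" by simp
  from ext[OF ab(1) this ab(2)] show ?thesis by simp
qed

end

text \<open>A symmetric cocycle is a coboundary. On finite multisets of elements of \<open>M\<close> let \<open>H\<close> accumulate
  the values of the cocycle while the elements are added up in any order. On the subgroup of
  differences \<open>A - B\<close> of multisets with equal sums, \<open>H A - H B\<close> is additive. An additive extension
  of this map to all functions, evaluated at singletons, splits the cocycle.\<close>

lemma (in monoid_cocycle) symmetric_cocycle_splits:
  assumes sym: "\<And>m n. m \<in> M \<Longrightarrow> n \<in> M \<Longrightarrow> h m n = h n m"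
  obtains g where "\<And>m n. m \<in> M \<Longrightarrow> n \<in> M \<Longrightarrow> h m n = g m + g n - g (m + n)"
proof -
  \<comment> \<open>Elements outside of \<open>M\<close> are ignored, so that the steps commute without exception.\<close>
  define F :: "'v \<Rightarrow> 'v \<times> real \<Rightarrow> 'v \<times> real" where
    "F = (\<lambda>m (s, r). if m \<in> M \<and> s \<in> M then (m + s, r + h m s) else (s, r))"
  interpret F: comp_fun_commute F
  proof
    fix m n
    show "F n \<circ> F m = F m \<circ> F n"
    proof
      fix p :: "'v \<times> real"
      obtain s r where p: "p = (s, r)" by (cases p)
      have "h m s + h n (m + s) = h n s + h m (n + s)" if "m \<in> M" "n \<in> M" "s \<in> M"
        using cocycle[of n m s] cocycle[of m n s] sym[OF that(1,2)] that by (simp add: add.commute)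
      then show "(F n \<circ> F m) p = (F m \<circ> F n) p"
        using add_in p by (auto simp: F_def add_ac)
    qed
  qed
  define S where "S = (\<lambda>A. fst (fold_mset F (0, 0) A))"
  define H where "H = (\<lambda>A. snd (fold_mset F (0, 0) A))"
  have S0: "S {#} = 0" "H {#} = 0" by (auto simp: S_def H_def)
  have SM: "S A \<in> M" for A
  proof (induction A)
    case (add x A)
    obtain s r where sr: "fold_mset F (0, 0) A = (s, r)" by fastforce
    then have "S (add_mset x A) = fst (F x (s, r))" by (simp add: S_def)
    then show ?case using add add_in sr by (simp add: S_def) (simp add: F_def)
  qed (auto simp: S0 zero_in)
  have step: "S (add_mset x A) = x + S A" "H (add_mset x A) = H A + h x (S A)" if "x \<in> M" for x A
  proof -
    have "fold_mset F (0, 0) (add_mset x A) = F x (S A, H A)" by (simp add: S_def H_def)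
    also have "\<dots> = (x + S A, H A + h x (S A))" using that SM[of A] by (simp add: F_def)
    finally show "S (add_mset x A) = x + S A" "H (add_mset x A) = H A + h x (S A)"
      by (simp_all add: S_def H_def)
  qed
  have un: "S (A + B) = S A + S B \<and> H (A + B) = H A + H B + h (S A) (S B)"
    if "set_mset A \<subseteq> M" for A B
    using that
  proof (induction A)
    case empty
    then show ?case using SM zero_left by (simp add: S0)
  next
    case (add x A)
    then have "x \<in> M" by auto
    then show ?case using add SM cocycle[of x "S A" "S B"] by (simp add: step add_ac)
  qed
  define cnt :: "'v multiset \<Rightarrow> 'v \<Rightarrow> real" where "cnt = (\<lambda>A v. real (count A v))"
  have cnt_add: "cnt (A + B) = cnt A + cnt B" for A B by (auto simp: cnt_def)
  have cnt_inj: "A = B" if "cnt A = cnt B" for A B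
    using that by (auto simp: cnt_def multiset_eq_iff fun_eq_iff)
  define P where "P = {(cnt A - cnt B, H A - H B) | A B.
    set_mset A \<subseteq> M \<and> set_mset B \<subseteq> M \<and> S A = S B}"
  have PI: "(cnt A - cnt B, H A - H B) \<in> P"
    if "set_mset A \<subseteq> M" "set_mset B \<subseteq> M" "S A = S B" for A B
    using that unfolding P_def by blast
  have P0: "0 \<in> P" using PI[of "{#}" "{#}"] by (simp add: zero_prod_def)
  have Pd: "p - q \<in> P" if pq: "p \<in> P" "q \<in> P" for p q
  proof -
    obtain A B A' B' where *: "p = (cnt A - cnt B, H A - H B)" "q = (cnt A' - cnt B', H A' - H B')"
      "set_mset A \<subseteq> M" "set_mset B \<subseteq> M" "S A = S B"
      "set_mset A' \<subseteq> M" "set_mset B' \<subseteq> M" "S A' = S B'"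
      using pq unfolding P_def by blast
    have "p - q = (cnt (A + B') - cnt (B + A'), H (A + B') - H (B + A'))"
      using un[OF *(3), of B'] un[OF *(4), of A'] * by (simp add: cnt_add algebra_simps)
    moreover have "(cnt (A + B') - cnt (B + A'), H (A + B') - H (B + A')) \<in> P"
      by (rule PI) (use * un[OF *(3), of B'] un[OF *(4), of A'] in auto)
    ultimately show ?thesis by simp
  qed
  have Pf: "r = 0" if r: "(0, r) \<in> P" for r
  proof -
    obtain A B where *: "cnt A - cnt B = 0" "r = H A - H B" using r unfolding P_def by auto
    then show ?thesis using cnt_inj[of A B] by simp
  qed
  obtain K where Kadd: "\<And>x y. K (x + y) = K x + K y" and KP: "\<And>x r. (x, r) \<in> P \<Longrightarrow> K x = r"
    using additive_graph_extends[OF P0 Pd Pf] by blast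
  have "h m n = K (cnt {#m#}) + K (cnt {#n#}) - K (cnt {#m + n#})" if "m \<in> M" "n \<in> M" for m n
  proof -
    have "(cnt {#m, n#} - cnt {#m + n#}, H {#m, n#} - H {#m + n#}) \<in> P"
      by (rule PI) (use that add_in in \<open>auto simp: step S0\<close>)
    then have "(cnt {#m, n#} - cnt {#m + n#}, h m n) \<in> P"
      using that zero_right add_in by (simp add: step S0)
    then have "h m n = K (cnt {#m, n#} - cnt {#m + n#})" using KP by simp
    moreover have "K (cnt {#m, n#} - cnt {#m + n#}) + K (cnt {#m + n#}) = K (cnt {#m, n#})"
      by (simp flip: Kadd)
    moreover have "K (cnt {#m, n#}) = K (cnt {#m#}) + K (cnt {#n#})"
      using Kadd[of "cnt {#m#}" "cnt {#n#}"] by (simp flip: cnt_add add: add_mset_commute)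
    ultimately show ?thesis by simp
  qed
  then show ?thesis by (rule that)
qed

section \<open>Balls, components and ends of a locale\<close>

locale connected_graph =
  fixes E :: "'x rel"
  assumes is_locale: "is_locale UNIV E"
begin

abbreviation dst :: "'x \<Rightarrow> 'x \<Rightarrow> nat" where "dst \<equiv> graph_dist E"

lemma edge_sym: "(x, y) \<in> E \<Longrightarrow> (y, x) \<in> E"
  using is_locale by (auto simp: is_locale_def sym_def)

lemma edge_irrefl: "(x, x) \<notin> E"
  using is_locale by (auto simp: is_locale_def irrefl_def)

lemma finite_neighbours: "finite (E `` {x})"
proof -
  have "finite {e \<in> E. fst e = x \<or> snd e = x}" using is_locale by (auto simp: is_locale_def)
  then have "finite (snd ` {e \<in> E. fst e = x \<or> snd e = x})" by simp
  moreover have "E `` {x} \<subseteq> snd ` {e \<in> E. fst e = x \<or> snd e = x}" by force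
  ultimately show ?thesis by (rule rev_finite_subset)
qed

lemma dst_relpow: "(x, y) \<in> E ^^ dst x y"
proof -
  have "(x, y) \<in> E\<^sup>*" using is_locale by (auto simp: is_locale_def connected_in_def)
  then have "\<exists>n. (x, y) \<in> E ^^ n" by (simp add: rtrancl_power)
  then show ?thesis unfolding graph_dist_def by (rule LeastI_ex)
qed

lemma dst_le: "(x, y) \<in> E ^^ n \<Longrightarrow> dst x y \<le> n"
  unfolding graph_dist_def by (rule Least_le)

lemma dst_self [simp]: "dst x x = 0"
  using dst_le[of x x 0] by simp

lemma relpow_edge_sym: "(x, y) \<in> E ^^ n \<Longrightarrow> (y, x) \<in> E ^^ n"
proof (induction n arbitrary: y)
  case (Suc n)
  then obtain z where "(x, z) \<in> E ^^ n" "(z, y) \<in> E" by auto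
  then show ?case using Suc.IH edge_sym by (meson relpow_Suc_I2)
qed simp

lemma dst_commute: "dst x y = dst y x"
  by (simp add: dst_le dst_relpow relpow_edge_sym order_antisym)

lemma dst_triangle: "dst x z \<le> dst x y + dst y z"
  by (rule dst_le) (use dst_relpow[of x y] dst_relpow[of y z] in \<open>auto simp: relpow_add\<close>)

lemma dst_intermediate:
  assumes "j \<le> dst x y"
  obtains z where "dst x z = j"
proof -
  have "(x, y) \<in> E ^^ (j + (dst x y - j))" using assms dst_relpow by simp
  then have "(x, y) \<in> E ^^ j O E ^^ (dst x y - j)" by (simp only: relpow_add)
  then obtain z where z: "(x, z) \<in> E ^^ j" "(z, y) \<in> E ^^ (dst x y - j)" by blast
  have "dst x z = j" using dst_le[OF z(1)] dst_le[OF z(2)] dst_triangle[of x y z] assms by linarith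
  then show ?thesis by (rule that)
qed

definition nball :: "'x \<Rightarrow> nat \<Rightarrow> 'x set" where
  "nball x n = {y. dst x y \<le> n}"

lemma graph_ball_nball: "R \<ge> 0 \<Longrightarrow> graph_ball E x R = nball x (nat \<lfloor>R\<rfloor>)"
  by (auto simp: graph_ball_def nball_def le_nat_floor) (metis le_nat_iff le_floor_iff nat_0_le of_int_of_nat_eq zero_le_floor)

lemma nball_mono: "m \<le> n \<Longrightarrow> nball x m \<subseteq> nball x n"
  by (auto simp: nball_def)

lemma finite_nball: "finite (nball x n)"
proof (induction n)
  case 0
  have "y = x" if "dst x y = 0" for y using dst_relpow[of x y] that by simp
  then have "nball x 0 \<subseteq> {x}" by (auto simp: nball_def)
  then show ?case by (rule finite_subset) simp
next
  case (Suc n)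
  have "nball x (Suc n) \<subseteq> nball x n \<union> (\<Union>z\<in>nball x n. E `` {z})"
  proof
    fix y assume y: "y \<in> nball x (Suc n)"
    show "y \<in> nball x n \<union> (\<Union>z\<in>nball x n. E `` {z})"
    proof (cases "dst x y \<le> n")
      case False
      then have "dst x y = Suc n" using y by (simp add: nball_def)
      then have "(x, y) \<in> E ^^ n O E" using dst_relpow[of x y] by simp
      then obtain z where "(x, z) \<in> E ^^ n" "(z, y) \<in> E" by blast
      then show ?thesis using dst_le[of x z n] by (auto simp: nball_def)
    qed (simp add: nball_def)
  qed
  then show ?case using Suc finite_neighbours by (meson finite_UN_I finite_UnI finite_subset)
qed

lemma finite_subset_nball:
  assumes "finite A"
  obtains n where "A \<subseteq> nball x n"
proof
  show "A \<subseteq> nball x (Max (insert 0 (dst x ` A)))"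
    using assms by (auto simp: nball_def intro!: Max_ge)
qed

lemma Restr_sym:
  assumes "(x, y) \<in> (Restr E A)\<^sup>*"
  shows "(y, x) \<in> (Restr E A)\<^sup>*"
proof -
  have "sym (Restr E A)" by (rule symI) (auto intro: edge_sym)
  then show ?thesis using assms by (metis symD sym_rtrancl)
qed

lemma Restr_rtrancl_mono: "(x, y) \<in> (Restr E A)\<^sup>* \<Longrightarrow> A \<subseteq> B \<Longrightarrow> (x, y) \<in> (Restr E B)\<^sup>*"
  by (rule subsetD[OF rtrancl_mono]) auto

lemma connected_Un:
  assumes "connected_in E A" "connected_in E B" "z \<in> A" "z \<in> B"
  shows "connected_in E (A \<union> B)"
proof -
  have z: "(u, z) \<in> (Restr E (A \<union> B))\<^sup>*" if "u \<in> A \<union> B" for u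
    using that assms Restr_rtrancl_mono[of u z A "A \<union> B"] Restr_rtrancl_mono[of u z B "A \<union> B"]
    by (auto simp: connected_in_def)
  show ?thesis unfolding connected_in_def
    using z Restr_sym[OF z] by (meson rtrancl_trans)
qed

lemma connected_edge:
  assumes "(x, y) \<in> E"
  shows "connected_in E {x, y}"
proof -
  have "(x, y) \<in> Restr E {x, y}" "(y, x) \<in> Restr E {x, y}" using assms edge_sym[OF assms] by auto
  then show ?thesis unfolding connected_in_def by blast
qed

lemma connected_singleton: "connected_in E {x}"
  by (auto simp: connected_in_def)

lemma path_in_finite_connected:
  assumes "(x, y) \<in> (Restr E A)\<^sup>*" "x \<in> A"
  shows "\<exists>P. finite P \<and> P \<subseteq> A \<and> connected_in E P \<and> x \<in> P \<and> y \<in> P"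
  using assms
proof (induction rule: rtrancl_induct)
  case base
  then show ?case using connected_singleton by (intro exI[of _ "{x}"]) auto
next
  case (step y z)
  then obtain P where P: "finite P" "P \<subseteq> A" "connected_in E P" "x \<in> P" "y \<in> P" by blast
  have "connected_in E (P \<union> {y, z})"
    by (rule connected_Un[OF P(3) connected_edge P(5)]) (use step in auto)
  moreover have "z \<in> A" using step by auto
  ultimately show ?case using P by (intro exI[of _ "P \<union> {y, z}"]) auto
qed

lemma finite_connected_superset:
  assumes "finite A" "A \<subseteq> W" "connected_in E W"
  shows "\<exists>Y. finite Y \<and> A \<subseteq> Y \<and> Y \<subseteq> W \<and> connected_in E Y"
  using assms(1,2)
proof (induction A)
  case empty
  then show ?case by (intro exI[of _ "{}"]) (auto simp: connected_in_def)
next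
  case (insert a A)
  then obtain Y where Y: "finite Y" "A \<subseteq> Y" "Y \<subseteq> W" "connected_in E Y" by auto
  show ?case
  proof (cases "Y = {}")
    case True
    then show ?thesis using Y insert connected_singleton by (intro exI[of _ "{a}"]) auto
  next
    case False
    then obtain y where y: "y \<in> Y" by auto
    then have "(y, a) \<in> (Restr E W)\<^sup>*" using assms(3) Y insert by (auto simp: connected_in_def)
    then obtain P where P: "finite P" "P \<subseteq> W" "connected_in E P" "y \<in> P" "a \<in> P"
      using path_in_finite_connected[of y a W] y Y by blast
    then show ?thesis using connected_Un[OF Y(4) P(3) y P(4)] Y
      by (intro exI[of _ "Y \<union> P"]) auto
  qed
qed

lemma far_path_avoids_ball:
  assumes "(y, z) \<in> E ^^ n" "dst x y > k + n"
  shows "(y, z) \<in> (Restr E (- nball x k))\<^sup>*"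
  using assms
proof (induction n arbitrary: z)
  case (Suc n)
  from Suc.prems(1) obtain w where w: "(y, w) \<in> E ^^ n" "(w, z) \<in> E" by (rule relpow_Suc_E)
  have "dst y w \<le> n" "dst y z \<le> Suc n" using dst_le[OF w(1)] dst_le[OF Suc.prems(1)] by auto
  then have "dst x w > k" "dst x z > k"
    using Suc.prems(2) dst_triangle[of x y w] dst_triangle[of x y z] dst_commute[of w y] dst_commute[of z y]
    by linarith+
  then have "(w, z) \<in> Restr E (- nball x k)" using w by (auto simp: nball_def)
  moreover have "(y, w) \<in> (Restr E (- nball x k))\<^sup>*" using Suc.IH[OF w(1)] Suc.prems(2) by simp
  ultimately show ?case by (rule rtrancl_into_rtrancl[rotated])
qed auto

lemma relpow_in_ball:
  "(x, y) \<in> E ^^ m \<Longrightarrow> m \<le> n \<Longrightarrow> (x, y) \<in> (Restr E (nball x n))\<^sup>*"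
proof (induction m arbitrary: y)
  case (Suc m)
  from Suc.prems(1) obtain w where w: "(x, w) \<in> E ^^ m" "(w, y) \<in> E" by (rule relpow_Suc_E)
  have "dst x w \<le> n" "dst x y \<le> n" using dst_le[OF w(1)] dst_le[OF Suc.prems(1)] Suc.prems by auto
  then have "(w, y) \<in> Restr E (nball x n)" using w by (auto simp: nball_def)
  moreover have "(x, w) \<in> (Restr E (nball x n))\<^sup>*" using Suc.IH[OF w(1)] Suc.prems(2) by simp
  ultimately show ?case by (rule rtrancl_into_rtrancl[rotated])
qed auto

lemma connected_nball: "connected_in E (nball x n)"
proof -
  have "(x, y) \<in> (Restr E (nball x n))\<^sup>*" if "y \<in> nball x n" for y
    using that relpow_in_ball[OF dst_relpow] by (auto simp: nball_def)
  then show ?thesis unfolding connected_in_def using Restr_sym by (meson rtrancl_trans)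
qed

lemma component_subset: "C \<in> graph_components E A \<Longrightarrow> C \<subseteq> A"
proof -
  have "y \<in> A" if "(x, y) \<in> (Restr E A)\<^sup>*" "x \<in> A" for x y
    using that by (induction rule: rtrancl_induct) auto
  then show "C \<in> graph_components E A \<Longrightarrow> C \<subseteq> A" by (auto simp: graph_components_def)
qed

lemma component_nonempty: "C \<in> graph_components E A \<Longrightarrow> C \<noteq> {}"
  by (auto simp: graph_components_def)

lemma component_absorbs:
  assumes C: "C \<in> graph_components E A" and D: "connected_in E D" "D \<subseteq> A" "z \<in> C" "z \<in> D"
  shows "D \<subseteq> C"
proof
  fix y assume "y \<in> D"
  then have "(z, y) \<in> (Restr E A)\<^sup>*"
    using D Restr_rtrancl_mono[of z y D A] by (auto simp: connected_in_def)
  then show "y \<in> C" using C D(3) by (auto simp: graph_components_def)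
qed

lemma connected_component:
  assumes "C \<in> graph_components E A"
  shows "connected_in E C"
proof -
  obtain x where x: "x \<in> A" "C = (Restr E A)\<^sup>* `` {x}" using assms
    by (auto simp: graph_components_def)
  have "(x, y) \<in> (Restr E C)\<^sup>*" if "y \<in> C" for y
  proof -
    from that have "(x, y) \<in> (Restr E A)\<^sup>*" using x by auto
    then obtain P where P: "P \<subseteq> A" "connected_in E P" "x \<in> P" "y \<in> P"
      using path_in_finite_connected x(1) by blast
    have "P \<subseteq> C" by (rule component_absorbs[OF assms P(2,1) _ P(3)]) (use x in auto)
    moreover have "(x, y) \<in> (Restr E P)\<^sup>*" using P by (auto simp: connected_in_def)
    ultimately show ?thesis by (metis Restr_rtrancl_mono)
  qed
  then show ?thesis unfolding connected_in_def using Restr_sym by (meson rtrancl_trans)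
qed

lemma component_exists:
  assumes "x \<in> A"
  obtains C where "C \<in> graph_components E A" "x \<in> C"
  using assms by (auto simp: graph_components_def)

lemma component_eq:
  assumes "C \<in> graph_components E A" "D \<in> graph_components E A" "z \<in> C" "z \<in> D"
  shows "C = D"
  using assms component_absorbs connected_component component_subset by (metis subset_antisym)

lemma component_nested:
  assumes "C \<in> graph_components E A" "D \<in> graph_components E B" "B \<subseteq> A" "z \<in> C" "z \<in> D"
  shows "D \<subseteq> C"
  by (rule component_absorbs[OF assms(1) connected_component[OF assms(2)] _ assms(4,5)])
    (use component_subset[OF assms(2)] assms(3) in auto)

end

text \<open>The ends of a graph in the sense of Freudenthal, seen from a base vertex.\<close>

definition is_end :: "'x rel \<Rightarrow> 'x \<Rightarrow> (nat \<Rightarrow> 'x set) \<Rightarrow> bool" where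
  "is_end E x0 C \<longleftrightarrow>
     (\<forall>n. C n \<in> graph_components E (- graph_ball E x0 (real n)) \<and> C (Suc n) \<subseteq> C n)"

locale weakly_transferable_graph = connected_graph E for E :: "'x rel" +
  assumes weakly_transferable: "weakly_transferable E"
begin

lemma component_infinite:
  assumes "C \<in> graph_components E (- nball x n)"
  shows "infinite C"
proof -
  \<comment> \<open>Weak transferability concerns balls of positive radius, and \<open>n\<close> may be \<open>0\<close>.\<close>
  have "graph_ball E x (real n + 1/2) = nball x n"
    by (auto simp: graph_ball_def nball_def)
  moreover have "real n + 1/2 > 0" by simp
  ultimately show ?thesis using assms weakly_transferable
    unfolding weakly_transferable_def Let_def by metis
qed

lemma infinite_vertices: "infinite (UNIV :: 'x set)"
proof -
  have "graph_components E (- graph_ball E undefined 1) \<noteq> {}"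
    and inf: "\<forall>C\<in>graph_components E (- graph_ball E undefined 1). infinite C"
    using weakly_transferable unfolding weakly_transferable_def Let_def by (meson zero_less_one)+
  then obtain C where "C \<in> graph_components E (- graph_ball E undefined 1)" by auto
  then have "infinite C" using inf by simp
  then show ?thesis using finite_subset[OF subset_UNIV] by blast
qed

lemma far_vertex: obtains y where "dst x y > n"
proof -
  have "nball x n \<noteq> UNIV" using finite_nball infinite_vertices by metis
  then obtain y where "y \<notin> nball x n" by blast
  then show ?thesis using that[of y] by (simp add: nball_def)
qed

lemma card_nball: "card (nball x n) > n"
proof -
  obtain y where y: "dst x y > n" by (rule far_vertex)
  have "{..n} \<subseteq> dst x ` nball x n"
  proof
    fix j assume j: "j \<in> {..n}"
    then obtain z where "dst x z = j" using dst_intermediate[of j x y] y by auto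
    then show "j \<in> dst x ` nball x n" using j by (auto simp: nball_def)
  qed
  then have "card {..n} \<le> card (nball x n)" by (meson finite_nball surj_card_le)
  then show ?thesis by simp
qed

abbreviation "components_off x n \<equiv> graph_components E (- nball x n)"

lemma is_end_iff: "is_end E x0 C \<longleftrightarrow> (\<forall>n. C n \<in> components_off x0 n \<and> C (Suc n) \<subseteq> C n)"
  by (simp add: is_end_def graph_ball_nball)

lemma end_component: "is_end E x0 C \<Longrightarrow> C n \<in> components_off x0 n"
  by (simp add: is_end_iff)

lemma end_antimono: "is_end E x0 C \<Longrightarrow> m \<le> n \<Longrightarrow> C n \<subseteq> C m"
  by (rule lift_Suc_antimono_le) (simp add: is_end_iff)

lemma end_outside: "is_end E x0 C \<Longrightarrow> y \<in> C n \<Longrightarrow> dst x0 y > n"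
  using component_subset[OF end_component] by (force simp: nball_def)

lemma end_connected: "is_end E x0 C \<Longrightarrow> connected_in E (C n)"
  using end_component connected_component by blast

lemma end_infinite: "is_end E x0 C \<Longrightarrow> infinite (C n)"
  using end_component component_infinite by blast

text \<open>Below level \<open>n\<close> the end is forced by \<open>K\<close>. Above it, each component is infinite and therefore
  contains a component of the next level.\<close>

lemma end_through_component:
  assumes K: "K \<in> components_off x0 n"
  obtains C where "is_end E x0 C" "C n = K"
proof -
  define P where "P = (\<lambda>j A. A \<in> components_off x0 j \<and> (j \<le> n \<longrightarrow> K \<subseteq> A))"
  obtain z where z: "z \<in> K" using component_nonempty[OF K] by auto
  have zo: "dst x0 z > n" using component_subset[OF K] z by (auto simp: nball_def)
  have "\<exists>C. \<forall>j. P j (C j) \<and> C (Suc j) \<subseteq> C j"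
  proof (rule dependent_nat_choice)
    have "z \<in> - nball x0 0" using zo by (auto simp: nball_def)
    then obtain A where A: "A \<in> components_off x0 0" "z \<in> A" by (rule component_exists)
    have "K \<subseteq> A" by (rule component_nested[OF A(1) K _ A(2) z]) (auto simp: nball_def)
    then show "\<exists>A. P 0 A" using A by (auto simp: P_def)
  next
    fix A j assume A: "P j A"
    have A1: "A \<in> components_off x0 j" using A by (simp add: P_def)
    have "\<exists>y \<in> A. dst x0 y > Suc j \<and> (Suc j \<le> n \<longrightarrow> y = z)"
    proof (cases "Suc j \<le> n")
      case True
      then show ?thesis using A z zo by (intro bexI[of _ z]) (auto simp: P_def)
    next
      case False
      have "\<not> A \<subseteq> nball x0 (Suc j)" using component_infinite[OF A1] finite_nball finite_subset
        by blast
      then obtain y where "y \<in> A" "y \<notin> nball x0 (Suc j)" by blast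
      then show ?thesis using False by (intro bexI[of _ y]) (simp_all add: nball_def)
    qed
    then obtain y where y: "y \<in> A" "dst x0 y > Suc j" "Suc j \<le> n \<longrightarrow> y = z" by blast
    then have "y \<in> - nball x0 (Suc j)" by (auto simp: nball_def)
    then obtain B where B: "B \<in> components_off x0 (Suc j)" "y \<in> B" by (rule component_exists)
    have "B \<subseteq> A" by (rule component_nested[OF A1 B(1) _ y(1) B(2)]) (auto simp: nball_def)
    moreover have "K \<subseteq> B" if "Suc j \<le> n"
      by (rule component_nested[OF B(1) K, of z]) (use that y B z in \<open>auto simp: nball_def\<close>)
    ultimately show "\<exists>B. P (Suc j) B \<and> B \<subseteq> A" using B by (auto simp: P_def)
  qed
  then obtain C where C: "\<And>j. P j (C j)" "\<And>j. C (Suc j) \<subseteq> C j" by blast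
  have "C n = K" using C(1)[of n] component_eq[OF _ K, of "C n" z] z by (auto simp: P_def)
  moreover have "is_end E x0 C" using C by (auto simp: is_end_iff P_def)
  ultimately show ?thesis using that by blast
qed

lemma end_in_component:
  assumes D: "D \<in> components_off x r"
  obtains C n where "is_end E x0 C" "C n \<subseteq> D"
proof -
  obtain n where n: "nball x r \<subseteq> nball x0 n" using finite_subset_nball[OF finite_nball] by blast
  have "\<not> D \<subseteq> nball x0 n" using component_infinite[OF D] finite_nball finite_subset by blast
  then obtain y where y: "y \<in> D" "y \<in> - nball x0 n" by auto
  obtain K where K: "K \<in> components_off x0 n" "y \<in> K" using component_exists[OF y(2)] .
  have "K \<subseteq> D" by (rule component_nested[OF D K(1) _ y(1) K(2)]) (use n in auto)
  moreover obtain C where "is_end E x0 C" "C n = K" using end_through_component[OF K(1)] .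
  ultimately show ?thesis using that by blast
qed

lemma end_exists: obtains C where "is_end E x0 C"
proof -
  obtain y where "dst x0 y > 0" by (rule far_vertex)
  then have "y \<in> - nball x0 0" by (auto simp: nball_def)
  then obtain K where "K \<in> components_off x0 0" by (rule component_exists)
  then show ?thesis using end_through_component that by metis
qed

lemma distinct_ends_separate:
  assumes "is_end E x0 C" "is_end E x0 C'" "C \<noteq> C'"
  obtains k where "C k \<inter> C' k = {}"
proof -
  obtain k where "C k \<noteq> C' k" using assms(3) by blast
  then have "C k \<inter> C' k = {}"
    using component_eq[OF end_component[OF assms(1)] end_component[OF assms(2)], of _ k] by blast
  then show ?thesis by (rule that)
qed

lemma separated_ends_far:
  assumes e: "is_end E x0 C" "is_end E x0 C'" and k: "C k \<inter> C' k = {}"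
    and x: "x \<in> C (k + r)" and y: "y \<in> C' (k + r)"
  shows "dst x y > r"
proof (rule ccontr)
  assume "\<not> dst x y > r"
  then have "dst x0 x > k + dst x y" using end_outside[OF e(1) x] by simp
  then have p: "(x, y) \<in> (Restr E (- nball x0 k))\<^sup>*" using far_path_avoids_ball[OF dst_relpow]
    by blast
  have "x \<in> C k" "y \<in> C' k"
    using x y end_antimono[OF e(1), of k "k + r"] end_antimono[OF e(2), of k "k + r"]
    by auto
  moreover have "y \<in> C k"
    using p \<open>x \<in> C k\<close> end_component[OF e(1), of k] unfolding graph_components_def
    by (blast intro: rtrancl_trans)
  ultimately show False using k by auto
qed

text \<open>Every component of the complement of a ball contains a tail of an end.\<close>

lemma unique_end_connected:
  assumes C: "is_end E x0 C" and uniq: "\<And>C'. is_end E x0 C' \<Longrightarrow> C' = C"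
  shows "connected_in E (- nball x r)"
proof -
  have "y \<in> D" if D: "D \<in> components_off x r" and y: "y \<in> - nball x r" for D y
  proof -
    obtain D' where D': "D' \<in> components_off x r" "y \<in> D'" using component_exists[OF y] .
    obtain n n' where n: "C n \<subseteq> D" "C n' \<subseteq> D'"
      using end_in_component[OF D, of x0] end_in_component[OF D'(1), of x0] uniq by metis
    have "C (max n n') \<subseteq> D" "C (max n n') \<subseteq> D'"
      using n end_antimono[OF C, of n "max n n'"] end_antimono[OF C, of n' "max n n'"] by auto
    moreover obtain z where "z \<in> C (max n n')" using component_nonempty[OF end_component[OF C]]
      by blast
    ultimately have "D = D'" using component_eq[OF D D'(1)] by blast
    then show ?thesis using D' by simp
  qed
  then have "connected_in E (- nball x r) \<or> - nball x r = {}"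
    by (metis component_exists component_subset connected_component ex_in_conv subsetI subset_antisym)
  then show ?thesis by (auto simp: connected_in_def)
qed

end

section \<open>Configurations, charges and exchanges\<close>

text \<open>The charge collects the total values of all conserved quantities. It is a function on all maps
  from states to reals, with the value \<open>0\<close> off the conserved quantities, so that charges are elements
  of a vector space and two configurations with the same totals have equal charges.\<close>

definition charge :: "'s \<Rightarrow> ('s \<times> 's \<Rightarrow> 's \<times> 's) \<Rightarrow> ('x \<Rightarrow> 's) \<Rightarrow> ('s \<Rightarrow> real) \<Rightarrow> real" where
  "charge b \<phi> \<eta> = (\<lambda>\<xi>. if \<xi> \<in> consv b \<phi> then \<Sum>x | \<eta> x \<noteq> b. \<xi> (\<eta> x) else 0)"

definition overlay :: "'s \<Rightarrow> ('x \<Rightarrow> 's) \<Rightarrow> ('x \<Rightarrow> 's) \<Rightarrow> 'x \<Rightarrow> 's" where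
  "overlay b \<alpha> \<beta> = (\<lambda>x. if \<alpha> x \<noteq> b then \<alpha> x else \<beta> x)"

definition moves :: "'x rel \<Rightarrow> ('s \<times> 's \<Rightarrow> 's \<times> 's) \<Rightarrow> 'x set \<Rightarrow> ('x \<Rightarrow> 's) rel" where
  "moves E \<phi> W = {(\<eta>, exchange \<phi> e \<eta>) | \<eta> e. e \<in> E \<and> fst e \<in> W \<and> snd e \<in> W}"

lemma exchange_other: "x \<noteq> fst e \<Longrightarrow> x \<noteq> snd e \<Longrightarrow> exchange \<phi> e \<eta> x = \<eta> x"
  by (simp add: exchange_def Let_def)

lemma exchange_apply:
  "y \<noteq> x \<Longrightarrow> exchange \<phi> (x, y) \<eta> =
    \<eta>(x := fst (\<phi> (\<eta> x, \<eta> y)), y := snd (\<phi> (\<eta> x, \<eta> y)))"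
  by (simp add: exchange_def Let_def)

lemma consv_base: "\<xi> \<in> consv b \<phi> \<Longrightarrow> \<xi> b = 0"
  by (simp add: consv_def)

lemma fin_configs_finite: "\<eta> \<in> fin_configs b \<longleftrightarrow> finite {x. \<eta> x \<noteq> b}"
  by (simp add: fin_configs_def)

lemma base_fin_config: "(\<lambda>_. b) \<in> fin_configs b"
  by (simp add: fin_configs_def)

lemma fin_configs_upd: "\<eta> \<in> fin_configs b \<Longrightarrow> \<eta>(x := s) \<in> fin_configs b"
  unfolding fin_configs_def mem_Collect_eq
  by (rule finite_subset[of _ "insert x {x. \<eta> x \<noteq> b}"]) auto

lemma fin_configs_exchange: "\<eta> \<in> fin_configs b \<Longrightarrow> exchange \<phi> e \<eta> \<in> fin_configs b"
  by (simp add: exchange_def Let_def fin_configs_upd)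

lemma fin_configs_restrict: "\<eta> \<in> fin_configs b \<Longrightarrow> (\<lambda>x. if P x then \<eta> x else b) \<in> fin_configs b"
  unfolding fin_configs_def mem_Collect_eq by (rule finite_subset[of _ "{x. \<eta> x \<noteq> b}"]) auto

lemma fin_configs_split:
  "\<eta> \<in> fin_configs b \<Longrightarrow> \<zeta> \<in> fin_configs b \<Longrightarrow> (\<lambda>x. if P x then \<eta> x else \<zeta> x) \<in> fin_configs b"
  unfolding fin_configs_def mem_Collect_eq
  by (rule finite_subset[of _ "{x. \<eta> x \<noteq> b} \<union> {x. \<zeta> x \<noteq> b}"]) auto

lemma fin_configs_overlay: "\<alpha> \<in> fin_configs b \<Longrightarrow> \<beta> \<in> fin_configs b \<Longrightarrow> overlay b \<alpha> \<beta> \<in> fin_configs b"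
  unfolding overlay_def by (rule fin_configs_split)

lemma overlay_supp: "{x. overlay b \<alpha> \<beta> x \<noteq> b} = {x. \<alpha> x \<noteq> b} \<union> {x. \<beta> x \<noteq> b}"
  by (auto simp: overlay_def)

lemma charge_superset:
  assumes "finite A" "{x. \<eta> x \<noteq> b} \<subseteq> A" "\<xi> \<in> consv b \<phi>"
  shows "charge b \<phi> \<eta> \<xi> = (\<Sum>x\<in>A. \<xi> (\<eta> x))"
proof -
  have "(\<Sum>x | \<eta> x \<noteq> b. \<xi> (\<eta> x)) = (\<Sum>x\<in>A. \<xi> (\<eta> x))"
    by (rule sum.mono_neutral_left) (use assms consv_base in auto)
  then show ?thesis using assms by (simp add: charge_def)
qed

lemma charge_base: "charge b \<phi> (\<lambda>_. b) = 0"
  by (auto simp: charge_def)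

lemma charge_overlay:
  assumes "\<alpha> \<in> fin_configs b" "\<beta> \<in> fin_configs b" "\<And>x. \<alpha> x = b \<or> \<beta> x = b"
  shows "charge b \<phi> (overlay b \<alpha> \<beta>) = charge b \<phi> \<alpha> + charge b \<phi> \<beta>"
proof
  fix \<xi>
  show "charge b \<phi> (overlay b \<alpha> \<beta>) \<xi> = (charge b \<phi> \<alpha> + charge b \<phi> \<beta>) \<xi>"
  proof (cases "\<xi> \<in> consv b \<phi>")
    case True
    define A where "A = {x. \<alpha> x \<noteq> b} \<union> {x. \<beta> x \<noteq> b}"
    have A: "finite A" using assms by (simp add: A_def fin_configs_finite)
    have "\<xi> (overlay b \<alpha> \<beta> x) = \<xi> (\<alpha> x) + \<xi> (\<beta> x)" for x
      using assms(3)[of x] consv_base[OF True] by (auto simp: overlay_def)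
    then show ?thesis using charge_superset[OF A _ True] overlay_supp[of b \<alpha> \<beta>]
      by (simp add: A_def sum.distrib)
  qed (simp add: charge_def)
qed

lemma charge_exchange:
  assumes \<eta>: "\<eta> \<in> fin_configs b" and xy: "x \<noteq> y"
  shows "charge b \<phi> (exchange \<phi> (x, y) \<eta>) = charge b \<phi> \<eta>"
proof
  fix \<xi>
  show "charge b \<phi> (exchange \<phi> (x, y) \<eta>) \<xi> = charge b \<phi> \<eta> \<xi>"
  proof (cases "\<xi> \<in> consv b \<phi>")
    case True
    let ?\<eta> = "exchange \<phi> (x, y) \<eta>"
    define A where "A = {x. \<eta> x \<noteq> b} - {x, y}"
    have A: "finite (insert x (insert y A))" "x \<notin> insert y A" "y \<notin> A" "finite A"
      using \<eta> xy by (auto simp: A_def fin_configs_finite)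
    have sub: "{z. \<eta> z \<noteq> b} \<subseteq> insert x (insert y A)" "{z. ?\<eta> z \<noteq> b} \<subseteq> insert x (insert y A)"
      using xy by (auto simp: A_def exchange_apply)
    have "(\<Sum>z\<in>A. \<xi> (?\<eta> z)) = (\<Sum>z\<in>A. \<xi> (\<eta> z))"
      by (rule sum.cong) (auto simp: A_def exchange_other)
    moreover have "\<xi> (?\<eta> x) + \<xi> (?\<eta> y) = \<xi> (\<eta> x) + \<xi> (\<eta> y)"
      using True xy by (simp add: exchange_apply consv_def)
    ultimately show ?thesis
      using charge_superset[OF A(1) sub(1) True] charge_superset[OF A(1) sub(2) True] A by simp
  qed (simp add: charge_def)
qed

text \<open>The charge depends on the states that occur, but not on their positions.\<close>

lemma charge_realized_in:
  assumes \<alpha>: "\<alpha> \<in> fin_configs b" and W: "infinite W \<or> card {x. \<alpha> x \<noteq> b} \<le> card W"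
  obtains \<beta> where "\<beta> \<in> fin_configs b" "{x. \<beta> x \<noteq> b} \<subseteq> W" "charge b \<phi> \<beta> = charge b \<phi> \<alpha>"
proof -
  let ?S = "{x. \<alpha> x \<noteq> b}"
  have S: "finite ?S" using \<alpha> by (simp add: fin_configs_finite)
  have "\<exists>B\<subseteq>W. finite B \<and> card B = card ?S"
  proof (cases "infinite W")
    case True
    then show ?thesis using infinite_arbitrarily_large by metis
  next
    case False
    then show ?thesis using W obtain_subset_with_card_n by metis
  qed
  then obtain B where B: "B \<subseteq> W" "finite B" "card B = card ?S" by blast
  then obtain g where g: "bij_betw g B ?S" using finite_same_card_bij[OF B(2) S] by auto
  define \<beta> where "\<beta> = (\<lambda>x. if x \<in> B then \<alpha> (g x) else b)"
  have sub: "{x. \<beta> x \<noteq> b} \<subseteq> B" by (auto simp: \<beta>_def)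
  have "charge b \<phi> \<beta> = charge b \<phi> \<alpha>"
  proof
    fix \<xi>
    show "charge b \<phi> \<beta> \<xi> = charge b \<phi> \<alpha> \<xi>"
    proof (cases "\<xi> \<in> consv b \<phi>")
      case True
      have "(\<Sum>x\<in>B. \<xi> (\<beta> x)) = (\<Sum>x\<in>B. \<xi> (\<alpha> (g x)))" by (rule sum.cong) (auto simp: \<beta>_def)
      also have "\<dots> = (\<Sum>x\<in>?S. \<xi> (\<alpha> x))" by (rule sum.reindex_bij_betw[OF g])
      finally show ?thesis using charge_superset[OF B(2) sub True] True by (simp add: charge_def)
    qed (simp add: charge_def)
  qed
  then show ?thesis using that[of \<beta>] sub B finite_subset[OF sub] by (auto simp: fin_configs_finite)
qed


section \<open>Potentials of closed forms\<close>

inductive walk :: "'v rel \<Rightarrow> ('v \<times> 'v \<Rightarrow> real) \<Rightarrow> 'v \<Rightarrow> 'v \<Rightarrow> real \<Rightarrow> bool" for T \<omega> u where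
  stay: "walk T \<omega> u u 0"
| step: "walk T \<omega> u v r \<Longrightarrow> (v, w) \<in> T \<Longrightarrow> walk T \<omega> u w (r + \<omega> (v, w))"

lemma walk_trans:
  assumes "walk T \<omega> v w s" "walk T \<omega> u v r"
  shows "walk T \<omega> u w (r + s)"
  using assms
proof (induction rule: walk.induct)
  case (step w s z)
  then show ?case using walk.step[of T \<omega> u w "r + s" z] by (simp add: add.assoc)
qed simp

lemma walk_edge: "(v, w) \<in> T \<Longrightarrow> walk T \<omega> v w (\<omega> (v, w))"
  using walk.step[OF walk.stay] by fastforce

lemma walk_reverse:
  assumes "walk T \<omega> u v r" and sym: "\<And>v w. (v, w) \<in> T \<Longrightarrow> (w, v) \<in> T \<and> \<omega> (w, v) = - \<omega> (v, w)"
  shows "walk T \<omega> v u (- r)"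
  using assms(1)
proof (induction rule: walk.induct)
  case stay
  then show ?case using walk.stay by simp
next
  case (step v r w)
  have "walk T \<omega> w v (- \<omega> (v, w))" using walk_edge[of w v T \<omega>] sym[OF step.hyps(2)] by simp
  from walk_trans[OF step.IH this] show ?case by (simp add: add.commute)
qed

lemma walk_list:
  assumes "walk T \<omega> u v r"
  shows "\<exists>p. set p \<subseteq> T \<and> successively (\<lambda>e e'. snd e = fst e') p \<and> r = sum_list (map \<omega> p) \<and>
    (p = [] \<longrightarrow> u = v) \<and> (p \<noteq> [] \<longrightarrow> fst (hd p) = u \<and> snd (last p) = v)"
  using assms
proof (induction rule: walk.induct)
  case (step v r w)
  then obtain p where "set p \<subseteq> T \<and> successively (\<lambda>e e'. snd e = fst e') p \<and> r = sum_list (map \<omega> p) \<and>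
    (p = [] \<longrightarrow> u = v) \<and> (p \<noteq> [] \<longrightarrow> fst (hd p) = u \<and> snd (last p) = v)" by blast
  then show ?case using step.hyps
    by (intro exI[of _ "p @ [(v, w)]"]) (auto simp: successively_append_iff hd_append)
qed (intro exI[of _ "[]"], simp)

text \<open>A form whose sums along closed paths vanish is the differential of the function that sums the
  form along any path from a chosen vertex in each connected component.\<close>

lemma potential_exists:
  assumes sym: "\<And>v w. (v, w) \<in> T \<Longrightarrow> (w, v) \<in> T \<and> \<omega> (w, v) = - \<omega> (v, w)"
    and closed: "\<And>p. closed_edge_path T p \<Longrightarrow> sum_list (map \<omega> p) = 0"
  obtains f :: "'v \<Rightarrow> real" where "\<And>v w. (v, w) \<in> T \<Longrightarrow> \<omega> (v, w) = f w - f v"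
proof -
  have loop: "r = 0" if w: "walk T \<omega> u u r" for u r
  proof -
    obtain p where p: "set p \<subseteq> T" "successively (\<lambda>e e'. snd e = fst e') p" "r = sum_list (map \<omega> p)"
      "p \<noteq> [] \<longrightarrow> fst (hd p) = u \<and> snd (last p) = u" using walk_list[OF w] by blast
    then have "closed_edge_path T p" by (auto simp: closed_edge_path_def)
    then show ?thesis using closed p by simp
  qed
  define base where "base = (\<lambda>v. SOME u. \<exists>r. walk T \<omega> u v r)"
  define f where "f = (\<lambda>v. SOME r. walk T \<omega> (base v) v r)"
  have f: "walk T \<omega> (base v) v (f v)" for v
  proof -
    have "\<exists>r. walk T \<omega> v v r" by (rule exI[of _ 0], rule walk.stay)
    then have "\<exists>u r. walk T \<omega> u v r" by (rule exI)
    then have "\<exists>r. walk T \<omega> (base v) v r" unfolding base_def by (rule someI_ex)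
    then show ?thesis unfolding f_def by (rule someI_ex)
  qed
  have "\<omega> (v, w) = f w - f v" if e: "(v, w) \<in> T" for v w
  proof -
    have "(\<exists>r. walk T \<omega> u v r) \<longleftrightarrow> (\<exists>r. walk T \<omega> u w r)" for u
      using walk.step[of T \<omega> u v _ w] walk.step[of T \<omega> u w _ v] sym[OF e] e by blast
    then have "base v = base w" by (simp add: base_def)
    moreover have "walk T \<omega> (base v) w (f v + \<omega> (v, w))" using walk.step[OF f e] .
    ultimately have "walk T \<omega> (base v) (base v) ((f v + \<omega> (v, w)) + - f w)"
      using walk_trans[OF walk_reverse[OF f[of w] sym]] by metis
    then show ?thesis using loop by fastforce
  qed
  then show ?thesis by (rule that)
qed


section \<open>Exchanges inside a connected set\<close>

lemma rtrancl_image: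
  assumes "(x, y) \<in> r\<^sup>*" and step: "\<And>x y. (x, y) \<in> r \<Longrightarrow> (f x, f y) \<in> s"
  shows "(f x, f y) \<in> s\<^sup>*"
  using assms(1) by (induction rule: rtrancl_induct) (auto intro: rtrancl_into_rtrancl step)

locale interacting_system = weakly_transferable_graph E for E :: "'x rel" +
  fixes b :: 's and \<phi> :: "'s \<times> 's \<Rightarrow> 's \<times> 's"
  assumes interaction: "interaction \<phi>"
    and irreducibly_quantified: "irreducibly_quantified b \<phi>"
begin

abbreviation "fin \<equiv> fin_configs b"
abbreviation "supp \<eta> \<equiv> {x. \<eta> x \<noteq> b}"
abbreviation "chg \<equiv> charge b \<phi>"
abbreviation "T \<equiv> fin_transitions b E \<phi>"

lemma fin_transitions_iff: "(\<eta>, \<eta>') \<in> T \<longleftrightarrow> \<eta> \<in> fin \<and> (\<exists>e\<in>E. \<eta>' = exchange \<phi> e \<eta>)"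
  by (auto simp: fin_transitions_def transitions_def configs_def fin_configs_exchange)

lemma exchange_reverse:
  assumes "x \<noteq> y" "exchange \<phi> (x, y) \<eta> \<noteq> \<eta>"
  shows "exchange \<phi> (y, x) (exchange \<phi> (x, y) \<eta>) = \<eta>"
proof -
  obtain s t where st: "\<phi> (\<eta> x, \<eta> y) = (s, t)" by (cases "\<phi> (\<eta> x, \<eta> y)")
  have "(s, t) \<noteq> (\<eta> x, \<eta> y)" using assms st by (auto simp: exchange_apply)
  then have "prod.swap (\<phi> (prod.swap (s, t))) = (\<eta> x, \<eta> y)"
    using interaction st unfolding interaction_def by metis
  then have "\<phi> (t, s) = (\<eta> y, \<eta> x)" by (metis prod.swap_def swap_simp swap_swap)
  then show ?thesis using assms(1) st by (auto simp: exchange_apply)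
qed

lemma fin_transitions_sym: "(\<eta>, \<eta>') \<in> T \<Longrightarrow> (\<eta>', \<eta>) \<in> T"
proof -
  assume a: "(\<eta>, \<eta>') \<in> T"
  then obtain x y where e: "(x, y) \<in> E" "\<eta>' = exchange \<phi> (x, y) \<eta>" and \<eta>: "\<eta> \<in> fin"
    by (auto simp: fin_transitions_iff)
  show "(\<eta>', \<eta>) \<in> T"
  proof (cases "\<eta>' = \<eta>")
    case False
    then have "exchange \<phi> (y, x) \<eta>' = \<eta>" using exchange_reverse[of x y \<eta>] e edge_irrefl by blast
    then show ?thesis using edge_sym[OF e(1)] e(2) \<eta> fin_configs_exchange
      unfolding fin_transitions_iff
      by metis
  qed (use a in simp)
qed

lemma chg_transition:
  assumes "(\<eta>, \<eta>') \<in> T"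
  shows "chg \<eta>' = chg \<eta>"
proof -
  obtain x y where e: "(x, y) \<in> E" "\<eta>' = exchange \<phi> (x, y) \<eta>" and \<eta>: "\<eta> \<in> fin"
    using assms by (auto simp: fin_transitions_iff)
  have "x \<noteq> y" using e(1) edge_irrefl by auto
  then show ?thesis using charge_exchange[OF \<eta>] e(2) by metis
qed

text \<open>Irreducible quantification concerns finite locales. Two configurations that differ only
  inside a connected set differ only inside a finite connected subset of it.\<close>

lemma moves_if_same_charge:
  assumes W: "connected_in E W" and fin: "\<eta> \<in> fin" "\<eta>' \<in> fin"
    and off: "\<And>x. x \<notin> W \<Longrightarrow> \<eta> x = \<eta>' x" and chg: "chg \<eta> = chg \<eta>'"
  shows "(\<eta>, \<eta>') \<in> (moves E \<phi> W)\<^sup>*"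
proof (cases "\<eta> = \<eta>'")
  case False
  let ?A = "{x. \<eta> x \<noteq> \<eta>' x}"
  have "?A \<subseteq> supp \<eta> \<union> supp \<eta>'" by auto
  moreover have "finite (supp \<eta> \<union> supp \<eta>')" using fin by (simp add: fin_configs_finite)
  ultimately have A: "finite ?A" by (rule finite_subset)
  have AW: "?A \<subseteq> W" using off by auto
  obtain Y where Y: "finite Y" "?A \<subseteq> Y" "Y \<subseteq> W" "connected_in E Y"
    using finite_connected_superset[OF A AW W] by (elim exE conjE)
  have Yne: "Y \<noteq> {}" using False Y(2) by auto
  \<comment> \<open>A copy of the finite locale \<open>Y\<close> on natural numbers\<close>
  obtain i where i: "bij_betw i Y {0..<card Y}" using ex_bij_betw_finite_nat[OF Y(1)] by blast
  define Y' where "Y' = {0..<card Y}"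
  define j where "j = inv_into Y i"
  have ij: "i x \<in> Y'" "j (i x) = x" if "x \<in> Y" for x
    using bij_betwE[OF i] bij_betw_inv_into_left[OF i] that by (simp_all add: Y'_def j_def)
  have ji: "j k \<in> Y" "i (j k) = k" if "k \<in> Y'" for k
    using bij_betwE[OF bij_betw_inv_into[OF i]] bij_betw_inv_into_right[OF i] that
    by (simp_all add: Y'_def j_def)
  have inj: "i x = i y \<longleftrightarrow> x = y" if "x \<in> Y" "y \<in> Y" for x y using ij(2) that by metis
  define F where "F = (\<lambda>(x, y). (i x, i y)) ` Restr E Y"
  have FI: "(i x, i y) \<in> F" if "(x, y) \<in> Restr E Y" for x y using that by (force simp: F_def)
  have FE: "\<exists>x y. k = i x \<and> l = i y \<and> (x, y) \<in> E \<and> x \<in> Y \<and> y \<in> Y" if "(k, l) \<in> F" for k l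
    using that by (auto simp: F_def)
  have FY: "F \<subseteq> Y' \<times> Y'" using ij(1) by (auto simp: F_def)
  have "is_locale Y' F"
    unfolding is_locale_def
  proof (intro conjI ballI)
    show "Y' \<noteq> {}" using Yne ij(1) by blast
    show "F \<subseteq> Y' \<times> Y'" by (rule FY)
    show "sym F"
    proof (rule symI)
      fix k l assume "(k, l) \<in> F"
      then obtain x y where xy: "k = i x" "l = i y" "(x, y) \<in> E" "x \<in> Y" "y \<in> Y" using FE by blast
      then show "(l, k) \<in> F" using FI[of y x] edge_sym[OF xy(3)] by simp
    qed
    show "irrefl F"
    proof (rule irreflI, rule notI)
      fix k assume "(k, k) \<in> F"
      then obtain x y where "k = i x" "k = i y" "(x, y) \<in> E" "x \<in> Y" "y \<in> Y" using FE by blast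
      then show False using inj[of x y] edge_irrefl[of x] by auto
    qed
    have "finite F" using finite_subset[OF FY] by (simp add: Y'_def)
    then show "finite {e \<in> F. fst e = k \<or> snd e = k}" for k by simp
    show "connected_in F Y'"
      unfolding connected_in_def
    proof (intro ballI)
      fix k l assume kl: "k \<in> Y'" "l \<in> Y'"
      have "(j k, j l) \<in> (Restr E Y)\<^sup>*" using Y(4) ji(1)[OF kl(1)] ji(1)[OF kl(2)]
        by (auto simp: connected_in_def)
      then have "(i (j k), i (j l)) \<in> (Restr F Y')\<^sup>*"
        by (rule rtrancl_image) (use FI FY in auto)
      then show "(k, l) \<in> (Restr F Y')\<^sup>*" using ji kl by simp
    qed
  qed
  moreover define q where "q = (\<lambda>\<eta> :: 'x \<Rightarrow> 's. restrict (\<eta> \<circ> j) Y')"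
  have q: "q \<eta> \<in> configs Y'" for \<eta> by (auto simp: q_def configs_def)
  have site: "site_sum \<xi> Y' (q \<eta>) = (\<Sum>x\<in>Y. \<xi> (\<eta> x))" for \<xi> \<eta>
  proof -
    have "site_sum \<xi> Y' (q \<eta>) = (\<Sum>k\<in>Y'. \<xi> (\<eta> (j k)))" by (simp add: site_sum_def Y'_def q_def)
    also have "\<dots> = (\<Sum>x\<in>Y. \<xi> (\<eta> x))"
      by (rule sum.reindex_bij_witness[of _ i j]) (use ij ji in auto)
    finally show ?thesis .
  qed
  have offY: "\<eta> x = \<eta>' x" if "x \<notin> Y" for x using Y(2) that by blast
  have "site_sum \<xi> Y' (q \<eta>) = site_sum \<xi> Y' (q \<eta>')" if \<xi>: "\<xi> \<in> consv b \<phi>" for \<xi>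
  proof -
    define B where "B = Y \<union> supp \<eta> \<union> supp \<eta>'"
    have B: "finite B" "supp \<eta> \<subseteq> B" "supp \<eta>' \<subseteq> B" "Y \<subseteq> B"
      using fin Y(1) by (auto simp: B_def fin_configs_finite)
    have "(\<Sum>x\<in>B. \<xi> (\<eta> x)) = (\<Sum>x\<in>B. \<xi> (\<eta>' x))"
      using chg charge_superset[OF B(1,2) \<xi>] charge_superset[OF B(1,3) \<xi>] by simp
    moreover have "(\<Sum>x\<in>B - Y. \<xi> (\<eta> x)) = (\<Sum>x\<in>B - Y. \<xi> (\<eta>' x))"
      by (rule sum.cong) (use offY in auto)
    ultimately show ?thesis using B by (simp add: site sum_diff)
  qed
  ultimately have path: "(q \<eta>, q \<eta>') \<in> (transitions Y' F \<phi>)\<^sup>*"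
    using irreducibly_quantified q unfolding irreducibly_quantified_def by (simp add: Y'_def)
  \<comment> \<open>The path of configurations on the copy is extended by \<open>\<eta>\<close> off \<open>Y\<close>.\<close>
  define L where "L = (\<lambda>\<theta> x. if x \<in> Y then \<theta> (i x) else \<eta> x)"
  have "(L (q \<eta>), L (q \<eta>')) \<in> (moves E \<phi> W)\<^sup>*"
  proof (rule rtrancl_image[OF path])
    fix \<theta> \<theta>' assume "(\<theta>, \<theta>') \<in> transitions Y' F \<phi>"
    then obtain k l where kl: "(k, l) \<in> F" "\<theta>' = exchange \<phi> (k, l) \<theta>"
      by (auto simp: transitions_def)
    then obtain x y where xy: "k = i x" "l = i y" "(x, y) \<in> E" "x \<in> Y" "y \<in> Y" using FE by blast
    then have "L \<theta>' = exchange \<phi> (x, y) (L \<theta>)"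
      using kl inj by (auto simp: L_def exchange_def Let_def fun_eq_iff)
    then show "(L \<theta>, L \<theta>') \<in> moves E \<phi> W" using xy Y(3) by (auto simp: moves_def)
  qed
  moreover have "L (q \<eta>) = \<eta>" "L (q \<eta>') = \<eta>'" using ij offY by (auto simp: L_def q_def fun_eq_iff)
  ultimately show ?thesis by simp
qed simp

lemma closed_form_potential:
  assumes \<omega>: "\<omega> \<in> forms b E \<phi>" and cl: "closed_form b E \<phi> \<omega>"
  obtains f where "\<And>\<eta>. \<eta> \<notin> fin \<Longrightarrow> f \<eta> = 0" "f (\<lambda>_. b) = 0" "differential b E \<phi> f = \<omega>"
proof -
  have "(w, v) \<in> T \<and> \<omega> (w, v) = - \<omega> (v, w)" if "(v, w) \<in> T" for v w
    using that fin_transitions_sym \<omega> by (auto simp: forms_def)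
  then obtain g where g: "\<And>v w. (v, w) \<in> T \<Longrightarrow> \<omega> (v, w) = g w - g v"
    using potential_exists[of T \<omega>] cl unfolding closed_form_def by metis
  define f where "f = (\<lambda>\<eta>. if \<eta> \<in> fin then g \<eta> - g (\<lambda>_. b) else 0)"
  have "differential b E \<phi> f = \<omega>"
  proof
    fix t
    show "differential b E \<phi> f t = \<omega> t"
    proof (cases "t \<in> T")
      case True
      then have "fst t \<in> fin" "snd t \<in> fin" by (auto simp: fin_transitions_def)
      then show ?thesis using True g[of "fst t" "snd t"] by (simp add: differential_def f_def)
    next
      case False
      moreover have "\<omega> t = 0" using \<omega> False unfolding forms_def by blast
      ultimately show ?thesis by (simp add: differential_def)
    qed
  qed
  then show ?thesis using that[of f] by (simp add: f_def base_fin_config)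
qed

end

text \<open>The uniformity of \<open>\<partial>f\<close>, with an integral radius, expressed by \<open>f\<close> itself.\<close>

definition local_change ::
  "'s \<Rightarrow> 'x rel \<Rightarrow> ('s \<times> 's \<Rightarrow> 's \<times> 's) \<Rightarrow> nat \<Rightarrow> (('x \<Rightarrow> 's) \<Rightarrow> real) \<Rightarrow> bool" where
  "local_change b E \<phi> r f \<longleftrightarrow> (\<forall>e\<in>E. \<forall>\<eta>\<in>fin_configs b. \<forall>\<zeta>\<in>fin_configs b.
     (\<forall>x. graph_dist E (fst e) x \<le> r \<or> graph_dist E (snd e) x \<le> r \<longrightarrow> \<eta> x = \<zeta> x) \<longrightarrow>
     f (exchange \<phi> e \<eta>) - f \<eta> = f (exchange \<phi> e \<zeta>) - f \<zeta>)"

context interacting_system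
begin

lemma moves_outside:
  assumes "(\<eta>, \<eta>') \<in> (moves E \<phi> W)\<^sup>*" "\<eta> \<in> fin"
  shows "\<eta>' \<in> fin \<and> (\<forall>x. x \<notin> W \<longrightarrow> \<eta>' x = \<eta> x)"
  using assms
proof (induction rule: rtrancl_induct)
  case (step \<eta>' \<eta>'')
  then obtain e where e: "\<eta>'' = exchange \<phi> e \<eta>'" "fst e \<in> W" "snd e \<in> W" by (auto simp: moves_def)
  then show ?case using step.IH[OF step.prems] exchange_other[of _ e \<phi> \<eta>'] fin_configs_exchange
    by metis
qed simp

text \<open>Each exchange inside \<open>W\<close> only sees the states within distance \<open>r\<close> of \<open>W\<close>, and these are the same
  for \<open>\<eta>\<close> and \<open>\<zeta>\<close> at each stage of the path.\<close>

lemma moves_effect_local: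
  assumes loc: "local_change b E \<phi> r f"
    and mv: "(\<eta>, \<eta>') \<in> (moves E \<phi> W)\<^sup>*" and \<eta>: "\<eta> \<in> fin" and \<zeta>: "\<zeta> \<in> fin"
    and near: "\<And>w x. w \<in> W \<Longrightarrow> dst w x \<le> r \<Longrightarrow> \<zeta> x = \<eta> x"
  shows "f (\<lambda>x. if x \<in> W then \<eta>' x else \<zeta> x) - f \<zeta> = f \<eta>' - f \<eta>"
  using mv
proof (induction rule: rtrancl_induct)
  case base
  have "(\<lambda>x. if x \<in> W then \<eta> x else \<zeta> x) = \<zeta>" using near[of x x for x] by auto
  then show ?case by simp
next
  case (step \<eta>' \<eta>'')
  then obtain e where e: "e \<in> E" "\<eta>'' = exchange \<phi> e \<eta>'" "fst e \<in> W" "snd e \<in> W"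
    by (auto simp: moves_def)
  have out: "\<eta>' \<in> fin" "\<And>x. x \<notin> W \<Longrightarrow> \<eta>' x = \<eta> x" using moves_outside[OF step.hyps(1) \<eta>] by auto
  let ?\<zeta> = "\<lambda>x. if x \<in> W then \<eta>' x else \<zeta> x"
  have \<zeta>f: "?\<zeta> \<in> fin" by (rule fin_configs_split[OF out(1) \<zeta>])
  have agree: "\<forall>x. dst (fst e) x \<le> r \<or> dst (snd e) x \<le> r \<longrightarrow> \<eta>' x = ?\<zeta> x"
    using near[OF e(3)] near[OF e(4)] out(2) by auto
  have "f (exchange \<phi> e \<eta>') - f \<eta>' = f (exchange \<phi> e ?\<zeta>) - f ?\<zeta>"
    using loc[unfolded local_change_def, rule_format, OF e(1) out(1) \<zeta>f] agree by blast
  moreover have "exchange \<phi> e ?\<zeta> = (\<lambda>x. if x \<in> W then \<eta>'' x else \<zeta> x)"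
    using e by (auto simp: exchange_def Let_def fun_eq_iff)
  ultimately show ?case using step.IH e(2) by simp
qed

end

section \<open>Interaction of far apart configurations\<close>

locale local_potential = interacting_system E b \<phi>
  for E :: "'x rel" and b :: 's and \<phi> :: "'s \<times> 's \<Rightarrow> 's \<times> 's" +
  fixes f :: "('x \<Rightarrow> 's) \<Rightarrow> real" and r :: nat
  assumes f_base: "f (\<lambda>_. b) = 0" and f_local: "local_change b E \<phi> r f"
begin

definition defect :: "('x \<Rightarrow> 's) \<Rightarrow> ('x \<Rightarrow> 's) \<Rightarrow> real" where
  "defect \<alpha> \<beta> = f (overlay b \<alpha> \<beta>) - f \<alpha> - f \<beta>"

lemma defect_commute:
  assumes "\<And>x. \<alpha> x = b \<or> \<beta> x = b"
  shows "defect \<alpha> \<beta> = defect \<beta> \<alpha>"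
proof -
  have "overlay b \<alpha> \<beta> = overlay b \<beta> \<alpha>" using assms by (force simp: overlay_def fun_eq_iff)
  then show ?thesis by (simp add: defect_def)
qed

text \<open>Rearranging \<open>\<beta>\<close> inside \<open>W\<close> has the same effect on \<open>f\<close> whether or not \<open>\<alpha>\<close> is present.\<close>

lemma defect_move:
  assumes W: "connected_in E W" and fin: "\<alpha> \<in> fin" "\<beta> \<in> fin" "\<beta>' \<in> fin"
    and sub: "supp \<beta> \<subseteq> W" "supp \<beta>' \<subseteq> W" and chg: "chg \<beta> = chg \<beta>'"
    and apart: "\<And>x y. \<alpha> x \<noteq> b \<Longrightarrow> y \<in> W \<Longrightarrow> dst x y > r"
  shows "defect \<alpha> \<beta> = defect \<alpha> \<beta>'"
proof -
  have off: "\<beta> x = b" "\<beta>' x = b" if "x \<notin> W" for x using sub that by auto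
  have \<alpha>0: "\<alpha> x = b" if "x \<in> W" for x using apart[of x x] that by auto
  have mv: "(\<beta>, \<beta>') \<in> (moves E \<phi> W)\<^sup>*"
    by (rule moves_if_same_charge[OF W fin(2,3) _ chg]) (simp add: off)
  have near: "overlay b \<alpha> \<beta> x = \<beta> x" if "w \<in> W" "dst w x \<le> r" for w x
    using apart[of x w] that dst_commute[of w x] by (auto simp: overlay_def)
  have "f (\<lambda>x. if x \<in> W then \<beta>' x else overlay b \<alpha> \<beta> x) - f (overlay b \<alpha> \<beta>) = f \<beta>' - f \<beta>"
    by (rule moves_effect_local[OF f_local mv fin(2) fin_configs_overlay[OF fin(1,2)] near])
  moreover have "(\<lambda>x. if x \<in> W then \<beta>' x else overlay b \<alpha> \<beta> x) = overlay b \<alpha> \<beta>'"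
    using off \<alpha>0 by (auto simp: overlay_def fun_eq_iff)
  ultimately show ?thesis by (simp add: defect_def)
qed

text \<open>The interaction of a charge near the base vertex with a charge far out in an end. All choices of
  \<open>N\<close>, \<open>\<alpha>\<close> and \<open>\<beta>\<close> give the same value.\<close>

definition pairing ::
  "'x \<Rightarrow> (nat \<Rightarrow> 'x set) \<Rightarrow> (('s \<Rightarrow> real) \<Rightarrow> real) \<Rightarrow> (('s \<Rightarrow> real) \<Rightarrow> real) \<Rightarrow> real" where
  "pairing x0 C m n = (SOME t. \<exists>N \<alpha> \<beta>. \<alpha> \<in> fin \<and> \<beta> \<in> fin \<and> supp \<alpha> \<subseteq> nball x0 N \<and>
     supp \<beta> \<subseteq> C (N + r) \<and> chg \<alpha> = m \<and> chg \<beta> = n \<and> t = defect \<alpha> \<beta>)"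

lemma ball_end_apart:
  assumes "is_end E x0 C" "x \<in> nball x0 N" "y \<in> C (N + r)"
  shows "dst x y > r" "dst y x > r"
proof -
  have "dst x0 y > N + r" using end_outside[OF assms(1,3)] .
  then show "dst x y > r" using assms(2) dst_triangle[of x0 y x] by (simp add: nball_def)
  then show "dst y x > r" by (simp add: dst_commute)
qed

lemma chg_in_end:
  assumes "is_end E x0 C" "\<alpha> \<in> fin"
  obtains \<beta> where "\<beta> \<in> fin" "supp \<beta> \<subseteq> C k" "chg \<beta> = chg \<alpha>"
  using charge_realized_in[OF assms(2), of "C k"] end_infinite[OF assms(1)] by metis

lemma fin_in_ball:
  assumes "\<alpha> \<in> fin"
  obtains N where "supp \<alpha> \<subseteq> nball x0 N"
  using finite_subset_nball assms by (metis fin_configs_finite)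

text \<open>The configuration in the end is moved far enough out to keep away from a ball that contains both
  \<open>\<alpha>\<close> and \<open>\<alpha>'\<close>. Inside this ball \<open>\<alpha>\<close> is then changed to \<open>\<alpha>'\<close>.\<close>

lemma defect_well_defined:
  assumes C: "is_end E x0 C"
    and a: "\<alpha> \<in> fin" "supp \<alpha> \<subseteq> nball x0 N" and b: "\<beta> \<in> fin" "supp \<beta> \<subseteq> C (N + r)"
    and a': "\<alpha>' \<in> fin" "supp \<alpha>' \<subseteq> nball x0 N'" and b': "\<beta>' \<in> fin" "supp \<beta>' \<subseteq> C (N' + r)"
    and c: "chg \<alpha> = chg \<alpha>'" "chg \<beta> = chg \<beta>'"
  shows "defect \<alpha> \<beta> = defect \<alpha>' \<beta>'"
proof -
  define K where "K = max N N'"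
  obtain \<gamma> where g: "\<gamma> \<in> fin" "supp \<gamma> \<subseteq> C (K + r)" "chg \<gamma> = chg \<beta>" using chg_in_end[OF C b(1)] .
  have sub: "C (K + r) \<subseteq> C (N + r)" "C (K + r) \<subseteq> C (N' + r)"
    using end_antimono[OF C] by (auto simp: K_def)
  have bsub: "nball x0 N \<subseteq> nball x0 K" "nball x0 N' \<subseteq> nball x0 K" by (auto simp: K_def nball_def)
  have "defect \<alpha> \<beta> = defect \<alpha> \<gamma>"
    by (rule defect_move[OF end_connected[OF C] a(1) b(1) g(1) b(2)])
      (use g sub a ball_end_apart[OF C] in auto)
  also have "\<dots> = defect \<gamma> \<alpha>"
    by (rule defect_commute) (use g a bsub ball_end_apart(1)[OF C, of _ K] in force)
  also have "\<dots> = defect \<gamma> \<alpha>'"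
    by (rule defect_move[OF connected_nball[of x0 K] g(1) a(1) a'(1)])
      (use a a' g bsub c ball_end_apart(2)[OF C, of _ K] in auto)
  also have "\<dots> = defect \<alpha>' \<gamma>"
    by (rule defect_commute) (use g a' bsub ball_end_apart(1)[OF C, of _ K] in force)
  also have "\<dots> = defect \<alpha>' \<beta>'"
    by (rule defect_move[OF end_connected[OF C, of "N' + r"] a'(1) g(1) b'(1)])
      (use g sub a' b' c ball_end_apart[OF C] in auto)
  finally show ?thesis .
qed

lemma pairing_eq:
  assumes C: "is_end E x0 C"
    and a: "\<alpha> \<in> fin" "supp \<alpha> \<subseteq> nball x0 N" and b: "\<beta> \<in> fin" "supp \<beta> \<subseteq> C (N + r)"
  shows "pairing x0 C (chg \<alpha>) (chg \<beta>) = defect \<alpha> \<beta>"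
  unfolding pairing_def
proof (rule some_equality)
  show "\<exists>N \<alpha>' \<beta>'. \<alpha>' \<in> fin \<and> \<beta>' \<in> fin \<and> supp \<alpha>' \<subseteq> nball x0 N \<and> supp \<beta>' \<subseteq> C (N + r) \<and>
      chg \<alpha>' = chg \<alpha> \<and> chg \<beta>' = chg \<beta> \<and> defect \<alpha> \<beta> = defect \<alpha>' \<beta>'"
    using a b by blast
next
  fix t assume "\<exists>N \<alpha>' \<beta>'. \<alpha>' \<in> fin \<and> \<beta>' \<in> fin \<and> supp \<alpha>' \<subseteq> nball x0 N \<and> supp \<beta>' \<subseteq> C (N + r) \<and>
      chg \<alpha>' = chg \<alpha> \<and> chg \<beta>' = chg \<beta> \<and> t = defect \<alpha>' \<beta>'"
  then obtain N' \<alpha>' \<beta>' where *: "\<alpha>' \<in> fin" "supp \<alpha>' \<subseteq> nball x0 N'" "\<beta>' \<in> fin"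
    "supp \<beta>' \<subseteq> C (N' + r)" "chg \<alpha>' = chg \<alpha>" "chg \<beta>' = chg \<beta>" "t = defect \<alpha>' \<beta>'" by blast
  show "t = defect \<alpha> \<beta>" unfolding *(7) by (rule defect_well_defined[OF C *(1-4) a b *(5,6)])
qed

definition charges :: "(('s \<Rightarrow> real) \<Rightarrow> real) set" where
  "charges = charge b \<phi> ` (fin_configs b :: ('x \<Rightarrow> 's) set)"

lemma chargeI: "(\<alpha> :: 'x \<Rightarrow> 's) \<in> fin \<Longrightarrow> chg \<alpha> \<in> charges"
  by (simp add: charges_def)

lemma chargeE:
  assumes "m \<in> charges"
  obtains \<alpha> :: "'x \<Rightarrow> 's" where "\<alpha> \<in> fin" "m = chg \<alpha>"
  using assms by (auto simp: charges_def)

text \<open>Place the first charge near the base vertex, the second one far out in the end and the third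
  one still further out. Then all four terms of the cocycle identity are values of the pairing, and
  the identity expresses that the overlay of configurations is associative.\<close>

lemma pairing_cocycle:
  assumes C: "is_end E x0 C"
  shows "monoid_cocycle charges (pairing x0 C)"
proof
  show zero: "0 \<in> charges" using chargeI[OF base_fin_config] by (simp add: charge_base)
  have defect0: "defect (\<lambda>_. b) \<beta> = 0" for \<beta> by (simp add: defect_def overlay_def f_base)
  show "pairing x0 C 0 m = 0" if "m \<in> charges" for m
  proof -
    obtain \<alpha> :: "'x \<Rightarrow> 's" where \<alpha>: "\<alpha> \<in> fin" "m = chg \<alpha>" using chargeE[OF \<open>m \<in> charges\<close>] .
    obtain \<beta> where \<beta>: "\<beta> \<in> fin" "supp \<beta> \<subseteq> C (0 + r)" "chg \<beta> = chg \<alpha>" using chg_in_end[OF C \<alpha>(1)] .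
    have "pairing x0 C (chg (\<lambda>_ :: 'x. b)) (chg \<beta>) = defect (\<lambda>_. b) \<beta>"
      by (rule pairing_eq[OF C base_fin_config _ \<beta>(1,2)]) simp
    then show ?thesis using \<alpha> \<beta> defect0 by (simp add: charge_base)
  qed
  fix m n assume mn: "m \<in> charges" "n \<in> charges"
  obtain \<alpha> :: "'x \<Rightarrow> 's" where \<alpha>: "\<alpha> \<in> fin" "m = chg \<alpha>" using chargeE[OF mn(1)] .
  obtain N where N: "supp \<alpha> \<subseteq> nball x0 N" using fin_in_ball[OF \<alpha>(1)] .
  obtain \<beta>0 :: "'x \<Rightarrow> 's" where \<beta>0: "\<beta>0 \<in> fin" "n = chg \<beta>0" using chargeE[OF mn(2)] .
  obtain \<beta> where \<beta>: "\<beta> \<in> fin" "supp \<beta> \<subseteq> C (N + r)" "chg \<beta> = chg \<beta>0" using chg_in_end[OF C \<beta>0(1)] .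
  have disj: "\<alpha> x = b \<or> \<beta> x = b" for x
    using N \<beta>(2) ball_end_apart(1)[OF C, of x N x] by auto
  have \<alpha>\<beta>: "overlay b \<alpha> \<beta> \<in> fin" "chg (overlay b \<alpha> \<beta>) = m + n"
    using \<alpha> \<beta> \<beta>0 disj fin_configs_overlay charge_overlay[OF \<alpha>(1) \<beta>(1)] by auto
  then show "m + n \<in> charges" by (metis chargeI)
  fix p assume p: "p \<in> charges"
  obtain \<gamma>0 :: "'x \<Rightarrow> 's" where \<gamma>0: "\<gamma>0 \<in> fin" "p = chg \<gamma>0" using chargeE[OF p] .
  obtain N1 where N1: "supp (overlay b \<alpha> \<beta>) \<subseteq> nball x0 N1" using fin_in_ball[OF \<alpha>\<beta>(1)] .
  define N' where "N' = max N N1"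
  have N': "supp (overlay b \<alpha> \<beta>) \<subseteq> nball x0 N'" "supp \<beta> \<subseteq> nball x0 N'" "C (N' + r) \<subseteq> C (N + r)"
  proof -
    show N': "supp (overlay b \<alpha> \<beta>) \<subseteq> nball x0 N'"
      using subset_trans[OF N1 nball_mono[of N1 N' x0]] by (simp add: N'_def)
    then show "supp \<beta> \<subseteq> nball x0 N'" unfolding overlay_supp by simp
    show "C (N' + r) \<subseteq> C (N + r)" by (rule end_antimono[OF C]) (simp add: N'_def)
  qed
  obtain \<gamma> where \<gamma>: "\<gamma> \<in> fin" "supp \<gamma> \<subseteq> C (N' + r)" "chg \<gamma> = chg \<gamma>0" using chg_in_end[OF C \<gamma>0(1)] .
  have disj': "\<beta> x = b \<or> \<gamma> x = b" for x
    using N'(2) \<gamma>(2) ball_end_apart(1)[OF C, of x N' x] by auto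
  have \<beta>\<gamma>: "overlay b \<beta> \<gamma> \<in> fin" "chg (overlay b \<beta> \<gamma>) = n + p"
    using \<gamma>0 \<beta> \<beta>0 \<gamma> disj' fin_configs_overlay charge_overlay[OF \<beta>(1) \<gamma>(1)] by auto
  have \<beta>\<gamma>s: "supp (overlay b \<beta> \<gamma>) \<subseteq> C (N + r)" using \<beta>(2) \<gamma>(2) N'(3) overlay_supp[of b \<beta> \<gamma>] by auto
  have "overlay b (overlay b \<alpha> \<beta>) \<gamma> = overlay b \<alpha> (overlay b \<beta> \<gamma>)" by (auto simp: overlay_def)
  moreover have "pairing x0 C m n = defect \<alpha> \<beta>"
    using pairing_eq[OF C \<alpha>(1) N \<beta>(1,2)] \<alpha> \<beta> \<beta>0 by simp
  moreover have "pairing x0 C (m + n) p = defect (overlay b \<alpha> \<beta>) \<gamma>"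
    using pairing_eq[OF C \<alpha>\<beta>(1) N'(1) \<gamma>(1,2)] \<alpha>\<beta> \<gamma> \<gamma>0 by simp
  moreover have "pairing x0 C n p = defect \<beta> \<gamma>"
    using pairing_eq[OF C \<beta>(1) N'(2) \<gamma>(1,2)] \<beta> \<beta>0 \<gamma> \<gamma>0 by simp
  moreover have "pairing x0 C m (n + p) = defect \<alpha> (overlay b \<beta> \<gamma>)"
    using pairing_eq[OF C \<alpha>(1) N \<beta>\<gamma>(1) \<beta>\<gamma>s] \<alpha> \<beta>\<gamma> by simp
  ultimately show
    "pairing x0 C m n + pairing x0 C (m + n) p = pairing x0 C n p + pairing x0 C m (n + p)"
    by (simp add: defect_def)
qed

text \<open>With one configuration in each of two different ends, either one can be pulled back to the base
  vertex and the other one pushed out.\<close>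

lemma pairing_swap:
  assumes C: "is_end E x0 C" and C': "is_end E x0 C'" and ne: "C \<noteq> C'"
    and mn: "m \<in> charges" "n \<in> charges"
  shows "pairing x0 C m n = pairing x0 C' n m"
proof -
  obtain k where k: "C k \<inter> C' k = {}" using distinct_ends_separate[OF C C' ne] .
  obtain \<alpha>0 :: "'x \<Rightarrow> 's" where a0: "\<alpha>0 \<in> fin" "m = chg \<alpha>0" using chargeE[OF mn(1)] .
  obtain \<beta>0 :: "'x \<Rightarrow> 's" where b0: "\<beta>0 \<in> fin" "n = chg \<beta>0" using chargeE[OF mn(2)] .
  note 0 = a0 b0
  obtain \<alpha> where a: "\<alpha> \<in> fin" "supp \<alpha> \<subseteq> C' (k + r)" "chg \<alpha> = m" using chg_in_end[OF C' 0(1)] 0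
    by metis
  obtain \<beta> where b: "\<beta> \<in> fin" "supp \<beta> \<subseteq> C (k + r)" "chg \<beta> = n" using chg_in_end[OF C 0(3)] 0
    by metis
  obtain N1 where N1: "supp \<alpha> \<subseteq> nball x0 N1" using fin_in_ball[OF a(1)] .
  obtain N2 where N2: "supp \<beta> \<subseteq> nball x0 N2" using fin_in_ball[OF b(1)] .
  define N where "N = max k (max N1 N2)"
  have N: "supp \<alpha> \<subseteq> nball x0 N" "supp \<beta> \<subseteq> nball x0 N"
    using subset_trans[OF N1 nball_mono[of N1 N x0]] subset_trans[OF N2 nball_mono[of N2 N x0]]
    by (simp_all add: N_def)
  have sub: "C (N + r) \<subseteq> C (k + r)" "C' (N + r) \<subseteq> C' (k + r)"
    using end_antimono[OF C] end_antimono[OF C'] by (auto simp: N_def)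
  obtain \<alpha>' where a': "\<alpha>' \<in> fin" "supp \<alpha>' \<subseteq> C' (N + r)" "chg \<alpha>' = m" using chg_in_end[OF C' a(1)] a
    by metis
  obtain \<beta>' where b': "\<beta>' \<in> fin" "supp \<beta>' \<subseteq> C (N + r)" "chg \<beta>' = n" using chg_in_end[OF C b(1)] b
    by metis
  have far: "dst x y > r" "dst y x > r" if "x \<in> C (k + r)" "y \<in> C' (k + r)" for x y
    using separated_ends_far[OF C C' k that] by (simp_all add: dst_commute)
  have "pairing x0 C m n = defect \<alpha> \<beta>'" using pairing_eq[OF C a(1) N(1) b'(1,2)] a b' by simp
  also have "\<dots> = defect \<alpha> \<beta>"
    by (rule defect_move[OF end_connected[OF C, of
      "k + r"] a(1) b'(1) b(1)]) (use b b' a sub far in auto)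
  also have "\<dots> = defect \<beta> \<alpha>"
    by (rule defect_commute) (use far[of x x for x] a b in auto)
  also have "\<dots> = defect \<beta> \<alpha>'"
    by (rule defect_move[OF end_connected[OF C', of
      "k + r"] b(1) a(1) a'(1)]) (use b a' a sub far in auto)
  also have "\<dots> = pairing x0 C' n m" using pairing_eq[OF C' b(1) N(2) a'(1,2)] a' b by simp
  finally show ?thesis .
qed

section \<open>Symmetry of the pairings\<close>

text \<open>Three transpositions lead from one end to the second, to the third and back to the first.\<close>

lemma pairing_symmetric_three_ends:
  assumes "is_end E x0 C" "is_end E x0 C'" "is_end E x0 C''" "C \<noteq> C'" "C \<noteq> C''" "C' \<noteq> C''"
    and mn: "m \<in> charges" "n \<in> charges"
  shows "pairing x0 C m n = pairing x0 C n m"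
  using pairing_swap[of x0 C C' m n] pairing_swap[of x0 C' C'' n m] pairing_swap[of x0 C'' C m n] assms
  by metis

text \<open>If a large ball does not disconnect the graph, a configuration outside can be moved from one
  end to another one without coming close to the centre of the ball.\<close>

lemma pairing_unique_if_large_balls:
  assumes big: "\<And>k::nat. \<exists>x. \<exists>R>0. R \<ge> real k \<and> connected_in E (- graph_ball E x R)"
    and C: "is_end E x0 C" and C': "is_end E x0 C'" and mn: "m \<in> charges" "n \<in> charges"
  shows "pairing x0 C m n = pairing x0 C' m n"
proof -
  obtain \<alpha>0 :: "'x \<Rightarrow> 's" where a0: "\<alpha>0 \<in> fin" "m = chg \<alpha>0" using chargeE[OF mn(1)] .
  obtain \<beta>0 :: "'x \<Rightarrow> 's" where b0: "\<beta>0 \<in> fin" "n = chg \<beta>0" using chargeE[OF mn(2)] .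
  note 0 = a0 b0
  \<comment> \<open>A ball of radius \<open>a\<close> has more than \<open>a\<close> vertices, enough for the states of \<open>\<alpha>0\<close>.\<close>
  define a where "a = card (supp \<alpha>0)"
  obtain x R where R: "R > 0" "R \<ge> real (a + r)" "connected_in E (- graph_ball E x R)" using big
    by blast
  define R' where "R' = nat \<lfloor>R\<rfloor>"
  have R': "R' \<ge> a + r" "connected_in E (- nball x R')"
    using R graph_ball_nball[of R x] by (auto simp: R'_def le_nat_floor)
  have "card (supp \<alpha>0) \<le> card (nball x a)" using card_nball[of a x] by (simp add: a_def)
  then obtain \<alpha> where \<alpha>: "\<alpha> \<in> fin" "supp \<alpha> \<subseteq> nball x a" "chg \<alpha> = m"
    using charge_realized_in[OF 0(1)] 0(2) by metis
  have "finite (nball x a \<union> nball x R')" by (simp add: finite_nball)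
  then obtain N where "nball x a \<union> nball x R' \<subseteq> nball x0 N" by (rule finite_subset_nball)
  then have N: "supp \<alpha> \<subseteq> nball x0 N" "nball x R' \<subseteq> nball x0 N" using \<alpha>(2) by auto
  have out: "D (N + r) \<subseteq> - nball x R'" if "is_end E x0 D" for D
  proof
    fix y assume "y \<in> D (N + r)"
    then have "y \<notin> nball x0 N" using end_outside[OF that] by (fastforce simp: nball_def)
    then show "y \<in> - nball x R'" using N(2) by auto
  qed
  obtain \<beta> where b: "\<beta> \<in> fin" "supp \<beta> \<subseteq> C (N + r)" "chg \<beta> = n" using chg_in_end[OF C 0(3)] 0
    by metis
  obtain \<beta>' where b': "\<beta>' \<in> fin" "supp \<beta>' \<subseteq> C' (N + r)" "chg \<beta>' = n" using chg_in_end[OF C' 0(3)] 0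
    by metis
  have apart: "dst y z > r" if "\<alpha> y \<noteq> b" "z \<in> - nball x R'" for y z
  proof -
    have "dst x y \<le> a" using \<alpha>(2) that(1) by (auto simp: nball_def)
    moreover have "dst x z > R'" using that(2) by (simp add: nball_def)
    ultimately show ?thesis using R'(1) dst_triangle[of x z y] by linarith
  qed
  have "pairing x0 C m n = defect \<alpha> \<beta>" using pairing_eq[OF C \<alpha>(1) N(1) b(1,2)] \<alpha> b by simp
  also have "\<dots> = defect \<alpha> \<beta>'"
    by (rule defect_move[OF R'(2) \<alpha>(1) b(1) b'(1)]) (use b b' out[OF C] out[OF C'] apart in auto)
  also have "\<dots> = pairing x0 C' m n" using pairing_eq[OF C' \<alpha>(1) N(1) b'(1,2)] \<alpha> b' by simp
  finally show ?thesis .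
qed

text \<open>If there is only one end, no ball disconnects the graph. Of two configurations in balls far
  apart, either one can be pushed out to infinity.\<close>

lemma pairing_symmetric_one_end:
  assumes C: "is_end E x0 C" and uniq: "\<And>C'. is_end E x0 C' \<Longrightarrow> C' = C"
    and mn: "m \<in> charges" "n \<in> charges"
  shows "pairing x0 C m n = pairing x0 C n m"
proof -
  obtain \<alpha> :: "'x \<Rightarrow> 's" where a0: "\<alpha> \<in> fin" "m = chg \<alpha>" using chargeE[OF mn(1)] .
  obtain \<beta>0 :: "'x \<Rightarrow> 's" where b0: "\<beta>0 \<in> fin" "n = chg \<beta>0" using chargeE[OF mn(2)] .
  note 0 = a0 b0
  obtain N where N: "supp \<alpha> \<subseteq> nball x0 N" using fin_in_ball[OF 0(1)] .
  define a where "a = card (supp \<beta>0)"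
  obtain y where y: "dst x0 y > N + a + r" by (rule far_vertex)
  have "card (supp \<beta>0) \<le> card (nball y a)" using card_nball[of a y] by (simp add: a_def)
  then obtain \<beta> where \<beta>: "\<beta> \<in> fin" "supp \<beta> \<subseteq> nball y a" "chg \<beta> = n"
    using charge_realized_in[OF 0(3)] 0(4) by metis
  have far: "dst z w > r" if zw: "\<alpha> z \<noteq> b" "\<beta> w \<noteq> b" for z w
  proof -
    have "dst x0 z \<le> N" "dst y w \<le> a" using N \<beta>(2) that by (auto simp: nball_def)
    then show "dst z w > r"
      using y dst_triangle[of x0 y z] dst_triangle[of z y w] dst_commute[of y w] by linarith
  qed
  have farN: "dst x0 w > N + r" if "\<beta> w \<noteq> b" for w
  proof -
    have "dst y w \<le> a" using \<beta>(2) that by (auto simp: nball_def)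
    then show ?thesis using y dst_triangle[of x0 y w] dst_commute[of y w] by linarith
  qed
  have fara: "dst y z > a + r" if "\<alpha> z \<noteq> b" for z
  proof -
    have "dst x0 z \<le> N" using N that by (auto simp: nball_def)
    then show ?thesis using y dst_triangle[of x0 y z] dst_commute[of y z] by linarith
  qed
  define W1 where "W1 = - nball x0 (N + r)"
  define W2 where "W2 = - nball y (a + r)"
  have W: "connected_in E W1" "connected_in E W2"
    using unique_end_connected[OF C uniq] by (simp_all add: W1_def W2_def)
  obtain M1 where M1: "nball x0 (N + r) \<union> nball y (a + r) \<union> supp \<beta> \<subseteq> nball x0 M1"
    using finite_subset_nball[of "nball x0 (N + r) \<union> nball y (a + r) \<union> supp \<beta>"] finite_nball \<beta>(1)
    by (auto simp: fin_configs_finite)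
  have out: "C (M1 + r) \<subseteq> W1" "C (M1 + r) \<subseteq> W2"
  proof -
    have "w \<notin> nball x0 M1" if "w \<in> C (M1 + r)" for w
      using end_outside[OF C that] by (simp add: nball_def)
    then show "C (M1 + r) \<subseteq> W1" "C (M1 + r) \<subseteq> W2" using M1 by (auto simp: W1_def W2_def)
  qed
  have "C (N + r + (M1 + r)) \<subseteq> C (M1 + r)" "C (N + r + (M1 + r)) \<subseteq> C (N + r)"
    using end_antimono[OF C] by auto
  then obtain \<beta>' where b': "\<beta>' \<in> fin" "supp \<beta>' \<subseteq> C (N + r)" "supp \<beta>' \<subseteq> C (M1 + r)" "chg \<beta>' = n"
    using chg_in_end[OF C 0(3), of "N + r + (M1 + r)"] 0(4) by (metis subset_trans)
  obtain \<alpha>' where a': "\<alpha>' \<in> fin" "supp \<alpha>' \<subseteq> C (M1 + r)" "chg \<alpha>' = m" using chg_in_end[OF C 0(1)] 0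
    by metis
  have "pairing x0 C m n = defect \<alpha> \<beta>'" using pairing_eq[OF C 0(1) N b'(1,2)] 0 b' by simp
  also have "\<dots> = defect \<alpha> \<beta>"
  proof (rule defect_move[OF W(1) 0(1) b'(1) \<beta>(1)])
    show "supp \<beta>' \<subseteq> W1" using b' out by auto
    show "supp \<beta> \<subseteq> W1"
    proof
      fix w assume "w \<in> supp \<beta>"
      then show "w \<in> W1" using farN[of w] by (simp add: W1_def nball_def)
    qed
    show "chg \<beta>' = chg \<beta>" using b' \<beta> by simp
    show "dst z w > r" if "\<alpha> z \<noteq> b" "w \<in> W1" for z w
    proof -
      have "dst x0 z \<le> N" "dst x0 w > N + r" using N that by (auto simp: nball_def W1_def)
      then show ?thesis using dst_triangle[of x0 w z] by linarith
    qed
  qed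
  also have "\<dots> = defect \<beta> \<alpha>"
    by (rule defect_commute) (use far[of x x for x] in auto)
  also have "\<dots> = defect \<beta> \<alpha>'"
  proof (rule defect_move[OF W(2) \<beta>(1) 0(1) a'(1)])
    show "supp \<alpha>' \<subseteq> W2" using a' out by auto
    show "supp \<alpha> \<subseteq> W2"
    proof
      fix w assume "w \<in> supp \<alpha>"
      then show "w \<in> W2" using fara[of w] by (simp add: W2_def nball_def)
    qed
    show "chg \<alpha> = chg \<alpha>'" using a' 0 by simp
    show "dst z w > r" if "\<beta> z \<noteq> b" "w \<in> W2" for z w
    proof -
      have "dst y z \<le> a" "dst y w > a + r" using \<beta>(2) that by (auto simp: nball_def W2_def)
      then show ?thesis using dst_triangle[of y w z] by linarith
    qed
  qed
  also have "\<dots> = pairing x0 C n m"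
    using pairing_eq[OF C \<beta>(1) _ a'(1,2)] M1 a' \<beta> by auto
  finally show ?thesis .
qed

text \<open>If the space of conserved quantities is spanned by \<open>\<xi>\<close>, a charge is determined by its value at
  \<open>\<xi>\<close>, and these values form the additive monoid generated by the range of \<open>\<xi>\<close>. If that monoid is
  \<open>\<nat>\<close> or \<open>\<int>\<close>, the charges are generated by one element up to sign, and every cocycle is symmetric.\<close>

lemma pairing_symmetric_simple:
  assumes simple: "simple_interaction b \<phi>" and C: "is_end E x0 C"
    and mn: "m \<in> charges" "n \<in> charges"
  shows "pairing x0 C m n = pairing x0 C n m"
proof -
  interpret h: monoid_cocycle charges "pairing x0 C" by (rule pairing_cocycle[OF C])
  have dim1: "dim (consv b \<phi>) = 1" using simple by (simp add: simple_interaction_def)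
  obtain B where B: "B \<subseteq> consv b \<phi>" "independent B" "consv b \<phi> \<subseteq> span B" "card B = dim (consv b \<phi>)"
    by (rule basis_exists)
  then obtain \<xi> where \<xi>B: "B = {\<xi>}" using dim1 card_1_singletonE by metis
  have \<xi>: "\<xi> \<in> consv b \<phi>" "\<xi> \<noteq> 0" using B \<xi>B dependent_zero by auto
  have mult: "\<exists>c. \<zeta> = c *\<^sub>R \<xi>" if "\<zeta> \<in> consv b \<phi>" for \<zeta>
    using that B(3) by (auto simp: \<xi>B span_singleton)
  have inj: "m = n" if mc: "m \<in> charges" and nc: "n \<in> charges" and eq: "m \<xi> = n \<xi>" for m n
  proof
    fix \<zeta>
    obtain \<alpha> :: "'x \<Rightarrow> 's" where \<alpha>: "\<alpha> \<in> fin" "m = chg \<alpha>" using chargeE[OF mc] .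
    obtain \<beta> :: "'x \<Rightarrow> 's" where \<beta>: "\<beta> \<in> fin" "n = chg \<beta>" using chargeE[OF nc] .
    show "m \<zeta> = n \<zeta>"
    proof (cases "\<zeta> \<in> consv b \<phi>")
      case True
      then obtain c where c: "\<zeta> = c *\<^sub>R \<xi>" using mult by blast
      have "chg \<eta> \<zeta> = c * chg \<eta> \<xi>" for \<eta> :: "'x \<Rightarrow> 's"
        using True \<xi>(1) by (simp add: charge_def c scaleR_fun_def sum_distrib_left)
      then show ?thesis using eq \<alpha> \<beta> by simp
    qed (simp add: \<alpha> \<beta> charge_def)
  qed
  define N where "N = additive_submonoid hull range \<xi>"
  have Nsub: "additive_submonoid N"
    unfolding N_def by (rule hull_in) (auto simp: additive_submonoid_def)
  have Nran: "range \<xi> \<subseteq> N" unfolding N_def by (rule hull_subset)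
  have valN: "m \<xi> \<in> N" if mc: "m \<in> charges" for m
  proof -
    obtain \<alpha> :: "'x \<Rightarrow> 's" where \<alpha>: "\<alpha> \<in> fin" "m = chg \<alpha>" using chargeE[OF mc] .
    have "finite A \<Longrightarrow> (\<Sum>x\<in>A. \<xi> (\<alpha> x)) \<in> N" for A
    proof (induction A rule: finite_induct)
      case (insert x A)
      have "\<xi> (\<alpha> x) \<in> N" using Nran by blast
      then show ?case using insert Nsub by (simp add: additive_submonoid_def)
    qed (use Nsub in \<open>simp add: additive_submonoid_def\<close>)
    then show ?thesis using \<alpha> \<xi> by (simp add: charge_def fin_configs_finite)
  qed
  have Nval: "\<exists>m\<in>charges. m \<xi> = u" if "u \<in> N" for u
  proof -
    have "N \<subseteq> (\<lambda>m. m \<xi>) ` charges"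
      unfolding N_def
    proof (rule hull_minimal)
      show "range \<xi> \<subseteq> (\<lambda>m. m \<xi>) ` charges"
      proof
        fix u assume "u \<in> range \<xi>"
        then obtain s where s: "u = \<xi> s" by auto
        define \<eta> where "\<eta> = (\<lambda>_. b)(x0 := s)"
        have \<eta>: "\<eta> \<in> fin" unfolding \<eta>_def by (intro fin_configs_upd base_fin_config)
        have "chg \<eta> \<xi> = (\<Sum>x\<in>{x0}. \<xi> (\<eta> x))" by (rule charge_superset) (use \<xi> in \<open>auto simp: \<eta>_def\<close>)
        then have "u = chg \<eta> \<xi>" by (simp add: \<eta>_def s)
        then show "u \<in> (\<lambda>m. m \<xi>) ` charges" using chargeI[OF \<eta>] by blast
      qed
      have "m \<xi> + n \<xi> \<in> (\<lambda>m. m \<xi>) ` charges" if "m \<in> charges" "n \<in> charges" for m n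
        using h.add_in[OF that] by (metis imageI plus_fun_apply)
      moreover have "0 \<in> (\<lambda>m. m \<xi>) ` charges" using h.zero_in by (metis imageI zero_fun_apply)
      ultimately show "additive_submonoid ((\<lambda>m. m \<xi>) ` charges)"
        by (auto simp: additive_submonoid_def)
    qed
    then show ?thesis using that by auto
  qed
  have step: "\<exists>m'\<in>charges. m = m' + u" if mc: "m \<in> charges" and uc: "u \<in> charges"
    and val: "m \<xi> = v + u \<xi>" "v \<in> N" for m u v
  proof -
    obtain m' where m': "m' \<in> charges" "m' \<xi> = v" using Nval[OF val(2)] by blast
    have "m = m' + u" by (rule inj) (use mc uc val m' h.add_in in auto)
    then show ?thesis using m' by blast
  qed
  have "additive_structure N \<cong> additive_structure (UNIV :: nat set) \<or>
      additive_structure N \<cong> additive_structure (UNIV :: int set)"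
    using simple \<xi> unfolding simple_interaction_def Let_def N_def by blast
  \<comment> \<open>A common form of both cases: the natural numbers are embedded in the integers.\<close>
  then obtain j :: "real \<Rightarrow> int" where jadd: "\<And>x y. x \<in> N \<Longrightarrow> y \<in> N \<Longrightarrow> j (x + y) = j x + j y"
    and jinj: "\<And>x y. x \<in> N \<Longrightarrow> y \<in> N \<Longrightarrow> j x = j y \<Longrightarrow> x = y" and jsurj: "\<And>k. k \<ge> 0 \<Longrightarrow> \<exists>x\<in>N. j x = k"
  proof
    assume "additive_structure N \<cong> additive_structure (UNIV :: nat set)"
    then obtain i where "i \<in> iso (additive_structure N) (additive_structure (UNIV :: nat set))"
      by (auto simp: is_iso_def)
    then have add: "\<And>x y. x \<in> N \<Longrightarrow> y \<in> N \<Longrightarrow> i (x + y) = i x + i y" and bij: "bij_betw i N UNIV"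
      by (auto simp: iso_def hom_def additive_structure_def)
    show ?thesis
    proof (rule that[of "\<lambda>x. int (i x)"])
      show "x = y" if "x \<in> N" "y \<in> N" "int (i x) = int (i y)" for x y
        using bij_betw_imp_inj_on[OF bij] that by (auto simp: inj_on_def)
      show "\<exists>x\<in>N. int (i x) = k" if "k \<ge> 0" for k
        using bij_betw_imp_surj_on[OF bij] that by (metis UNIV_I imageE nonneg_int_cases)
    qed (use add in simp)
  next
    assume "additive_structure N \<cong> additive_structure (UNIV :: int set)"
    then obtain i where "i \<in> iso (additive_structure N) (additive_structure (UNIV :: int set))"
      by (auto simp: is_iso_def)
    then have add: "\<And>x y. x \<in> N \<Longrightarrow> y \<in> N \<Longrightarrow> i (x + y) = i x + i y" and bij: "bij_betw i N UNIV"
      by (auto simp: iso_def hom_def additive_structure_def)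
    show ?thesis
    proof (rule that[of i])
      show "x = y" if "x \<in> N" "y \<in> N" "i x = i y" for x y
        using bij_betw_imp_inj_on[OF bij] that by (auto simp: inj_on_def)
      show "\<exists>x\<in>N. i x = k" for k
        using bij_betw_imp_surj_on[OF bij] by (metis UNIV_I imageE)
    qed (use add in simp)
  qed
  have N0: "0 \<in> N" using Nsub by (simp add: additive_submonoid_def)
  have j0: "j 0 = 0" using jadd[OF N0 N0] by simp
  obtain v where v: "v \<in> N" "j v = 1" using jsurj[of 1] by auto
  obtain u where u: "u \<in> charges" "u \<xi> = v" using Nval[OF v(1)] by blast
  have gen: "charges \<subseteq> S" if S: "0 \<in> S" "\<And>m. m \<in> charges \<Longrightarrow> m \<in> S \<longleftrightarrow> m + u \<in> S" for S
  proof -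
    have "\<forall>m\<in>charges. j (m \<xi>) = k \<longrightarrow> m \<in> S" for k
    proof (induction k rule: int_induct[where k = 0])
      case base
      show ?case
      proof (intro ballI impI)
        fix m assume m: "m \<in> charges" "j (m \<xi>) = 0"
        have "m \<xi> = 0" by (rule jinj) (use m valN N0 j0 in auto)
        then have "m = 0" by (intro inj) (use m h.zero_in in auto)
        then show "m \<in> S" using S by simp
      qed
    next
      case (step1 k)
      show ?case
      proof (intro ballI impI)
        fix m assume m: "m \<in> charges" "j (m \<xi>) = k + 1"
        obtain w where w: "w \<in> N" "j w = k" using jsurj step1(1) by blast
        have "m \<xi> = w + u \<xi>"
          by (rule jinj) (use m w u v valN jadd Nsub in \<open>auto simp: additive_submonoid_def\<close>)
        then obtain m' where m': "m' \<in> charges" "m = m' + u" using step m u(1) w(1) by blast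
        have "j (m \<xi>) = j (m' \<xi>) + 1" using jadd valN m' u v by simp
        then have "m' \<in> S" using step1 m m' by simp
        then show "m \<in> S" using S m' by simp
      qed
    next
      case (step2 k)
      show ?case
      proof (intro ballI impI)
        fix m assume m: "m \<in> charges" "j (m \<xi>) = k - 1"
        have "j ((m + u) \<xi>) = k" using jadd valN m u v by simp
        then have "m + u \<in> S" using step2 h.add_in[OF m(1) u(1)] by simp
        then show "m \<in> S" using S m by simp
      qed
    qed
    then show ?thesis by blast
  qed
  show ?thesis by (rule h.symmetric_if_cyclic[OF u(1) gen mn])
qed

text \<open>If there are two ends, their pairings are equal and also transposes of each other.\<close>

lemma pairing_symmetric_large_balls:
  assumes big: "\<And>k::nat. \<exists>x. \<exists>R>0. R \<ge> real k \<and> connected_in E (- graph_ball E x R)"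
    and C: "is_end E x0 C" and mn: "m \<in> charges" "n \<in> charges"
  shows "pairing x0 C m n = pairing x0 C n m"
proof (cases "\<exists>C'. is_end E x0 C' \<and> C' \<noteq> C")
  case True
  then obtain C' where C': "is_end E x0 C'" "C \<noteq> C'" by blast
  show ?thesis
    using pairing_swap[OF C C' mn] pairing_unique_if_large_balls[OF big C C'(1) mn(2,1)] by simp
next
  case False
  then show ?thesis using pairing_symmetric_one_end[OF C _ mn] by blast
qed

lemma three_ends:
  assumes card: "card (components_off x0 k) \<ge> 3" and C: "is_end E x0 C"
  obtains C' C'' where "is_end E x0 C'" "is_end E x0 C''" "C \<noteq> C'" "C \<noteq> C''" "C' \<noteq> C''"
proof -
  let ?K = "components_off x0 k - {C k}"
  have "card ?K \<ge> 2" using card end_component[OF C, of k] by (subst card_Diff_singleton) auto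
  then obtain S where S: "S \<subseteq> ?K" "card S = 2" using obtain_subset_with_card_n by metis
  then obtain A B where AB: "A \<in> ?K" "B \<in> ?K" "A \<noteq> B" by (auto simp: card_2_iff)
  obtain C' where C': "is_end E x0 C'" "C' k = A" using end_through_component[of A x0 k] AB(1)
    by blast
  obtain C'' where C'': "is_end E x0 C''" "C'' k = B" using end_through_component[of B x0 k] AB(2)
    by blast
  show ?thesis by (rule that[OF C'(1) C''(1)]) (use C' C'' AB in auto)
qed

text \<open>The symmetry makes the pairings of all ends equal, because the pairings of two different ends
  are the transposes of each other. So one splitting serves all ends.\<close>

lemma pairings_split:
  assumes hyp: "transferable E \<or> simple_interaction b \<phi> \<and> weakly_transferable E"
  obtains x0 g where "\<And>C m n. is_end E x0 C \<Longrightarrow> m \<in> charges \<Longrightarrow> n \<in> charges \<Longrightarrow>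
    pairing x0 C m n = g m + g n - g (m + n)"
proof -
  obtain x0 where sym: "\<And>C m n. is_end E x0 C \<Longrightarrow> m \<in> charges \<Longrightarrow> n \<in> charges \<Longrightarrow>
    pairing x0 C m n = pairing x0 C n m"
  proof -
    consider (simple) "simple_interaction b \<phi>"
      | (three) x R where "R > 0" "card (graph_components E (- graph_ball E x R)) \<ge> 3"
      | (balls) "\<forall>k::nat. \<exists>x. \<exists>R>0. R \<ge> real k \<and> connected_in E (- graph_ball E x R)"
      using hyp unfolding transferable_def by blast
    then show thesis
    proof cases
      case simple
      then show ?thesis using pairing_symmetric_simple that by blast
    next
      case three
      then have card: "card (components_off x (nat \<lfloor>R\<rfloor>)) \<ge> 3" by (simp add: graph_ball_nball)
      show ?thesis
      proof (rule that[of x])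
        fix C m n assume *: "is_end E x C" "m \<in> charges" "n \<in> charges"
        obtain C' C'' where "is_end E x C'" "is_end E x C''" "C \<noteq> C'" "C \<noteq> C''" "C' \<noteq> C''"
          using three_ends[OF card *(1)] .
        then show "pairing x C m n = pairing x C n m" using pairing_symmetric_three_ends * by blast
      qed
    next
      case balls
      show ?thesis
      proof (rule that)
        fix C m n assume *: "is_end E undefined C" "m \<in> charges" "n \<in> charges"
        show "pairing undefined C m n = pairing undefined C n m"
          by (rule pairing_symmetric_large_balls[OF _ *]) (use balls in blast)
      qed
    qed
  qed
  obtain C0 where C0: "is_end E x0 C0" by (rule end_exists)
  interpret h: monoid_cocycle charges "pairing x0 C0" by (rule pairing_cocycle[OF C0])
  obtain g where g: "\<And>m n. m \<in> charges \<Longrightarrow> n \<in> charges \<Longrightarrow> pairing x0 C0 m n = g m + g n - g (m + n)"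
    using h.symmetric_cocycle_splits sym[OF C0] by blast
  have "pairing x0 C m n = pairing x0 C0 m n" if C: "is_end E x0 C"
    and mn: "m \<in> charges" "n \<in> charges" for C m n
    using pairing_swap[OF C C0 _ mn] sym[OF C0 mn] by (cases "C = C0") auto
  then show ?thesis using g by (intro that[of x0 g]) simp
qed

end

section \<open>Expansions and uniform functions\<close>

lemma local_fun_outside: "f \<in> local_funs b A \<Longrightarrow> \<eta> \<notin> fin_configs b \<Longrightarrow> f \<eta> = 0"
  by (simp add: local_funs_def)

lemma local_fun_cong:
  assumes f: "f \<in> local_funs b A" and \<eta>: "\<eta> \<in> fin_configs b" and \<zeta>: "\<zeta> \<in> fin_configs b"
    and eq: "\<And>x. x \<in> A \<Longrightarrow> \<eta> x = \<zeta> x"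
  shows "f \<eta> = f \<zeta>"
proof -
  have "\<forall>\<eta>\<in>fin_configs b. \<forall>\<eta>'\<in>fin_configs b. (\<forall>x\<in>A. \<eta> x = \<eta>' x) \<longrightarrow> f \<eta> = f \<eta>'"
    using f unfolding local_funs_def mem_Collect_eq by (rule conjunct2)
  from bspec[OF bspec[OF this \<eta>] \<zeta>] eq show ?thesis by blast
qed

lemma local_funsI:
  assumes "\<And>\<eta>. \<eta> \<notin> fin_configs b \<Longrightarrow> f \<eta> = 0"
    and "\<And>\<eta> \<zeta>. \<eta> \<in> fin_configs b \<Longrightarrow> \<zeta> \<in> fin_configs b \<Longrightarrow> (\<And>x. x \<in> A \<Longrightarrow> \<eta> x = \<zeta> x) \<Longrightarrow> f \<eta> = f \<zeta>"
  shows "f \<in> local_funs b A"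
  unfolding local_funs_def mem_Collect_eq by (intro conjI allI ballI impI assms) simp_all

text \<open>Moebius inversion on the finite subsets, applied to the values of a function on the truncations of
  a configuration, gives the terms of its expansion.\<close>

definition mobius :: "('x set \<Rightarrow> real) \<Rightarrow> 'x set \<Rightarrow> real" where
  "mobius g A = (\<Sum>B\<in>Pow A. (-1) ^ card (A - B) * g B)"

lemma sum_Pow_insert:
  assumes "finite A" "x \<notin> A"
  shows "(\<Sum>B\<in>Pow (insert x A). g B) = (\<Sum>B\<in>Pow A. g B + g (insert x B) :: real)"
proof -
  have "(\<Sum>B\<in>Pow (insert x A). g B) = (\<Sum>B\<in>Pow A. g B) + (\<Sum>B\<in>insert x ` Pow A. g B)"
    unfolding Pow_insert by (rule sum.union_disjoint) (use assms in auto)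
  also have "(\<Sum>B\<in>insert x ` Pow A. g B) = (\<Sum>B\<in>Pow A. g (insert x B))"
    by (subst sum.reindex) (use assms in \<open>auto simp: inj_on_def\<close>)
  finally show ?thesis by (simp add: sum.distrib)
qed

lemma mobius_insert:
  assumes "finite A" "x \<notin> A"
  shows "mobius g (insert x A) = mobius (\<lambda>B. g (insert x B) - g B) A"
proof -
  have "(-1) ^ card (insert x A - B) * g B + (-1) ^ card (insert x A - insert x B) * g (insert x B)
      = (-1) ^ card (A - B) * (g (insert x B) - g B)" if "B \<in> Pow A" for B
  proof -
    have "x \<notin> B" using that assms by auto
    then have "card (insert x A - B) = Suc (card (A - B))" "insert x A - insert x B = A - B"
      using assms by (auto simp: insert_Diff_if)
    then show ?thesis by (simp add: algebra_simps)
  qed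
  then show ?thesis unfolding mobius_def sum_Pow_insert[OF assms] by (rule sum.cong[OF refl])
qed

lemma sum_mobius:
  assumes "finite S"
  shows "(\<Sum>A\<in>Pow S. mobius g A) = g S"
  using assms
proof (induction S arbitrary: g)
  case (insert x S)
  have "(\<Sum>A\<in>Pow (insert x S). mobius g A) = (\<Sum>A\<in>Pow S. mobius g A + mobius (\<lambda>B. g (insert x B) - g B) A)"
    unfolding sum_Pow_insert[OF insert.hyps]
  proof (rule sum.cong[OF refl])
    fix A assume "A \<in> Pow S"
    then have "finite A" "x \<notin> A" using insert.hyps finite_subset by auto
    then show "mobius g A + mobius g (insert x A) = mobius g A + mobius (\<lambda>B. g (insert x B) - g B) A"
      by (simp add: mobius_insert)
  qed
  then show ?case using insert.IH by (simp add: sum.distrib)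
qed (simp add: mobius_def)

lemma mobius_zero:
  assumes "finite A" "x \<in> A" "\<And>B. B \<subseteq> A - {x} \<Longrightarrow> g (insert x B) = g B"
  shows "mobius g A = 0"
proof -
  have "A = insert x (A - {x})" using assms by auto
  then have "mobius g A = mobius (\<lambda>B. g (insert x B) - g B) (A - {x})"
    using mobius_insert[of "A - {x}" x g] assms by simp
  also have "\<dots> = 0" unfolding mobius_def by (rule sum.neutral) (use assms in auto)
  finally show ?thesis .
qed

definition truncation :: "'s \<Rightarrow> 'x set \<Rightarrow> ('x \<Rightarrow> 's) \<Rightarrow> 'x \<Rightarrow> 's" where
  "truncation b A \<eta> = (\<lambda>x. if x \<in> A then \<eta> x else b)"

definition mobius_term :: "'s \<Rightarrow> (('x \<Rightarrow> 's) \<Rightarrow> real) \<Rightarrow> 'x set \<Rightarrow> ('x \<Rightarrow> 's) \<Rightarrow> real" where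
  "mobius_term b f A \<eta> = (if \<eta> \<in> fin_configs b then mobius (\<lambda>B. f (truncation b B \<eta>)) A else 0)"

lemma mobius_term_expansion:
  fixes f :: "('x \<Rightarrow> 's) \<Rightarrow> real"
  shows "is_expansion b f (mobius_term b f)"
  unfolding is_expansion_def
proof (intro conjI allI impI ballI)
  fix A :: "'x set" assume A: "finite A"
  have "mobius_term b f A \<in> local_funs b A"
  proof (rule local_funsI)
    fix \<eta> \<eta>' assume fin: "\<eta> \<in> fin_configs b" "\<eta>' \<in> fin_configs b"
      and agree: "\<And>x. x \<in> A \<Longrightarrow> \<eta> x = \<eta>' x"
    have "truncation b B \<eta> = truncation b B \<eta>'" if "B \<in> Pow A" for B
      using that agree by (auto simp: truncation_def fun_eq_iff)
    then show "mobius_term b f A \<eta> = mobius_term b f A \<eta>'" using fin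
      by (simp add: mobius_term_def mobius_def)
  qed (simp add: mobius_term_def)
  moreover have "mobius_term b f A \<eta> = 0" if ex: "\<exists>x\<in>A. \<eta> x = b" for \<eta>
  proof -
    obtain x where x: "x \<in> A" "\<eta> x = b" using ex by auto
    then have "truncation b (insert x B) \<eta> = truncation b B \<eta>" for B by (auto simp: truncation_def)
    then show ?thesis using mobius_zero[OF A x(1)] by (simp add: mobius_term_def)
  qed
  ultimately show "mobius_term b f A \<in> exact_local_funs b A" unfolding exact_local_funs_def by blast
next
  fix \<eta> :: "'x \<Rightarrow> 's" assume \<eta>: "\<eta> \<in> fin_configs b"
  then have "(\<Sum>A\<in>Pow {x. \<eta> x \<noteq> b}. mobius (\<lambda>B. f (truncation b B \<eta>)) A) = f (truncation b {x. \<eta> x \<noteq> b} \<eta>)"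
    by (intro sum_mobius) (simp add: fin_configs_finite)
  moreover have "truncation b {x. \<eta> x \<noteq> b} \<eta> = \<eta>" by (auto simp: truncation_def)
  ultimately show "f \<eta> = (\<Sum>A\<in>Pow {x. \<eta> x \<noteq> b}. mobius_term b f A \<eta>)"
    using \<eta> by (simp add: mobius_term_def)
qed

context connected_graph
begin

lemma finite_dists: "finite A \<Longrightarrow> finite {dst x y | x y. x \<in> A \<and> y \<in> A}"
  by (rule finite_subset[of _ "(\<lambda>(x, y). dst x y) ` (A \<times> A)"]) auto

lemma dst_le_diam: "finite A \<Longrightarrow> x \<in> A \<Longrightarrow> y \<in> A \<Longrightarrow> dst x y \<le> graph_diam E A"
  unfolding graph_diam_def by (rule cSup_upper) (auto intro: bdd_above_finite finite_dists)

lemma diam_le: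
  assumes "\<And>x y. x \<in> A \<Longrightarrow> y \<in> A \<Longrightarrow> dst x y \<le> k"
  shows "graph_diam E A \<le> k"
proof (cases "A = {}")
  case False
  then obtain x where "x \<in> A" by auto
  then have "{dst x y | x y. x \<in> A \<and> y \<in> A} \<noteq> {}" by blast
  then show ?thesis unfolding graph_diam_def by (rule cSup_least) (use assms in auto)
qed (simp add: graph_diam_def Sup_nat_empty)

text \<open>A set of large diameter contains two vertices \<open>x\<close> and \<open>y\<close> far apart. The term of the expansion at
  this set is an alternating sum of second differences of \<open>f\<close> with respect to erasing the states at
  \<open>x\<close> and \<open>y\<close>.\<close>

lemma uniform_fun_if_erasing_local:
  fixes f :: "('x \<Rightarrow> 's) \<Rightarrow> real"
  assumes erase: "\<And>\<eta> x y. \<eta> \<in> fin_configs b \<Longrightarrow> dst x y > r \<Longrightarrow>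
    f \<eta> - f (\<eta>(x := b)) = f (\<eta>(y := b)) - f (\<eta>(y := b, x := b))"
  shows "uniform_fun b E f"
  unfolding uniform_fun_def
proof (intro exI[of _ "mobius_term b f"] conjI exI[of _ "real (Suc r)"] allI impI)
  show "is_expansion b f (mobius_term b f)" by (rule mobius_term_expansion)
  show "real (Suc r) > 0" by simp
  fix A assume A: "finite A \<and> real (Suc r) < real (graph_diam E A)"
  then have "\<not> graph_diam E A \<le> r" by simp
  then obtain x y where xy: "x \<in> A" "y \<in> A" "\<not> dst x y \<le> r" using diam_le[of A r] by blast
  then have ne: "x \<noteq> y" by auto
  show "mobius_term b f A = 0"
  proof
    fix \<eta>
    have "mobius (\<lambda>B. f (truncation b B \<eta>)) A = 0" if \<eta>: "\<eta> \<in> fin_configs b"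
    proof -
      define g where "g = (\<lambda>B. f (truncation b B \<eta>))"
      have "A = insert x (A - {x})" using xy by auto
      then have "mobius g A = mobius (\<lambda>B. g (insert x B) - g B) (A - {x})"
        using mobius_insert[of "A - {x}" x g] A by simp
      also have "\<dots> = 0"
      proof (rule mobius_zero[of _ y])
        show "finite (A - {x})" "y \<in> A - {x}" using A xy ne by auto
        fix B assume B: "B \<subseteq> A - {x} - {y}"
        define \<zeta> where "\<zeta> = truncation b (insert x (insert y B)) \<eta>"
        have "\<zeta> \<in> fin_configs b" unfolding \<zeta>_def truncation_def by (rule fin_configs_restrict[OF \<eta>])
        then have "f \<zeta> - f (\<zeta>(x := b)) = f (\<zeta>(y := b)) - f (\<zeta>(y := b, x := b))"
          using erase xy by simp
        moreover have "\<zeta>(x := b) = truncation b (insert y B) \<eta>"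
          "\<zeta>(y := b) = truncation b (insert x B) \<eta>"
          "\<zeta>(y := b, x := b) = truncation b B \<eta>"
          using B ne by (auto simp: \<zeta>_def truncation_def fun_eq_iff)
        ultimately show "g (insert x (insert y B)) - g (insert y B) = g (insert x B) - g B"
          by (simp add: g_def \<zeta>_def)
      qed
      finally show ?thesis by (simp add: g_def)
    qed
    then show "mobius_term b f A \<eta> = 0 \<eta>" by (simp add: mobius_term_def)
  qed
qed

end

section \<open>Closed uniform forms are differentials of uniform functions\<close>

context local_potential
begin

text \<open>The states in the component of \<open>y\<close> outside the \<open>r\<close>-ball around \<open>x\<close> can be moved far out along
  an end. This does not change the effect of erasing the state at \<open>x\<close>, and afterwards they do not
  interact with the remaining states. So the state at \<open>y\<close> is irrelevant for that effect.\<close>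

lemma erasing_local:
  assumes no_defect: "\<And>C N \<alpha> \<beta>. is_end E x0 C \<Longrightarrow> \<alpha> \<in> fin \<Longrightarrow> supp \<alpha> \<subseteq> nball x0 N \<Longrightarrow> \<beta> \<in> fin \<Longrightarrow>
      supp \<beta> \<subseteq> C (N + r) \<Longrightarrow> defect \<alpha> \<beta> = 0"
    and \<eta>: "\<eta> \<in> fin" and xy: "dst x y > r"
  shows "f \<eta> - f (\<eta>(x := b)) = f (\<eta>(y := b)) - f (\<eta>(y := b, x := b))"
proof -
  have "y \<in> - nball x r" using xy by (simp add: nball_def)
  then obtain K where K: "K \<in> components_off x r" "y \<in> K" by (rule component_exists)
  have Kfar: "dst x z > r" if "z \<in> K" for z
    using component_subset[OF K(1)] that by (auto simp: nball_def)
  obtain C n where C: "is_end E x0 C" "C n \<subseteq> K" using end_in_component[OF K(1)] .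
  have erase: "f \<eta> - f (\<eta>(x := b)) = f (truncation b (- K) \<eta>) - f ((truncation b (- K) \<eta>)(x := b))"
    if \<eta>: "\<eta> \<in> fin" for \<eta>
  proof -
    define \<alpha> where "\<alpha> = truncation b (- K) \<eta>"
    define \<theta> where "\<theta> = truncation b K \<eta>"
    have \<alpha>: "\<alpha> \<in> fin" and \<theta>: "\<theta> \<in> fin" unfolding \<alpha>_def \<theta>_def truncation_def
      by (intro fin_configs_restrict \<eta>)+
    obtain N1 where N1: "supp \<alpha> \<subseteq> nball x0 N1" using fin_in_ball[OF \<alpha>] .
    define N where "N = max n N1"
    have N: "supp \<alpha> \<subseteq> nball x0 N" using subset_trans[OF N1 nball_mono[of N1 N x0]]
      by (simp add: N_def)
    obtain \<beta> where \<beta>: "\<beta> \<in> fin" "supp \<beta> \<subseteq> C (N + r)" "chg \<beta> = chg \<theta>" using chg_in_end[OF C(1) \<theta>] .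
    have "C (N + r) \<subseteq> C n" by (rule end_antimono[OF C(1)]) (simp add: N_def)
    then have \<beta>K: "supp \<beta> \<subseteq> K" using \<beta>(2) C(2) by auto
    have \<alpha>K: "\<alpha> z = b" if "z \<in> K" for z using that by (simp add: \<alpha>_def truncation_def)
    have \<beta>0: "\<beta> z = b" if "z \<notin> K" for z using that \<beta>K by auto
    have \<theta>0: "\<theta> z = b" if "z \<notin> K" for z using that by (simp add: \<theta>_def truncation_def)
    have \<eta>m: "\<eta> = overlay b \<alpha> \<theta>" by (auto simp: overlay_def \<alpha>_def \<theta>_def truncation_def)
    have \<beta>m: "overlay b \<alpha> \<beta> \<in> fin" by (rule fin_configs_overlay[OF \<alpha> \<beta>(1)])
    have "chg \<eta> = chg (overlay b \<alpha> \<beta>)"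
      unfolding \<eta>m using charge_overlay[OF \<alpha> \<theta>] charge_overlay[OF \<alpha> \<beta>(1)] \<alpha>K \<beta>0 \<theta>0 \<beta>(3) by metis
    moreover have "\<eta> z = overlay b \<alpha> \<beta> z" if "z \<notin> K" for z using \<beta>0 \<theta>0 that
      by (simp add: \<eta>m overlay_def)
    ultimately have mv: "(\<eta>, overlay b \<alpha> \<beta>) \<in> (moves E \<phi> K)\<^sup>*"
      by (intro moves_if_same_charge[OF connected_component[OF K(1)] \<eta> \<beta>m])
    have near: "(\<eta>(x := b)) z = \<eta> z" if "w \<in> K" "dst w z \<le> r" for w z
      using Kfar[OF that(1)] that(2) dst_commute[of w x] by auto
    have "f (\<lambda>z. if z \<in> K then overlay b \<alpha> \<beta> z else (\<eta>(x := b)) z) - f (\<eta>(x := b)) = f (overlay b \<alpha> \<beta>) - f \<eta>"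
      by (rule moves_effect_local[OF f_local mv \<eta> fin_configs_upd[OF \<eta>] near])
    moreover have "x \<notin> K" using Kfar[of x] by auto
    then have "(\<lambda>z. if z \<in> K then overlay b \<alpha> \<beta> z else (\<eta>(x := b)) z) = overlay b (\<alpha>(x := b)) \<beta>"
      using \<alpha>K \<beta>0 \<theta>0 by (auto simp: overlay_def \<eta>m fun_eq_iff)
    moreover have "defect \<alpha> \<beta> = 0" by (rule no_defect[OF C(1) \<alpha> N \<beta>(1,2)])
    moreover have "supp (\<alpha>(x := b)) \<subseteq> nball x0 N" using N by auto
    then have "defect (\<alpha>(x := b)) \<beta> = 0" by (rule no_defect[OF C(1) fin_configs_upd[OF \<alpha>] _ \<beta>(1,2)])
    ultimately show ?thesis by (simp add: defect_def \<alpha>_def)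
  qed
  have "truncation b (- K) (\<eta>(y := b)) = truncation b (- K) \<eta>" using K(2)
    by (auto simp: truncation_def)
  then show ?thesis using erase[OF \<eta>] erase[OF fin_configs_upd[OF \<eta>], of y b] by simp
qed

end

context interacting_system
begin

lemma local_change_of_uniform_form:
  assumes unif: "uniform_form b E \<phi> \<omega>" and f: "differential b E \<phi> f = \<omega>"
  shows "\<exists>r. local_change b E \<phi> r f"
proof -
  obtain R where R: "R > 0" and loc: "\<forall>e\<in>E. form_at \<phi> \<omega> e \<in> local_funs b (edge_ball E e R)"
    using unif unfolding uniform_form_def by (elim exE conjE)
  have "local_change b E \<phi> (nat \<lfloor>R\<rfloor>) f"
    unfolding local_change_def
  proof (intro ballI impI)
    fix e \<eta> \<zeta> assume e: "e \<in> E" and \<eta>: "\<eta> \<in> fin" and \<zeta>: "\<zeta> \<in> fin"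
      and agree: "\<forall>x. dst (fst e) x \<le> nat \<lfloor>R\<rfloor> \<or> dst (snd e) x \<le> nat \<lfloor>R\<rfloor> \<longrightarrow> \<eta> x = \<zeta> x"
    have *: "form_at \<phi> \<omega> e \<theta> = f (exchange \<phi> e \<theta>) - f \<theta>" if "\<theta> \<in> fin" for \<theta>
    proof -
      have "(\<theta>, exchange \<phi> e \<theta>) \<in> T" unfolding fin_transitions_iff using that e by blast
      then show ?thesis unfolding form_at_def f[symmetric] by (simp add: differential_def)
    qed
    have "\<forall>x\<in>edge_ball E e R. \<eta> x = \<zeta> x"
      using agree R by (auto simp: edge_ball_def graph_ball_nball nball_def)
    then have "form_at \<phi> \<omega> e \<eta> = form_at \<phi> \<omega> e \<zeta>" using local_fun_cong[OF bspec[OF loc e] \<eta> \<zeta>]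
      by blast
    then show "f (exchange \<phi> e \<eta>) - f \<eta> = f (exchange \<phi> e \<zeta>) - f \<zeta>" using * \<eta> \<zeta> by simp
  qed
  then show ?thesis by blast
qed

text \<open>A potential of a closed uniform form becomes uniform after adding a function of the charge that
  cancels the interaction between the base vertex and the ends.\<close>

lemma closed_uniform_form_exact:
  assumes hyp: "transferable E \<or> simple_interaction b \<phi> \<and> weakly_transferable E"
    and \<omega>: "\<omega> \<in> Z1_unif b E \<phi>"
  obtains f where "f \<in> C0_unif b E" "differential b E \<phi> f = \<omega>"
proof -
  have \<omega>': "\<omega> \<in> forms b E \<phi>" "closed_form b E \<phi> \<omega>" "uniform_form b E \<phi> \<omega>" using \<omega>
    by (auto simp: Z1_unif_def)
  obtain f where f: "\<And>\<eta>. \<eta> \<notin> fin \<Longrightarrow> f \<eta> = 0" "f (\<lambda>_. b) = 0" "differential b E \<phi> f = \<omega>"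
    by (rule closed_form_potential[OF \<omega>'(1,2)]) blast
  obtain r where r: "local_change b E \<phi> r f" using local_change_of_uniform_form[OF \<omega>'(3) f(3)]
    by blast
  interpret P: local_potential E b \<phi> f r by unfold_locales (fact f(2), fact r)
  obtain x0 g where g: "\<And>C m n. is_end E x0 C \<Longrightarrow> m \<in> P.charges \<Longrightarrow> n \<in> P.charges \<Longrightarrow>
    P.pairing x0 C m n = g m + g n - g (m + n)"
    by (rule P.pairings_split[OF hyp]) blast
  obtain C0 where C0: "is_end E x0 C0" by (rule end_exists)
  interpret h: monoid_cocycle P.charges "P.pairing x0 C0" by (rule P.pairing_cocycle[OF C0])
  have g0: "g 0 = 0" using g[OF C0 h.zero_in h.zero_in] h.zero_left[OF h.zero_in] by simp
  define f' where "f' = (\<lambda>\<eta>. if \<eta> \<in> fin then f \<eta> + g (chg \<eta>) else 0)"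
  have change: "f' (exchange \<phi> e \<eta>) - f' \<eta> = f (exchange \<phi> e \<eta>) - f \<eta>" if "e \<in> E" "\<eta> \<in> fin" for e \<eta>
  proof -
    have "(\<eta>, exchange \<phi> e \<eta>) \<in> T" unfolding fin_transitions_iff using that by blast
    from chg_transition[OF this] show ?thesis using that by (simp add: f'_def fin_configs_exchange)
  qed
  have base: "f' (\<lambda>_. b) = 0" by (simp add: f'_def base_fin_config f(2) charge_base g0)
  have "local_change b E \<phi> r f'"
    unfolding local_change_def
  proof (intro ballI impI)
    fix e and \<eta> \<zeta> :: "'x \<Rightarrow> 's" assume *: "e \<in> E" "\<eta> \<in> fin" "\<zeta> \<in> fin"
      "\<forall>x. dst (fst e) x \<le> r \<or> dst (snd e) x \<le> r \<longrightarrow> \<eta> x = \<zeta> x"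
    show "f' (exchange \<phi> e \<eta>) - f' \<eta> = f' (exchange \<phi> e \<zeta>) - f' \<zeta>"
      unfolding change[OF *(1,2)] change[OF *(1,3)]
      using r[unfolded local_change_def, rule_format, OF *(1-3)] *(4) by blast
  qed
  then interpret Q: local_potential E b \<phi> f' r by unfold_locales (rule base)
  have "uniform_fun b E f'"
  proof (rule uniform_fun_if_erasing_local)
    fix \<eta> :: "'x \<Rightarrow> 's" and x y assume \<eta>: "\<eta> \<in> fin" and xy: "r < dst x y"
    show "f' \<eta> - f' (\<eta>(x := b)) = f' (\<eta>(y := b)) - f' (\<eta>(y := b, x := b))"
    proof (rule Q.erasing_local[OF _ \<eta> xy])
      fix C N \<alpha> \<beta> assume C: "is_end E x0 C" and \<alpha>: "\<alpha> \<in> fin" "supp \<alpha> \<subseteq> nball x0 N"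
        and \<beta>: "\<beta> \<in> fin" "supp \<beta> \<subseteq> C (N + r)"
      have disj: "\<alpha> x = b \<or> \<beta> x = b" for x using P.ball_end_apart(1)[OF C, of x N x] \<alpha>(2) \<beta>(2)
        by auto
      have "P.defect \<alpha> \<beta> = g (chg \<alpha>) + g (chg \<beta>) - g (chg \<alpha> + chg \<beta>)"
        using P.pairing_eq[OF C \<alpha> \<beta>] g[OF C P.chargeI[OF \<alpha>(1)] P.chargeI[OF \<beta>(1)]] by simp
      then show "Q.defect \<alpha> \<beta> = 0"
        using charge_overlay[OF \<alpha>(1) \<beta>(1) disj, of \<phi>] fin_configs_overlay[OF \<alpha>(1) \<beta>(1)] \<alpha>(1) \<beta>(1)
        unfolding P.defect_def Q.defect_def by (simp add: f'_def)
    qed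
  qed
  then have "f' \<in> C0_unif b E" using base by (simp add: C0_unif_def f'_def)
  moreover have "differential b E \<phi> f' = \<omega>"
  proof
    fix t
    show "differential b E \<phi> f' t = \<omega> t"
    proof (cases "t \<in> T")
      case True
      obtain \<eta> \<eta>' where t: "t = (\<eta>, \<eta>')" by (cases t)
      then obtain e where "e \<in> E" "\<eta> \<in> fin" "\<eta>' = exchange \<phi> e \<eta>" using True fin_transitions_iff
        by blast
      then show ?thesis using change[of e \<eta>] True t unfolding f(3)[symmetric]
        by (simp add: differential_def)
    next
      case False
      then show ?thesis unfolding f(3)[symmetric] by (simp add: differential_def)
    qed
  qed
  ultimately show ?thesis by (rule that)
qed

end

section \<open>Differentials of uniform functions\<close>

lemma expansion_superset:
  assumes F: "is_expansion b f F" and \<eta>: "\<eta> \<in> fin_configs b" and S: "finite S" "{x. \<eta> x \<noteq> b} \<subseteq> S"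
  shows "f \<eta> = (\<Sum>A\<in>Pow S. F A \<eta>)"
proof -
  have "F A \<eta> = 0" if "A \<in> Pow S - Pow {x. \<eta> x \<noteq> b}" for A
  proof -
    have "finite A" using that S finite_subset by auto
    then have "F A \<in> exact_local_funs b A" using F by (simp add: is_expansion_def)
    moreover have "\<exists>x\<in>A. \<eta> x = b" using that by auto
    ultimately show ?thesis by (simp add: exact_local_funs_def)
  qed
  then have "(\<Sum>A\<in>Pow {x. \<eta> x \<noteq> b}. F A \<eta>) = (\<Sum>A\<in>Pow S. F A \<eta>)"
    by (intro sum.mono_neutral_left) (use S in auto)
  then show ?thesis using F \<eta> by (simp add: is_expansion_def)
qed

lemma expansion_term_local:
  assumes "is_expansion b f F" "finite A" "\<eta> \<in> fin_configs b" "\<zeta> \<in> fin_configs b"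
    "\<And>x. x \<in> A \<Longrightarrow> \<eta> x = \<zeta> x"
  shows "F A \<eta> = F A \<zeta>"
proof -
  have "F A \<in> exact_local_funs b A" using assms(1,2) by (simp add: is_expansion_def)
  then have "F A \<in> local_funs b A" by (simp add: exact_local_funs_def)
  then show ?thesis by (rule local_fun_cong) (fact assms)+
qed

lemma local_funs_subspace: "subspace (local_funs b A)"
proof (rule subspaceI)
  show "0 \<in> local_funs b A" by (rule local_funsI) simp_all
next
  fix f g assume f: "f \<in> local_funs b A" and g: "g \<in> local_funs b A"
  show "f + g \<in> local_funs b A"
  proof (rule local_funsI)
    show "(f + g) \<eta> = 0" if "\<eta> \<notin> fin_configs b" for \<eta>
      using local_fun_outside[OF f that] local_fun_outside[OF g that] by simp
    show "(f + g) \<eta> = (f + g) \<eta>'"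
      if "\<eta> \<in> fin_configs b" "\<eta>' \<in> fin_configs b" "\<And>x. x \<in> A \<Longrightarrow> \<eta> x = \<eta>' x" for \<eta> \<eta>'
      using local_fun_cong[OF f that] local_fun_cong[OF g that] by simp
  qed
next
  fix c f assume f: "f \<in> local_funs b A"
  show "c *\<^sub>R f \<in> local_funs b A"
  proof (rule local_funsI)
    show "(c *\<^sub>R f) \<eta> = 0" if "\<eta> \<notin> fin_configs b" for \<eta>
      using local_fun_outside[OF f that] by (simp add: scaleR_fun_def)
    show "(c *\<^sub>R f) \<eta> = (c *\<^sub>R f) \<eta>'"
      if "\<eta> \<in> fin_configs b" "\<eta>' \<in> fin_configs b" "\<And>x. x \<in> A \<Longrightarrow> \<eta> x = \<eta>' x" for \<eta> \<eta>'
      using local_fun_cong[OF f that] by (simp add: scaleR_fun_def)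
  qed
qed

lemma exact_local_funs_subspace: "subspace (exact_local_funs b A)"
  using local_funs_subspace[of b A]
  by (simp add: subspace_def exact_local_funs_def scaleR_fun_def)

lemma C0_unif_subspace: "subspace (C0_unif b E)"
proof (rule subspaceI)
  have "is_expansion b 0 (\<lambda>A. 0)"
    by (simp add: is_expansion_def subspace_0[OF exact_local_funs_subspace])
  then have "uniform_fun b E 0"
    unfolding uniform_fun_def by (intro exI[of _ "\<lambda>A. 0"] conjI exI[of _ "1::real"]) simp_all
  then show "0 \<in> C0_unif b E" by (simp add: C0_unif_def)
next
  fix f f' :: "('a \<Rightarrow> 'b) \<Rightarrow> real" assume f: "f \<in> C0_unif b E" and f': "f' \<in> C0_unif b E"
  obtain F R where F: "is_expansion b f F" "R > 0"
    "\<And>A. finite A \<Longrightarrow> real (graph_diam E A) > R \<Longrightarrow> F A = 0"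
    using f unfolding C0_unif_def uniform_fun_def by blast
  obtain F' R'
    where F': "is_expansion b f' F'" "R' > 0" "\<And>A. finite A \<Longrightarrow> real (graph_diam E A) > R' \<Longrightarrow> F' A = 0"
    using f' unfolding C0_unif_def uniform_fun_def by blast
  have "is_expansion b (f + f') (\<lambda>A. F A + F' A)"
    unfolding is_expansion_def
  proof (intro conjI allI impI ballI)
    fix A :: "'a set" assume "finite A"
    then have "F A \<in> exact_local_funs b A" "F' A \<in> exact_local_funs b A" using F F'
      by (auto simp: is_expansion_def)
    then show "F A + F' A \<in> exact_local_funs b A"
      by (rule subspace_add[OF exact_local_funs_subspace])
  next
    fix \<eta> :: "'a \<Rightarrow> 'b" assume "\<eta> \<in> fin_configs b"
    then show "(f + f') \<eta> = (\<Sum>A\<in>Pow {x. \<eta> x \<noteq> b}. (F A + F' A) \<eta>)"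
      using F F' by (simp add: is_expansion_def sum.distrib)
  qed
  moreover have "\<forall>A. finite A \<and> real (graph_diam E A) > max R R' \<longrightarrow> F A + F' A = 0" using F F'
    by simp
  moreover have "max R R' > 0" using F by simp
  ultimately have "uniform_fun b E (f + f')"
    unfolding uniform_fun_def by (intro exI[of _ "\<lambda>A. F A + F' A"] conjI exI[of _ "max R R'"])
  then show "f + f' \<in> C0_unif b E" using f f' by (simp add: C0_unif_def)
next
  fix c :: real and f :: "('a \<Rightarrow> 'b) \<Rightarrow> real" assume f: "f \<in> C0_unif b E"
  obtain F R where F: "is_expansion b f F" "R > 0"
    "\<And>A. finite A \<Longrightarrow> real (graph_diam E A) > R \<Longrightarrow> F A = 0"
    using f unfolding C0_unif_def uniform_fun_def by blast
  have "is_expansion b (c *\<^sub>R f) (\<lambda>A. c *\<^sub>R F A)"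
    unfolding is_expansion_def
  proof (intro conjI allI impI ballI)
    fix A :: "'a set" assume "finite A"
    then have "F A \<in> exact_local_funs b A" using F by (auto simp: is_expansion_def)
    then show "c *\<^sub>R F A \<in> exact_local_funs b A"
      by (rule subspace_scale[OF exact_local_funs_subspace])
  next
    fix \<eta> :: "'a \<Rightarrow> 'b" assume "\<eta> \<in> fin_configs b"
    then show "(c *\<^sub>R f) \<eta> = (\<Sum>A\<in>Pow {x. \<eta> x \<noteq> b}. (c *\<^sub>R F A) \<eta>)"
      using F by (simp add: is_expansion_def scaleR_fun_def sum_distrib_left)
  qed
  moreover have "\<forall>A. finite A \<and> real (graph_diam E A) > R \<longrightarrow> c *\<^sub>R F A = 0" using F by simp
  ultimately have "uniform_fun b E (c *\<^sub>R f)"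
    unfolding uniform_fun_def using F(2) by (intro exI[of _ "\<lambda>A. c *\<^sub>R F A"] conjI exI[of _ R])
  then show "c *\<^sub>R f \<in> C0_unif b E" using f by (simp add: C0_unif_def scaleR_fun_def)
qed

lemma differential_add: "differential b E \<phi> (f + g) = differential b E \<phi> f + differential b E \<phi> g"
  by (auto simp: differential_def fun_eq_iff)

lemma differential_scale: "differential b E \<phi> (c *\<^sub>R f) = c *\<^sub>R differential b E \<phi> f"
  by (auto simp: differential_def scaleR_fun_def fun_eq_iff algebra_simps)

lemma differential_path:
  assumes "set p \<subseteq> fin_transitions b E \<phi>" "successively (\<lambda>e e'. snd e = fst e') p" "p \<noteq> []"
  shows "sum_list (map (differential b E \<phi> f) p) = f (snd (last p)) - f (fst (hd p))"
  using assms
proof (induction p)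
  case (Cons t p)
  then show ?case by (cases p) (auto simp: differential_def)
qed simp

context interacting_system
begin

text \<open>The terms of the expansion at sets that contain no end of the edge \<open>e\<close> are not affected by the
  exchange at \<open>e\<close>. The other nonzero ones only depend on the states near \<open>e\<close>.\<close>

lemma differential_Z1_unif:
  assumes f: "f \<in> C0_unif b E"
  shows "differential b E \<phi> f \<in> Z1_unif b E \<phi>"
proof -
  obtain F R where F: "is_expansion b f F" and R: "R > 0"
    and far: "\<And>A. finite A \<Longrightarrow> real (graph_diam E A) > R \<Longrightarrow> F A = 0"
    using f unfolding C0_unif_def uniform_fun_def by blast
  have "differential b E \<phi> f \<in> forms b E \<phi>"
    using fin_transitions_sym by (auto simp: forms_def differential_def)
  moreover have "closed_form b E \<phi> (differential b E \<phi> f)"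
    unfolding closed_form_def closed_edge_path_def
  proof (intro allI impI)
    fix p assume p:
      "set p \<subseteq> T \<and> successively (\<lambda>e e'. snd e = fst e') p \<and> (p \<noteq> [] \<longrightarrow> snd (last p) = fst (hd p))"
    then show "sum_list (map (differential b E \<phi> f) p) = 0"
      using differential_path[of p b E \<phi> f] by (cases "p = []") auto
  qed
  moreover have "uniform_form b E \<phi> (differential b E \<phi> f)"
    unfolding uniform_form_def
  proof (intro exI[of _ R] conjI ballI R)
    fix e assume e: "e \<in> E"
    have at: "form_at \<phi> (differential b E \<phi> f) e \<eta> = (if \<eta> \<in> fin then f (exchange \<phi> e \<eta>) - f \<eta> else 0)" for \<eta>
    proof -
      have "(\<eta>, exchange \<phi> e \<eta>) \<in> T \<longleftrightarrow> \<eta> \<in> fin" unfolding fin_transitions_iff using e by blast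
      then show ?thesis by (simp add: form_at_def differential_def)
    qed
    have change: "f (exchange \<phi> e \<eta>) - f \<eta> = f (exchange \<phi> e \<zeta>) - f \<zeta>"
      if \<eta>: "\<eta> \<in> fin" and \<zeta>: "\<zeta> \<in> fin" and agree: "\<forall>x\<in>edge_ball E e R. \<eta> x = \<zeta> x" for \<eta> \<zeta>
    proof -
      let ?x = "fst e" and ?y = "snd e"
      define S where "S = supp \<eta> \<union> supp \<zeta> \<union> {?x, ?y}"
      have S: "finite S" using \<eta> \<zeta> by (simp add: S_def fin_configs_finite)
      have sub: "supp \<eta> \<subseteq> S" "supp \<zeta> \<subseteq> S" "supp (exchange \<phi> e \<eta>) \<subseteq> S" "supp (exchange \<phi> e \<zeta>) \<subseteq> S"
        by (auto simp: S_def exchange_def Let_def)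
      have \<eta>e: "exchange \<phi> e \<eta> \<in> fin" and \<zeta>e: "exchange \<phi> e \<zeta> \<in> fin" using \<eta> \<zeta>
        by (simp_all add: fin_configs_exchange)
      have ends: "?x \<in> edge_ball E e R" "?y \<in> edge_ball E e R" using R
        by (auto simp: edge_ball_def graph_ball_def)
      have "F A (exchange \<phi> e \<eta>) - F A \<eta> = F A (exchange \<phi> e \<zeta>) - F A \<zeta>" if A: "A \<in> Pow S" for A
      proof -
        have fA: "finite A" using A S finite_subset by auto
        show ?thesis
        proof (cases "?x \<in> A \<or> ?y \<in> A")
          case False
          then have same: "exchange \<phi> e \<theta> z = \<theta> z" if "z \<in> A" for \<theta> z using exchange_other that
            by metis
          have "F A (exchange \<phi> e \<eta>) = F A \<eta>" "F A (exchange \<phi> e \<zeta>) = F A \<zeta>"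
            using expansion_term_local[OF F fA] \<eta> \<zeta> \<eta>e \<zeta>e same by metis+
          then show ?thesis by simp
        next
          case True
          show ?thesis
          proof (cases "real (graph_diam E A) > R")
            case False
            have "z \<in> edge_ball E e R" if "z \<in> A" for z
              using True False dst_le_diam[OF fA _ that]
                by (fastforce simp: edge_ball_def graph_ball_def)
            then have "\<eta> z = \<zeta> z" "exchange \<phi> e \<eta> z = exchange \<phi> e \<zeta> z" if "z \<in> A" for z
              using agree ends that by (auto simp: exchange_def Let_def)
            then have "F A \<eta> = F A \<zeta>" "F A (exchange \<phi> e \<eta>) = F A (exchange \<phi> e \<zeta>)"
              using expansion_term_local[OF F fA] \<eta> \<zeta> \<eta>e \<zeta>e by blast+
            then show ?thesis by simp
          qed (use far[OF fA] in simp)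
        qed
      qed
      then have "(\<Sum>A\<in>Pow S. F A (exchange \<phi> e \<eta>) - F A \<eta>) = (\<Sum>A\<in>Pow S. F A (exchange \<phi> e \<zeta>) - F A \<zeta>)"
        by (rule sum.cong[OF refl])
      then show ?thesis
        using expansion_superset[OF F \<eta> S sub(1)] expansion_superset[OF F \<zeta> S sub(2)]
          expansion_superset[OF F \<eta>e S sub(3)] expansion_superset[OF F \<zeta>e S sub(4)]
        by (simp add: sum_subtractf)
    qed
    show "form_at \<phi> (differential b E \<phi> f) e \<in> local_funs b (edge_ball E e R)"
    proof (rule local_funsI)
      fix \<eta> \<zeta> assume *: "\<eta> \<in> fin" "\<zeta> \<in> fin" "\<And>x. x \<in> edge_ball E e R \<Longrightarrow> \<eta> x = \<zeta> x"
      have "\<forall>x\<in>edge_ball E e R. \<eta> x = \<zeta> x" using *(3) by blast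
      from change[OF *(1,2) this] show
        "form_at \<phi> (differential b E \<phi> f) e \<eta> = form_at \<phi> (differential b E \<phi> f) e \<zeta>"
        unfolding at using *(1,2) by simp
    qed (simp add: at)
  qed
  ultimately show ?thesis by (simp add: Z1_unif_def)
qed

text \<open>A uniform function that is invariant under the exchanges only depends on the charge. It is also
  additive, because charges can be kept far apart, and so it is a total conserved quantity.\<close>

lemma kernel_of_differential:
  assumes f: "f \<in> C0_unif b E" and df: "differential b E \<phi> f = 0"
  obtains \<xi> where "\<xi> \<in> consv b \<phi>" "\<And>\<eta>. \<eta> \<in> fin \<Longrightarrow> f \<eta> = (\<Sum>x\<in>supp \<eta>. \<xi> (\<eta> x))"
proof -
  obtain F R where F: "is_expansion b f F" and R: "R > 0"
    and far: "\<And>A. finite A \<Longrightarrow> real (graph_diam E A) > R \<Longrightarrow> F A = 0"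
    using f unfolding C0_unif_def uniform_fun_def by blast
  have base: "f (\<lambda>_. b) = 0" using f by (simp add: C0_unif_def)
  have invar: "f (exchange \<phi> e \<eta>) = f \<eta>" if "e \<in> E" "\<eta> \<in> fin" for e \<eta>
  proof -
    have "(\<eta>, exchange \<phi> e \<eta>) \<in> T" unfolding fin_transitions_iff using that by blast
    moreover have "differential b E \<phi> f (\<eta>, exchange \<phi> e \<eta>) = 0" by (simp add: df)
    ultimately show ?thesis by (simp add: differential_def)
  qed
  have same: "f \<eta> = f \<eta>'" if "\<eta> \<in> fin" "\<eta>' \<in> fin" "chg \<eta> = chg \<eta>'" for \<eta> \<eta>'
  proof -
    have "connected_in E UNIV" using is_locale by (simp add: is_locale_def)
    then have "(\<eta>, \<eta>') \<in> (moves E \<phi> UNIV)\<^sup>*" using moves_if_same_charge that by blast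
    then have "\<eta>' \<in> fin \<and> f \<eta>' = f \<eta>"
    proof (induction rule: rtrancl_induct)
      case (step \<zeta> \<zeta>')
      then obtain e where "e \<in> E" "\<zeta>' = exchange \<phi> e \<zeta>" by (auto simp: moves_def)
      then show ?case using step.IH invar by (simp add: fin_configs_exchange)
    qed (use that in simp)
    then show ?thesis by simp
  qed
  have additive: "f (overlay b \<alpha> \<beta>) = f \<alpha> + f \<beta>"
    if \<alpha>: "\<alpha> \<in> fin" and \<beta>: "\<beta> \<in> fin" and apart: "\<And>x y. \<alpha> x \<noteq> b \<Longrightarrow> \<beta> y \<noteq> b \<Longrightarrow> real (dst x y) > R"
      for \<alpha> \<beta>
  proof -
    let ?m = "overlay b \<alpha> \<beta>"
    have m: "?m \<in> fin" by (rule fin_configs_overlay[OF \<alpha> \<beta>])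
    have fa: "finite (supp \<alpha>)" "finite (supp \<beta>)" using \<alpha> \<beta> by (simp_all add: fin_configs_finite)
    have disj: "\<alpha> x = b \<or> \<beta> x = b" for x using apart[of x x] R by auto
    have "f (\<lambda>_. b) = (\<Sum>A\<in>Pow {}. F A (\<lambda>_. b))"
      by (rule expansion_superset[OF F base_fin_config]) auto
    then have "F {} (\<lambda>_. b) = 0" using base by simp
    then have F0: "F {} ?m = 0" using expansion_term_local[OF F finite.emptyI m base_fin_config]
      by simp
    have "F A ?m = 0" if A: "A \<in> Pow (supp \<alpha> \<union> supp \<beta>) - (Pow (supp \<alpha>) \<union> Pow (supp \<beta>))" for A
    proof -
      obtain x y where xy: "x \<in> A" "y \<in> A" "\<alpha> x \<noteq> b" "\<beta> y \<noteq> b" using A by blast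
      have fA: "finite A" using A fa finite_subset[of A "supp \<alpha> \<union> supp \<beta>"] by auto
      have "real (graph_diam E A) > R" using apart[OF xy(3,4)] dst_le_diam[OF fA xy(1,2)]
        by linarith
      then show ?thesis using far[OF fA] by simp
    qed
    then have "(\<Sum>A\<in>Pow (supp \<alpha> \<union> supp \<beta>). F A ?m) = (\<Sum>A\<in>Pow (supp \<alpha>) \<union> Pow (supp \<beta>). F A ?m)"
      by (intro sum.mono_neutral_right) (use fa in auto)
    moreover have "Pow (supp \<alpha>) \<inter> Pow (supp \<beta>) = {{}}" using disj by auto
    then have "(\<Sum>A\<in>Pow (supp \<alpha>) \<union> Pow (supp \<beta>). F A ?m)
        = (\<Sum>A\<in>Pow (supp \<alpha>). F A ?m) + (\<Sum>A\<in>Pow (supp \<beta>). F A ?m)"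
      using sum.union_inter[of "Pow (supp \<alpha>)" "Pow (supp \<beta>)" "\<lambda>A. F A ?m"] fa F0 by simp
    moreover have "(\<Sum>A\<in>Pow (supp \<alpha>). F A ?m) = (\<Sum>A\<in>Pow (supp \<alpha>). F A \<alpha>)"
    proof (rule sum.cong[OF refl])
      fix A assume A: "A \<in> Pow (supp \<alpha>)"
      then have "finite A" using fa finite_subset by auto
      then show "F A ?m = F A \<alpha>" by (rule expansion_term_local[OF F _ m \<alpha>]) (use A in \<open>auto simp: overlay_def\<close>)
    qed
    moreover have "(\<Sum>A\<in>Pow (supp \<beta>). F A ?m) = (\<Sum>A\<in>Pow (supp \<beta>). F A \<beta>)"
    proof (rule sum.cong[OF refl])
      fix A assume A: "A \<in> Pow (supp \<beta>)"
      then have "finite A" using fa finite_subset by auto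
      moreover have "?m x = \<beta> x" if "x \<in> A" for x using A that disj[of x]
        by (auto simp: overlay_def)
      ultimately show "F A ?m = F A \<beta>" by (rule expansion_term_local[OF F _ m \<beta>])
    qed
    ultimately show ?thesis
      using expansion_superset[OF F m, of "supp \<alpha> \<union> supp \<beta>"] expansion_superset[OF F \<alpha> fa(1)]
        expansion_superset[OF F \<beta> fa(2)] fa overlay_supp[of b \<alpha> \<beta>] by simp
  qed
  obtain x0 :: 'x where True by simp
  define single where "single = (\<lambda>(x::'x) s. (\<lambda>_. b)(x := s))"
  have single: "single x s \<in> fin" for x s unfolding single_def
    by (intro fin_configs_upd base_fin_config)
  have single_chg: "chg (single x s) = chg (single y s)" for x y s
  proof
    fix \<xi>
    have "\<xi> \<in> consv b \<phi> \<Longrightarrow> chg (single x s) \<xi> = (\<Sum>z\<in>{x}. \<xi> (single x s z))" for x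
      by (rule charge_superset) (auto simp: single_def)
    then show "chg (single x s) \<xi> = chg (single y s) \<xi>"
      by (cases "\<xi> \<in> consv b \<phi>") (simp_all add: single_def charge_def)
  qed
  define \<xi> where "\<xi> = (\<lambda>s. f (single x0 s))"
  have "single x0 b = (\<lambda>_. b)" by (auto simp: single_def)
  then have \<xi>b: "\<xi> b = 0" using base by (simp add: \<xi>_def)
  have sum: "f \<eta> = (\<Sum>x\<in>supp \<eta>. \<xi> (\<eta> x))" if "\<eta> \<in> fin" for \<eta>
    using that
  proof (induction "card (supp \<eta>)" arbitrary: \<eta>)
    case 0
    then have "supp \<eta> = {}" by (simp add: fin_configs_finite)
    then have "\<eta> = (\<lambda>_. b)" by auto
    then show ?case using base by simp
  next
    case (Suc n)
    then have fin: "finite (supp \<eta>)" by (simp add: fin_configs_finite)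
    obtain x where x: "x \<in> supp \<eta>" using Suc.hyps(2) by fastforce
    let ?\<zeta> = "\<eta>(x := b)"
    have \<zeta>: "?\<zeta> \<in> fin" by (rule fin_configs_upd[OF Suc.prems])
    have supp\<zeta>: "supp ?\<zeta> = supp \<eta> - {x}" by auto
    \<comment> \<open>Moving the state at \<open>x\<close> to a vertex \<open>y\<close> far away from the other states does not change \<open>f\<close>.\<close>
    obtain N where N: "supp ?\<zeta> \<subseteq> nball x0 N" using finite_subset_nball fin supp\<zeta>
      by (metis finite_Diff)
    obtain y where y: "dst x0 y > N + nat \<lceil>R\<rceil>" by (rule far_vertex)
    have apart: "real (dst z y) > R" if "z \<in> supp ?\<zeta>" for z
    proof -
      have "dst x0 z \<le> N" using N that by (auto simp: nball_def)
      then have "dst z y > nat \<lceil>R\<rceil>" using y dst_triangle[of x0 y z] by linarith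
      then show ?thesis by linarith
    qed
    have ap: "real (dst z w) > R" if "?\<zeta> z \<noteq> b" "single y (\<eta> x) w \<noteq> b" for z w
      using apart[of z] that by (auto simp: single_def split: if_splits)
    have disj: "?\<zeta> z = b \<or> single y (\<eta> x) z = b" for z
    proof (rule ccontr)
      assume "\<not> (?\<zeta> z = b \<or> single y (\<eta> x) z = b)"
      then have "real (dst z z) > R" by (intro ap) blast+
      then show False using R by simp
    qed
    have "\<eta> = overlay b ?\<zeta> (single x (\<eta> x))" by (auto simp: overlay_def single_def)
    then have "chg \<eta> = chg ?\<zeta> + chg (single x (\<eta> x))"
      using charge_overlay[OF \<zeta> single[of x "\<eta> x"], of \<phi>] by (simp add: single_def)
    also have "\<dots> = chg (overlay b ?\<zeta> (single y (\<eta> x)))"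
      unfolding charge_overlay[OF \<zeta> single[of y "\<eta> x"] disj, of \<phi>] single_chg[of x "\<eta> x" y]
        by (rule refl)
    finally have "f \<eta> = f (overlay b ?\<zeta> (single y (\<eta> x)))"
      using same Suc.prems fin_configs_overlay[OF \<zeta> single] by blast
    also have "\<dots> = f ?\<zeta> + f (single y (\<eta> x))" by (rule additive[OF \<zeta> single ap])
    also have "f (single y (\<eta> x)) = \<xi> (\<eta> x)" unfolding \<xi>_def
      by (rule same[OF single single single_chg])
    also have "f ?\<zeta> = (\<Sum>z\<in>supp ?\<zeta>. \<xi> (?\<zeta> z))"
      by (rule Suc.hyps(1)[OF _ \<zeta>]) (use Suc.hyps(2) x fin supp\<zeta> in simp)
    also have "\<dots> = (\<Sum>z\<in>supp \<eta> - {x}. \<xi> (\<eta> z))" unfolding supp\<zeta> by (rule sum.cong) auto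
    finally show ?case using sum.remove[OF fin x, of "\<lambda>z. \<xi> (\<eta> z)"] by simp
  qed
  have sum': "f \<eta> = (\<Sum>x\<in>A. \<xi> (\<eta> x))" if "finite A" "supp \<eta> \<subseteq> A" for \<eta> A
  proof -
    have "(\<Sum>x\<in>supp \<eta>. \<xi> (\<eta> x)) = (\<Sum>x\<in>A. \<xi> (\<eta> x))"
      by (rule sum.mono_neutral_left) (use that \<xi>b in auto)
    moreover have "\<eta> \<in> fin" using that finite_subset by (auto simp: fin_configs_finite)
    ultimately show ?thesis using sum by simp
  qed
  have "\<xi> \<in> consv b \<phi>"
    unfolding consv_def mem_Collect_eq
  proof (intro conjI allI \<xi>b)
    fix s t
    obtain y where "dst x0 y > 0" by (rule far_vertex)
    then obtain z where "dst x0 z = 1" using dst_intermediate[of 1 x0 y] by auto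
    then have xz: "(x0, z) \<in> E" using dst_relpow[of x0 z] by simp
    then have ne: "x0 \<noteq> z" using edge_irrefl by auto
    define \<eta> where "\<eta> = (\<lambda>_. b)(x0 := s, z := t)"
    have \<eta>: "\<eta> \<in> fin" unfolding \<eta>_def by (intro fin_configs_upd base_fin_config)
    have "f \<eta> = (\<Sum>x\<in>{x0, z}. \<xi> (\<eta> x))" by (rule sum') (auto simp: \<eta>_def)
    moreover have "f (exchange \<phi> (x0, z) \<eta>) = (\<Sum>x\<in>{x0, z}. \<xi> (exchange \<phi> (x0, z) \<eta> x))"
      by (rule sum') (use ne in \<open>auto simp: \<eta>_def exchange_apply\<close>)
    ultimately show "\<xi> s + \<xi> t = \<xi> (fst (\<phi> (s, t))) + \<xi> (snd (\<phi> (s, t)))"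
      using invar[OF xz \<eta>] ne by (simp add: \<eta>_def exchange_apply)
  qed
  then show ?thesis using sum by (rule that)
qed

end

section \<open>Homomorphisms on the free part of an abelian group\<close>

text \<open>More than \<open>d\<close> integer vectors of length \<open>d\<close> are linearly dependent over the integers. The last
  coordinate is eliminated with the help of a vector in which it does not vanish.\<close>

lemma integer_vectors_dependent:
  fixes v :: "'i \<Rightarrow> nat \<Rightarrow> int"
  assumes "finite I" "card I > d"
  shows "\<exists>c. (\<exists>i\<in>I. c i \<noteq> 0) \<and> (\<forall>j<d. (\<Sum>i\<in>I. c i * v i j) = 0)"
  using assms
proof (induction d arbitrary: I v)
  case 0
  then have "I \<noteq> {}" by auto
  then show ?case by (intro exI[of _ "\<lambda>_. 1"]) auto
next
  case (Suc d)
  show ?case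
  proof (cases "\<exists>p\<in>I. v p d \<noteq> 0")
    case False
    have "d < card I" using Suc.prems by simp
    then obtain c where c: "\<exists>i\<in>I. c i \<noteq> 0" "\<forall>j<d. (\<Sum>i\<in>I. c i * v i j) = 0"
      using Suc.IH[OF Suc.prems(1), of v] by blast
    have "(\<Sum>i\<in>I. c i * v i d) = 0" using False by simp
    then have "\<forall>j<Suc d. (\<Sum>i\<in>I. c i * v i j) = 0" using c(2) by (simp add: less_Suc_eq)
    then show ?thesis using c(1) by blast
  next
    case True
    then obtain p where p: "p \<in> I" "v p d \<noteq> 0" by blast
    define J where "J = I - {p}"
    have J: "finite J" "d < card J" "p \<notin> J" "I = insert p J" using Suc.prems p by (auto simp: J_def)
    define w where "w = (\<lambda>i j. v p d * v i j - v i d * v p j)"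
    obtain c where c: "\<exists>i\<in>J. c i \<noteq> 0" "\<forall>j<d. (\<Sum>i\<in>J. c i * w i j) = 0"
      using Suc.IH[OF J(1,2), of w] by blast
    \<comment> \<open>The combination with coefficients \<open>c\<close> of the \<open>w i\<close>, written in terms of the \<open>v i\<close>\<close>
    define e where "e = (\<lambda>i. if i = p then - (\<Sum>i\<in>J. c i * v i d) else c i * v p d)"
    have sum: "(\<Sum>i\<in>I. e i * v i j) = (\<Sum>i\<in>J. c i * w i j)" for j
    proof -
      have "(\<Sum>i\<in>J. e i * v i j) = (\<Sum>i\<in>J. c i * v p d * v i j)"
        by (rule sum.cong) (use J(3) in \<open>auto simp: e_def\<close>)
      then have "(\<Sum>i\<in>I. e i * v i j) = - (\<Sum>i\<in>J. c i * v i d) * v p j + (\<Sum>i\<in>J. c i * v p d * v i j)"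
        using J by (simp add: e_def)
      also have "\<dots> = (\<Sum>i\<in>J. c i * w i j)"
        by (simp add: w_def sum_distrib_left sum_distrib_right sum_subtractf algebra_simps)
      finally show ?thesis .
    qed
    have "\<forall>j<Suc d. (\<Sum>i\<in>I. e i * v i j) = 0"
      using c(2) unfolding sum less_Suc_eq by (auto simp: w_def)
    moreover have "\<exists>i\<in>I. e i \<noteq> 0"
    proof -
      obtain i where "i \<in> J" "c i \<noteq> 0" using c(1) by blast
      then show ?thesis using p J by (intro bexI[of _ i]) (auto simp: e_def)
    qed
    ultimately show ?thesis by blast
  qed
qed

locale free_part_basis = comm_group A for A :: "('a, 'm) monoid_scheme" (structure) +
  fixes d :: nat and \<gamma> :: "nat \<Rightarrow> 'a"
  assumes rank: "has_rank A d" and generators: "free_part_generators A d \<gamma>"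
begin

lemma gen_closed: "j < d \<Longrightarrow> \<gamma> j \<in> carrier A"
  using generators by (simp add: free_part_generators_def)

lemma torsion_subgroup: "subgroup (torsion_part A) A"
proof (rule subgroup.intro)
  show "torsion_part A \<subseteq> carrier A" by (auto simp: torsion_part_def)
  show "\<one> \<in> torsion_part A" by (auto simp: torsion_part_def intro!: exI[of _ 1])
next
  fix x y assume "x \<in> torsion_part A" "y \<in> torsion_part A"
  then obtain m n :: nat
    where *: "x \<in> carrier A" "m > 0" "x [^] m = \<one>" "y \<in> carrier A" "n > 0" "y [^] n = \<one>"
    by (auto simp: torsion_part_def)
  have "x [^] (m * n) = (x [^] m) [^] n" "y [^] (m * n) = (y [^] n) [^] m"
    using nat_pow_pow[OF *(1)] nat_pow_pow[OF *(4)] by (simp_all add: mult.commute[of m n])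
  then have "x [^] (m * n) = \<one>" "y [^] (m * n) = \<one>" using *(3,6) by simp_all
  then have "(x \<otimes> y) [^] (m * n) = \<one>" using * by (simp add: pow_mult_distrib m_comm)
  then show "x \<otimes> y \<in> torsion_part A" using *
    by (auto simp: torsion_part_def intro!: exI[of _ "m * n"])
next
  fix x assume "x \<in> torsion_part A"
  then obtain m :: nat where *: "x \<in> carrier A" "m > 0" "x [^] m = \<one>"
    by (auto simp: torsion_part_def)
  then have "(inv x) [^] m = \<one>" by (simp add: nat_pow_inv)
  then show "inv x \<in> torsion_part A" using * by (auto simp: torsion_part_def)
qed

definition gen_prod :: "(nat \<Rightarrow> int) \<Rightarrow> 'a" where
  "gen_prod n = (\<Otimes>j\<in>{..<d}. \<gamma> j [^] n j)"

text \<open>The coordinates of an element with respect to the generators, modulo torsion.\<close>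

definition coords :: "'a \<Rightarrow> (nat \<Rightarrow> int) \<Rightarrow> bool" where
  "coords a n \<longleftrightarrow> (\<exists>t\<in>torsion_part A. a = gen_prod n \<otimes> t)"

lemma gen_prod_closed [simp]: "gen_prod n \<in> carrier A"
  unfolding gen_prod_def by (rule finprod_closed) (auto simp: gen_closed)

lemma gen_prod_cong: "(\<And>j. j < d \<Longrightarrow> n j = m j) \<Longrightarrow> gen_prod n = gen_prod m"
  unfolding gen_prod_def by (rule finprod_cong') (auto simp: gen_closed)

lemma gen_prod_add: "gen_prod (\<lambda>j. n j + m j) = gen_prod n \<otimes> gen_prod m"
proof -
  have "gen_prod (\<lambda>j. n j + m j) = (\<Otimes>j\<in>{..<d}. \<gamma> j [^] n j \<otimes> \<gamma> j [^] m j)"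
    unfolding gen_prod_def by (rule finprod_cong') (auto simp: gen_closed int_pow_mult)
  also have "\<dots> = gen_prod n \<otimes> gen_prod m"
    unfolding gen_prod_def by (rule finprod_multf) (auto simp: gen_closed)
  finally show ?thesis .
qed

lemma gen_prod_zero: "gen_prod (\<lambda>_. 0) = \<one>"
  by (simp add: gen_prod_def)

lemma gen_prod_uminus: "gen_prod (\<lambda>j. - n j) = inv (gen_prod n)"
  using gen_prod_add[of "\<lambda>j. - n j" n] by (simp add: gen_prod_zero inv_equality)

lemma torsion_closed: "t \<in> torsion_part A \<Longrightarrow> t \<in> carrier A"
  by (simp add: torsion_part_def)

lemma coords_carrier: "coords a n \<Longrightarrow> a \<in> carrier A"
  by (auto simp: coords_def torsion_closed)

lemma coords_mult:
  assumes "coords a n" "coords c m"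
  shows "coords (a \<otimes> c) (\<lambda>j. n j + m j)"
proof -
  obtain s t where st: "s \<in> torsion_part A" "t \<in> torsion_part A" "a = gen_prod n \<otimes> s"
    "c = gen_prod m \<otimes> t"
    using assms by (auto simp: coords_def)
  then have "a \<otimes> c = gen_prod (\<lambda>j. n j + m j) \<otimes> (s \<otimes> t)"
    using torsion_closed by (simp add: gen_prod_add m_ac)
  then show ?thesis using subgroup.m_closed[OF torsion_subgroup st(1,2)] by (auto simp: coords_def)
qed

lemma coords_inv:
  assumes "coords a n"
  shows "coords (inv a) (\<lambda>j. - n j)"
proof -
  obtain s where s: "s \<in> torsion_part A" "a = gen_prod n \<otimes> s" using assms by (auto simp: coords_def)
  then have "inv a = gen_prod (\<lambda>j. - n j) \<otimes> inv s"
    using torsion_closed by (simp add: gen_prod_uminus inv_mult)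
  then show ?thesis using subgroup.m_inv_closed[OF torsion_subgroup s(1)] by (auto simp: coords_def)
qed

lemma coords_torsion: "t \<in> torsion_part A \<Longrightarrow> coords t (\<lambda>_. 0)"
  by (auto simp: coords_def gen_prod_zero torsion_closed)

lemma coords_torsion_iff:
  assumes "coords a n"
  shows "a \<in> torsion_part A \<longleftrightarrow> gen_prod n \<in> torsion_part A"
proof -
  obtain t where t: "t \<in> torsion_part A" "a = gen_prod n \<otimes> t" using assms by (auto simp: coords_def)
  then have "a \<otimes> inv t = gen_prod n" using torsion_closed[OF t(1)] by (simp add: m_assoc)
  then show ?thesis
    using t subgroup.m_closed[OF torsion_subgroup] subgroup.m_inv_closed[OF torsion_subgroup t(1)]
      by metis
qed

lemma coords_nat_pow: "coords a n \<Longrightarrow> coords (a [^] (k::nat)) (\<lambda>j. int k * n j)"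
proof (induction k)
  case 0
  then show ?case using coords_torsion[OF subgroup.one_closed[OF torsion_subgroup]] by simp
next
  case (Suc k)
  then show ?case using coords_mult[of "a [^] k" "\<lambda>j. int k * n j" a n] by (simp add: algebra_simps)
qed

lemma coords_int_pow:
  assumes "coords a n"
  shows "coords (a [^] (k::int)) (\<lambda>j. k * n j)"
proof (cases "k < 0")
  case True
  have "a [^] k = inv (a [^] nat (- k))" unfolding int_pow_def2[of _ a k] using True
    by (simp only: if_True)
  moreover have "(\<lambda>j. - (int (nat (- k)) * n j)) = (\<lambda>j. k * n j)" using True by (intro ext) simp
  ultimately show ?thesis using coords_inv[OF coords_nat_pow[OF assms, of "nat (- k)"]]
    by (simp only:)
next
  case False
  have "a [^] k = a [^] nat k" unfolding int_pow_def2[of _ a k] using False by (simp only: if_False)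
  moreover have "(\<lambda>j. int (nat k) * n j) = (\<lambda>j. k * n j)" using False by (intro ext) simp
  ultimately show ?thesis using coords_nat_pow[OF assms, of "nat k"] by (simp only:)
qed

lemma coords_finprod:
  assumes "finite B" "\<And>i. i \<in> B \<Longrightarrow> coords (f i) (n i)"
  shows "coords (finprod A f B) (\<lambda>j. \<Sum>i\<in>B. n i j)"
  using assms
proof (induction B rule: finite_induct)
  case empty
  then show ?case using coords_torsion[OF subgroup.one_closed[OF torsion_subgroup]] by simp
next
  case (insert i B)
  then have "f \<in> B \<rightarrow> carrier A" "f i \<in> carrier A" using coords_carrier by auto
  then show ?case using insert coords_mult[of "f i" "n i" "finprod A f B"] by simp
qed

lemma coords_gen: "j < d \<Longrightarrow> coords (\<gamma> j) (\<lambda>i. if i = j then 1 else 0)"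
proof -
  assume j: "j < d"
  have "gen_prod (\<lambda>i. if i = j then 1 else 0) = (\<Otimes>i\<in>{..<d}. if j = i then \<gamma> i else \<one>)"
    unfolding gen_prod_def by (rule finprod_cong') (auto simp: gen_closed)
  also have "\<dots> = \<gamma> j" using j by (intro finprod_singleton) (auto simp: gen_closed)
  finally have "\<gamma> j = gen_prod (\<lambda>i. if i = j then 1 else 0) \<otimes> \<one>" using j gen_closed by simp
  then show ?thesis using subgroup.one_closed[OF torsion_subgroup] unfolding coords_def by blast
qed

lemma coords_exist:
  assumes "a \<in> carrier A"
  obtains n where "coords a n"
proof -
  let ?H = "{a. \<exists>n. coords a n}"
  have "subgroup ?H A"
  proof (rule subgroup.intro)
    show "?H \<subseteq> carrier A" using coords_carrier by auto
    show "\<one> \<in> ?H" using coords_torsion[OF subgroup.one_closed[OF torsion_subgroup]] by auto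
    show "x \<otimes> y \<in> ?H" if "x \<in> ?H" "y \<in> ?H" for x y using that coords_mult by blast
    show "inv x \<in> ?H" if "x \<in> ?H" for x using that coords_inv by blast
  qed
  moreover have "\<gamma> ` {..<d} \<union> torsion_part A \<subseteq> ?H" using coords_gen coords_torsion by auto
  ultimately have "generate A (\<gamma> ` {..<d} \<union> torsion_part A) \<subseteq> ?H" by (intro generate_subgroup_incl)
  then show ?thesis using assms generators that by (auto simp: free_part_generators_def)
qed

text \<open>If the generators satisfied a relation \<open>n\<close> modulo torsion, then \<open>n\<close> and the coordinates of
  \<open>d\<close> independent elements would be linearly dependent, and a dependence between them would
  contradict the independence.\<close>

lemma torsion_coords_zero:
  assumes n: "gen_prod n \<in> torsion_part A" and j: "j < d"
  shows "n j = 0"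
proof (rule ccontr)
  assume nj: "n j \<noteq> 0"
  obtain B where B: "int_independent A B" "card B = d" using rank by (auto simp: has_rank_def)
  have fB: "finite B" "B \<subseteq> carrier A" using B(1) by (auto simp: int_independent_def)
  have "\<forall>a\<in>B. \<exists>m. coords a m" using fB(2) coords_exist by blast
  then obtain N where N: "\<And>a. a \<in> B \<Longrightarrow> coords a (N a)" by metis
  \<comment> \<open>The relation is put in front of the coordinate vectors of \<open>B\<close>.\<close>
  define v where "v = (\<lambda>i. case i of None \<Rightarrow> n | Some a \<Rightarrow> N a)"
  have "card (insert None (Some ` B)) > d" using fB B(2) by (simp add: card_image)
  then obtain c where c: "\<exists>i\<in>insert None (Some ` B). c i \<noteq> 0"
    "\<forall>j<d. (\<Sum>i\<in>insert None (Some ` B). c i * v i j) = 0"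
    using integer_vectors_dependent[of "insert None (Some ` B)" d v] fB(1) by auto
  define P where "P = (\<Otimes>a\<in>B. a [^] c (Some a))"
  have P: "coords P (\<lambda>j. \<Sum>a\<in>B. c (Some a) * N a j)"
    unfolding P_def by (rule coords_finprod[OF fB(1)]) (rule coords_int_pow[OF N])
  have rel: "(\<Sum>a\<in>B. c (Some a) * N a j) = - c None * n j" if "j < d" for j
  proof -
    have "c None * n j + (\<Sum>i\<in>Some ` B. c i * v i j) = 0"
      using c(2) that fB(1) by (simp add: v_def)
    moreover have "(\<Sum>i\<in>Some ` B. c i * v i j) = (\<Sum>a\<in>B. c (Some a) * N a j)"
      by (subst sum.reindex) (auto simp: v_def)
    ultimately show ?thesis by simp
  qed
  have "gen_prod (\<lambda>j. \<Sum>a\<in>B. c (Some a) * N a j) = gen_prod (\<lambda>j. - c None * n j)"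
    by (rule gen_prod_cong) (rule rel)
  moreover have "gen_prod (\<lambda>j. - c None * n j) \<in> torsion_part A"
  proof -
    have "coords (gen_prod n) n"
      using subgroup.one_closed[OF torsion_subgroup] unfolding coords_def
        by (intro bexI[of _ \<one>]) simp_all
    then have "coords (gen_prod n [^] (- c None)) (\<lambda>j. - c None * n j)" by (rule coords_int_pow)
    moreover have "gen_prod n [^] (- c None) \<in> torsion_part A"
      by (rule subgroup_int_pow_closed[OF torsion_subgroup n])
    ultimately show ?thesis using coords_torsion_iff by blast
  qed
  ultimately have "P \<in> torsion_part A" using coords_torsion_iff[OF P] by simp
  then obtain k :: nat where k: "k > 0" "P [^] k = \<one>" by (auto simp: torsion_part_def)
  have "P [^] int k = (\<Otimes>a\<in>B. a [^] (c (Some a) * int k))"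
    unfolding P_def using fB
  proof (induction B rule: finite_induct)
    case (insert a B)
    have cl: "(\<lambda>a. a [^] c (Some a)) \<in> B \<rightarrow> carrier A"
      "(\<lambda>a. a [^] (c (Some a) * int k)) \<in> B \<rightarrow> carrier A"
      "a \<in> carrier A" using insert.prems by auto
    then have cl': "(\<Otimes>a\<in>B. a [^] c (Some a)) \<in> carrier A" by (intro finprod_closed)
    have "(\<Otimes>a\<in>insert a B. a [^] c (Some a)) [^] int k
        = (a [^] c (Some a)) [^] int k \<otimes> (\<Otimes>a\<in>B. a [^] c (Some a)) [^] int k"
      using insert.hyps cl cl' by (simp add: int_pow_mult_distrib m_comm)
    also have "\<dots> = (\<Otimes>a\<in>insert a B. a [^] (c (Some a) * int k))"
      using insert cl by (simp add: int_pow_pow)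
    finally show ?case .
  qed simp
  then have "(\<Otimes>a\<in>B. a [^] (c (Some a) * int k)) = \<one>" using k(2) by (simp add: int_pow_int)
  moreover have "\<forall>m::'a \<Rightarrow> int. (\<Otimes>a\<in>B. a [^] m a) = \<one> \<longrightarrow> (\<forall>a\<in>B. m a = 0)"
    using B(1) by (simp add: int_independent_def)
  ultimately have "\<forall>a\<in>B. c (Some a) * int k = 0" by (elim allE[of _ "\<lambda>a. c (Some a) * int k"]) simp
  then have c0: "\<forall>a\<in>B. c (Some a) = 0" using k(1) by simp
  then have "c None \<noteq> 0" using c(1) by auto
  moreover have "c None * n j = 0" using rel[OF j] c0 by simp
  ultimately show False using nj by simp
qed

lemma coords_unique:
  assumes "coords a n" "coords a m" "j < d"
  shows "n j = m j"
proof -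
  have "coords (a \<otimes> inv a) (\<lambda>j. n j + - m j)"
    by (rule coords_mult[OF assms(1) coords_inv[OF assms(2)]])
  then have "coords \<one> (\<lambda>j. n j + - m j)" using coords_carrier[OF assms(1)] by simp
  from iffD1[OF coords_torsion_iff[OF this] subgroup.one_closed[OF torsion_subgroup]]
  have "gen_prod (\<lambda>j. n j + - m j) \<in> torsion_part A" .
  from torsion_coords_zero[OF this assms(3)] show ?thesis by simp
qed

text \<open>Additive maps to a real vector space vanish on torsion and so are determined by their values
  at the generators.\<close>

lemma additive_eq_if_eq_on_gens:
  fixes f g :: "'a \<Rightarrow> 'u::real_vector"
  assumes f: "\<And>x y. x \<in> carrier A \<Longrightarrow> y \<in> carrier A \<Longrightarrow> f (x \<otimes> y) = f x + f y"
    and g: "\<And>x y. x \<in> carrier A \<Longrightarrow> y \<in> carrier A \<Longrightarrow> g (x \<otimes> y) = g x + g y"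
    and eq: "\<And>j. j < d \<Longrightarrow> f (\<gamma> j) = g (\<gamma> j)" and a: "a \<in> carrier A"
  shows "f a = g a"
proof -
  define h where "h = (\<lambda>a. f a - g a)"
  have h: "h (x \<otimes> y) = h x + h y" if "x \<in> carrier A" "y \<in> carrier A" for x y
    using f[OF that] g[OF that] by (simp add: h_def)
  have h1: "h \<one> = 0" using h[of \<one> \<one>] by simp
  have pow: "h (x [^] (n::nat)) = real n *\<^sub>R h x" if "x \<in> carrier A" for x n
  proof (induction n)
    case (Suc n)
    then show ?case using h[of "x [^] n" x] that by (simp add: scaleR_left_distrib add.commute)
  qed (simp add: h1)
  let ?H = "{x \<in> carrier A. h x = 0}"
  have "subgroup ?H A"
  proof (rule subgroup.intro)
    show "inv x \<in> ?H" if "x \<in> ?H" for x using that h[of "inv x" x] h1 by simp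
  qed (use h h1 in auto)
  moreover have "t \<in> ?H" if t: "t \<in> torsion_part A" for t
  proof -
    obtain n :: nat where n: "t \<in> carrier A" "n > 0" "t [^] n = \<one>" using t
      by (auto simp: torsion_part_def)
    then have "real n *\<^sub>R h t = 0" using pow[OF n(1), of n] h1 by simp
    then show ?thesis using n by simp
  qed
  moreover have "\<gamma> j \<in> ?H" if "j < d" for j using gen_closed[OF that] eq[OF that]
    by (simp add: h_def)
  ultimately have "generate A (\<gamma> ` {..<d} \<union> torsion_part A) \<subseteq> ?H"
    by (intro generate_subgroup_incl) auto
  then show ?thesis using a generators by (auto simp: free_part_generators_def h_def)
qed

text \<open>By the uniqueness of the coordinates at the generators modulo torsion, the values at the
  generators may be prescribed.\<close>

lemma additive_with_values:
  fixes v :: "nat \<Rightarrow> 'u::real_vector"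
  obtains f where "\<And>x y. x \<in> carrier A \<Longrightarrow> y \<in> carrier A \<Longrightarrow> f (x \<otimes> y) = f x + f y"
    and "\<And>j. j < d \<Longrightarrow> f (\<gamma> j) = v j"
    and "\<And>U x. subspace U \<Longrightarrow> (\<And>j. j < d \<Longrightarrow> v j \<in> U) \<Longrightarrow> f x \<in> U"
proof -
  define n where "n = (\<lambda>a. SOME n. coords a n)"
  have n: "coords a (n a)" if "a \<in> carrier A" for a
    unfolding n_def using coords_exist[OF that] by (metis someI_ex)
  define f where "f = (\<lambda>a. \<Sum>j<d. of_int (n a j) *\<^sub>R v j)"
  have f: "f a = (\<Sum>j<d. of_int (m j) *\<^sub>R v j)" if "coords a m" for a m
  proof -
    have "n a j = m j" if "j < d" for j
      using coords_unique[OF n[OF coords_carrier[OF \<open>coords a m\<close>]] \<open>coords a m\<close> that] .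
    then show ?thesis by (simp add: f_def)
  qed
  show ?thesis
  proof (rule that[of f])
    fix x y assume "x \<in> carrier A" "y \<in> carrier A"
    then show "f (x \<otimes> y) = f x + f y"
      using f[OF coords_mult[OF n n]] f[OF n] by (simp add: scaleR_left_distrib sum.distrib)
  next
    fix j assume j: "j < d"
    have "f (\<gamma> j) = (\<Sum>i<d. of_int (if i = j then 1 else 0) *\<^sub>R v i)"
      by (rule f[OF coords_gen[OF j]])
    also have "\<dots> = (\<Sum>i<d. if i = j then v i else 0)" by (rule sum.cong) auto
    also have "\<dots> = v j" using j by simp
    finally show "f (\<gamma> j) = v j" .
  next
    fix U x assume "subspace U" "\<And>j. j < d \<Longrightarrow> v j \<in> U"
    then show "f x \<in> U" unfolding f_def by (intro subspace_sum subspace_scale) auto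
  qed
qed

end

section \<open>Homomorphisms and the abelianization\<close>

lemma Hom_iff: "\<psi> \<in> Hom G U \<longleftrightarrow> (\<forall>\<sigma>\<in>carrier G. \<psi> \<sigma> \<in> U) \<and>
    (\<forall>\<sigma>\<in>carrier G. \<forall>\<tau>\<in>carrier G. \<psi> (\<sigma> \<otimes>\<^bsub>G\<^esub> \<tau>) = \<psi> \<sigma> + \<psi> \<tau>) \<and> (\<forall>\<sigma>. \<sigma> \<notin> carrier G \<longrightarrow> \<psi> \<sigma> = 0)"
  by (auto simp: Hom_def hom_def additive_structure_def)

lemma Hom_subspace:
  assumes "group G" "subspace U"
  shows "subspace (Hom G U)"
proof (rule subspaceI)
  show "0 \<in> Hom G U" using subspace_0[OF assms(2)] by (simp add: Hom_iff)
next
  fix \<psi> \<psi>' assume "\<psi> \<in> Hom G U" "\<psi>' \<in> Hom G U"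
  then show "\<psi> + \<psi>' \<in> Hom G U" using subspace_add[OF assms(2)] by (simp add: Hom_iff add_ac)
next
  fix c \<psi> assume "\<psi> \<in> Hom G U"
  then show "c *\<^sub>R \<psi> \<in> Hom G U"
    using subspace_scale[OF assms(2)] by (simp add: Hom_iff scaleR_fun_def scaleR_right_distrib)
qed

lemma direct_power_subspace: "subspace U \<Longrightarrow> subspace (direct_power d U)"
  by (rule subspaceI) (auto simp: direct_power_def scaleR_fun_def subspace_0 subspace_add subspace_scale)

text \<open>The kernel is a subgroup that contains all commutators. So a homomorphism to a vector space factors
  through the abelianization.\<close>

lemma (in group) Hom_derived:
  assumes \<psi>: "\<psi> \<in> Hom G U" and "x \<in> derived G (carrier G)"
  shows "\<psi> x = 0"
proof -
  have add: "\<psi> (x \<otimes> y) = \<psi> x + \<psi> y" if "x \<in> carrier G" "y \<in> carrier G" for x y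
    using \<psi> that by (simp add: Hom_iff)
  have one: "\<psi> \<one> = 0" using add[of \<one> \<one>] by simp
  have inv: "\<psi> (inv x) = - \<psi> x" if "x \<in> carrier G" for x
    using add[of "inv x" x] that one by (simp add: eq_neg_iff_add_eq_0)
  let ?H = "{x \<in> carrier G. \<psi> x = 0}"
  have "subgroup ?H G" by (rule subgroup.intro) (auto simp: add one inv)
  moreover have "derived_set G (carrier G) \<subseteq> ?H" by (auto simp: add inv)
  ultimately have "derived G (carrier G) \<subseteq> ?H" unfolding derived_def
    by (rule generate_subgroup_incl[rotated])
  then show ?thesis using assms(2) by auto
qed

lemma (in group) Hom_coset_value:
  assumes \<psi>: "\<psi> \<in> Hom G U" and x: "x \<in> carrier G"
  shows "the_elem (\<psi> ` (derived G (carrier G) #> x)) = \<psi> x"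
proof -
  have sub: "subgroup (derived G (carrier G)) G" by (rule derived_is_subgroup) simp
  have "\<psi> y = \<psi> x" if "y \<in> derived G (carrier G) #> x" for y
  proof -
    obtain z where z: "z \<in> derived G (carrier G)" "y = z \<otimes> x" using \<open>y \<in> _\<close> by (auto simp: r_coset_def)
    have "z \<in> carrier G" using z(1) subgroup.subset[OF sub] by auto
    then show ?thesis using \<psi> x z Hom_derived[OF \<psi> z(1)] by (simp add: Hom_iff)
  qed
  moreover have "x \<in> derived G (carrier G) #> x" by (rule rcos_self[OF x sub])
  ultimately have "\<psi> ` (derived G (carrier G) #> x) = {\<psi> x}" by blast
  then show ?thesis by simp
qed

text \<open>Homomorphisms on \<open>G\<close> are the same as additive maps on the abelianization, and these correspond to
  their values at the generators.\<close>

lemma eval_gens_iso: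
  fixes G :: "('g, 'm) monoid_scheme" and U :: "'u::real_vector set"
  assumes G: "group G" and U: "subspace U"
    and rank: "has_rank (abelianization G) d"
      and gens: "free_part_generators (abelianization G) d \<gamma>"
  shows "linear_iso_on (Hom G U) (direct_power d U) (eval_gens d \<gamma>)"
proof -
  interpret G: group G by (rule G)
  let ?N = "derived G (carrier G)" and ?A = "abelianization G"
  have carA: "carrier ?A = (\<lambda>x. ?N #>\<^bsub>G\<^esub> x) ` carrier G"
    by (simp add: abelianization_def carrier_FactGroup)
  interpret N: normal ?N G by (rule G.derived_is_normal) (rule G.normal_self)
  have multA: "(?N #>\<^bsub>G\<^esub> x) \<otimes>\<^bsub>?A\<^esub> (?N #>\<^bsub>G\<^esub> y) = ?N #>\<^bsub>G\<^esub> (x \<otimes>\<^bsub>G\<^esub> y)"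
    if "x \<in> carrier G" "y \<in> carrier G" for x y
    using N.rcos_sum[OF that] by (simp add: abelianization_def)
  have "comm_group ?A" unfolding abelianization_def by (rule G.derived_quot_is_comm_group)
  then interpret A: free_part_basis ?A d \<gamma>
    unfolding free_part_basis_def free_part_basis_axioms_def using rank gens by simp
  have \<gamma>: "\<exists>x\<in>carrier G. \<gamma> j = ?N #>\<^bsub>G\<^esub> x" if "j < d" for j using A.gen_closed[OF that] carA by auto
  have at: "eval_gens d \<gamma> \<psi> j = \<psi> x" if "\<psi> \<in> Hom G U" "j < d" "x \<in> carrier G" "\<gamma> j = ?N #>\<^bsub>G\<^esub> x"
    for \<psi> j x
    using that G.Hom_coset_value by (simp add: eval_gens_def)
  have sub: "subspace (Hom G U)" by (rule Hom_subspace[OF G U])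
  have inj: "inj_on (eval_gens d \<gamma>) (Hom G U)"
  proof (rule inj_onI)
    fix \<psi> \<psi>' assume \<psi>: "\<psi> \<in> Hom G U" "\<psi>' \<in> Hom G U" and eq: "eval_gens d \<gamma> \<psi> = eval_gens d \<gamma> \<psi>'"
    have add: "the_elem (\<psi> ` (a \<otimes>\<^bsub>?A\<^esub> c)) = the_elem (\<psi> ` a) + the_elem (\<psi> ` c)"
      if "\<psi> \<in> Hom G U" "a \<in> carrier ?A" "c \<in> carrier ?A" for \<psi> a c
    proof -
      obtain x y where xy: "x \<in> carrier G" "y \<in> carrier G" "a = ?N #>\<^bsub>G\<^esub> x" "c = ?N #>\<^bsub>G\<^esub> y"
        using \<open>a \<in> _\<close> \<open>c \<in> _\<close> carA by auto
      have "\<psi> (x \<otimes>\<^bsub>G\<^esub> y) = \<psi> x + \<psi> y" using \<open>\<psi> \<in> _\<close> xy by (simp add: Hom_iff)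
      then show ?thesis using xy multA G.Hom_coset_value[OF \<open>\<psi> \<in> _\<close>] by simp
    qed
    have "the_elem (\<psi> ` a) = the_elem (\<psi>' ` a)" if "a \<in> carrier ?A" for a
    proof (rule A.additive_eq_if_eq_on_gens[OF add[OF \<psi>(1)] add[OF \<psi>(2)] _ that])
      fix j assume "j < d"
      then show "the_elem (\<psi> ` \<gamma> j) = the_elem (\<psi>' ` \<gamma> j)" using fun_cong[OF eq, of j]
        by (simp add: eval_gens_def)
    qed
    then have "\<psi> x = \<psi>' x" if "x \<in> carrier G" for x
      using that carA G.Hom_coset_value[OF \<psi>(1) that] G.Hom_coset_value[OF \<psi>(2) that] by force
    moreover have "\<psi> x = \<psi>' x" if "x \<notin> carrier G" for x using \<psi> that by (simp add: Hom_iff)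
    ultimately show "\<psi> = \<psi>'" by blast
  qed
  have into: "eval_gens d \<gamma> \<psi> \<in> direct_power d U" if "\<psi> \<in> Hom G U" for \<psi>
  proof -
    have "eval_gens d \<gamma> \<psi> j \<in> U" if j: "j < d" for j
    proof -
      obtain x where x: "x \<in> carrier G" "\<gamma> j = ?N #>\<^bsub>G\<^esub> x" using \<gamma>[OF j] by blast
      then show ?thesis using at[OF \<open>\<psi> \<in> _\<close> j x] \<open>\<psi> \<in> _\<close> by (simp add: Hom_iff)
    qed
    then show ?thesis by (simp add: direct_power_def eval_gens_def)
  qed
  have onto: "\<exists>\<psi>\<in>Hom G U. eval_gens d \<gamma> \<psi> = v" if v: "v \<in> direct_power d U" for v
  proof -
    obtain f where f: "\<And>x y. x \<in> carrier ?A \<Longrightarrow> y \<in> carrier ?A \<Longrightarrow> f (x \<otimes>\<^bsub>?A\<^esub> y) = f x + f y"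
      "\<And>j. j < d \<Longrightarrow> f (\<gamma> j) = v j"
      "\<And>U x. subspace U \<Longrightarrow> (\<And>j. j < d \<Longrightarrow> v j \<in> U) \<Longrightarrow> f x \<in> U"
      by (rule A.additive_with_values[of v]) blast
    define \<psi> where "\<psi> = (\<lambda>x. if x \<in> carrier G then f (?N #>\<^bsub>G\<^esub> x) else 0)"
    have \<psi>: "\<psi> \<in> Hom G U"
      unfolding Hom_iff
    proof (intro conjI ballI allI impI)
      show "\<psi> \<sigma> \<in> U" if "\<sigma> \<in> carrier G" for \<sigma>
        using that f(3)[OF U] v by (simp add: \<psi>_def direct_power_def)
      show "\<psi> (\<sigma> \<otimes>\<^bsub>G\<^esub> \<tau>) = \<psi> \<sigma> + \<psi> \<tau>" if "\<sigma> \<in> carrier G" "\<tau> \<in> carrier G" for \<sigma> \<tau>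
        using that f(1)[of "?N #>\<^bsub>G\<^esub> \<sigma>" "?N #>\<^bsub>G\<^esub> \<tau>"] multA[OF that] carA by (simp add: \<psi>_def)
    qed (simp add: \<psi>_def)
    have "eval_gens d \<gamma> \<psi> j = v j" for j
    proof (cases "j < d")
      case True
      then obtain x where x: "x \<in> carrier G" "\<gamma> j = ?N #>\<^bsub>G\<^esub> x" using \<gamma> by blast
      then show ?thesis using at[OF \<psi> True x] f(2)[OF True] by (simp add: \<psi>_def)
    next
      case False
      then show ?thesis using v by (simp add: eval_gens_def direct_power_def)
    qed
    then show ?thesis using \<psi> by blast
  qed
  have "bij_betw (eval_gens d \<gamma>) (Hom G U) (direct_power d U)"
    unfolding bij_betw_def using inj into onto by force
  moreover have "eval_gens d \<gamma> (\<psi> + \<psi>') = eval_gens d \<gamma> \<psi> + eval_gens d \<gamma> \<psi>'"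
    if "\<psi> \<in> Hom G U" "\<psi>' \<in> Hom G U" for \<psi> \<psi>'
  proof
    fix j
    show "eval_gens d \<gamma> (\<psi> + \<psi>') j = (eval_gens d \<gamma> \<psi> + eval_gens d \<gamma> \<psi>') j"
    proof (cases "j < d")
      case True
      then obtain x where "x \<in> carrier G" "\<gamma> j = ?N #>\<^bsub>G\<^esub> x" using \<gamma> by blast
      then show ?thesis using at[OF _ True] that subspace_add[OF sub that] by simp
    qed (simp add: eval_gens_def)
  qed
  moreover have "eval_gens d \<gamma> (c *\<^sub>R \<psi>) = c *\<^sub>R eval_gens d \<gamma> \<psi>" if "\<psi> \<in> Hom G U" for c \<psi>
  proof
    fix j
    show "eval_gens d \<gamma> (c *\<^sub>R \<psi>) j = (c *\<^sub>R eval_gens d \<gamma> \<psi>) j"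
    proof (cases "j < d")
      case True
      then obtain x where "x \<in> carrier G" "\<gamma> j = ?N #>\<^bsub>G\<^esub> x" using \<gamma> by blast
      then show ?thesis using at[OF _ True] that subspace_scale[OF sub that]
        by (simp add: scaleR_fun_def)
    qed (simp add: eval_gens_def scaleR_fun_def)
  qed
  ultimately show ?thesis
    unfolding linear_iso_on_def using sub direct_power_subspace[OF U] by blast
qed

section \<open>Actions of a group on the configurations\<close>

text \<open>Like all functions on configurations considered here, \<open>total b u\<close> vanishes where the support of
  the configuration is infinite. The total of a conserved quantity \<open>\<xi>\<close> is \<open>total b (\<lambda>_. \<xi>)\<close>.\<close>

definition total :: "'s \<Rightarrow> ('x \<Rightarrow> 's \<Rightarrow> real) \<Rightarrow> ('x \<Rightarrow> 's) \<Rightarrow> real" where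
  "total b u \<eta> = (if \<eta> \<in> fin_configs b then \<Sum>x | \<eta> x \<noteq> b. u x (\<eta> x) else 0)"

lemma total_add: "total b (\<lambda>x. u x + v x) = total b u + total b v"
  by (auto simp: total_def fun_eq_iff sum.distrib)

lemma total_scale: "total b (\<lambda>x. c *\<^sub>R u x) = c *\<^sub>R total b u"
  by (auto simp: total_def fun_eq_iff scaleR_fun_def sum_distrib_left)

locale acted_system = interacting_system E b \<phi>
  for E :: "'x rel" and b :: 's and \<phi> :: "'s \<times> 's \<Rightarrow> 's \<times> 's" +
  fixes G :: "('g, 'm) monoid_scheme" and \<alpha> :: "'g \<Rightarrow> 'x \<Rightarrow> 'x"
  assumes group_G: "group G" and locale_action: "locale_action G E \<alpha>"
    and free_action: "free_action G \<alpha>"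
begin

sublocale G: group G by (rule group_G)

lemma action: "group_action G UNIV \<alpha>"
  using locale_action by (simp add: locale_action_def)

lemma act_mult: "\<sigma> \<in> carrier G \<Longrightarrow> \<tau> \<in> carrier G \<Longrightarrow> \<alpha> (\<sigma> \<otimes>\<^bsub>G\<^esub> \<tau>) x = \<alpha> \<sigma> (\<alpha> \<tau> x)"
  using group_action.composition_rule[OF action] by simp

lemma act_one: "\<alpha> \<one>\<^bsub>G\<^esub> x = x"
  using group_action.id_eq_one[OF action] by (metis UNIV_I restrict_apply)

lemma act_inv: "\<sigma> \<in> carrier G \<Longrightarrow> \<alpha> (inv\<^bsub>G\<^esub> \<sigma>) (\<alpha> \<sigma> x) = x" "\<sigma> \<in> carrier G \<Longrightarrow> \<alpha> \<sigma> (\<alpha> (inv\<^bsub>G\<^esub> \<sigma>) x) = x"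
  by (simp_all add: act_one flip: act_mult)

lemma act_inj: "\<sigma> \<in> carrier G \<Longrightarrow> \<alpha> \<sigma> x = \<alpha> \<sigma> y \<longleftrightarrow> x = y"
  using act_inv(1) by metis

lemma act_edge: "\<sigma> \<in> carrier G \<Longrightarrow> (x, y) \<in> E \<Longrightarrow> (\<alpha> \<sigma> x, \<alpha> \<sigma> y) \<in> E"
  using locale_action by (simp add: locale_action_def)

lemma act_relpow: "\<sigma> \<in> carrier G \<Longrightarrow> (x, y) \<in> E ^^ n \<Longrightarrow> (\<alpha> \<sigma> x, \<alpha> \<sigma> y) \<in> E ^^ n"
proof (induction n arbitrary: y)
  case (Suc n)
  from Suc.prems(2) obtain z where "(x, z) \<in> E ^^ n" "(z, y) \<in> E" by (rule relpow_Suc_E)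
  then show ?case using Suc.IH[OF Suc.prems(1)] act_edge[OF Suc.prems(1)] by (meson relpow_Suc_I)
qed simp

lemma act_dst: 
  assumes "\<sigma> \<in> carrier G"
  shows "dst (\<alpha> \<sigma> x) (\<alpha> \<sigma> y) = dst x y"
proof (rule order_antisym)
  show "dst (\<alpha> \<sigma> x) (\<alpha> \<sigma> y) \<le> dst x y" by (rule dst_le[OF act_relpow[OF assms dst_relpow]])
  have "(\<alpha> (inv\<^bsub>G\<^esub> \<sigma>) (\<alpha> \<sigma> x), \<alpha> (inv\<^bsub>G\<^esub> \<sigma>) (\<alpha> \<sigma> y)) \<in> E ^^ dst (\<alpha> \<sigma> x) (\<alpha> \<sigma> y)"
    using assms by (intro act_relpow dst_relpow) simp
  then show "dst x y \<le> dst (\<alpha> \<sigma> x) (\<alpha> \<sigma> y)" using assms by (intro dst_le) (simp add: act_inv)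
qed

lemma act_diam: "\<sigma> \<in> carrier G \<Longrightarrow> graph_diam E (\<alpha> \<sigma> ` A) = graph_diam E A"
proof -
  assume "\<sigma> \<in> carrier G"
  then have eq: "dst (\<alpha> \<sigma> x) (\<alpha> \<sigma> y) = dst x y" for x y by (rule act_dst)
  have "{dst x y | x y. x \<in> \<alpha> \<sigma> ` A \<and> y \<in> \<alpha> \<sigma> ` A} = {dst (\<alpha> \<sigma> x) (\<alpha> \<sigma> y) | x y. x \<in> A \<and> y \<in> A}"
    by blast
  then show ?thesis unfolding graph_diam_def eq by simp
qed

lemma act_supp: "\<sigma> \<in> carrier G \<Longrightarrow> supp (\<eta> \<circ> \<alpha> \<sigma>) = \<alpha> (inv\<^bsub>G\<^esub> \<sigma>) ` supp \<eta>"
proof -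
  assume s: "\<sigma> \<in> carrier G"
  show ?thesis
  proof (intro subset_antisym subsetI)
    fix x assume "x \<in> supp (\<eta> \<circ> \<alpha> \<sigma>)"
    then show "x \<in> \<alpha> (inv\<^bsub>G\<^esub> \<sigma>) ` supp \<eta>" using act_inv(1)[OF s, of x]
      by (intro image_eqI[of _ _ "\<alpha> \<sigma> x"]) auto
  qed (auto simp: act_inv s)
qed

lemma act_fin:
  assumes "\<sigma> \<in> carrier G"
  shows "\<eta> \<circ> \<alpha> \<sigma> \<in> fin \<longleftrightarrow> \<eta> \<in> fin"
proof -
  have "inj_on (\<alpha> (inv\<^bsub>G\<^esub> \<sigma>)) (supp \<eta>)" using assms by (simp add: inj_on_def act_inj)
  then show ?thesis using assms by (simp only: fin_configs_finite act_supp finite_image_iff)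
qed

lemma act_exchange:
  assumes "\<sigma> \<in> carrier G"
  shows "exchange \<phi> (x, y) (\<eta> \<circ> \<alpha> \<sigma>) = exchange \<phi> (\<alpha> \<sigma> x, \<alpha> \<sigma> y) \<eta> \<circ> \<alpha> \<sigma>"
  using assms by (auto simp: exchange_def Let_def act_inj fun_eq_iff)

lemma act_transition:
  assumes s: "\<sigma> \<in> carrier G" and "(\<eta>, \<eta>') \<in> T"
  shows "(\<eta> \<circ> \<alpha> \<sigma>, \<eta>' \<circ> \<alpha> \<sigma>) \<in> T"
proof -
  obtain x y where e: "(x, y) \<in> E" "\<eta> \<in> fin" "\<eta>' = exchange \<phi> (x, y) \<eta>"
    using assms(2) by (auto simp: fin_transitions_iff)
  have i: "inv\<^bsub>G\<^esub> \<sigma> \<in> carrier G" using s by simp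
  have "\<eta>' \<circ> \<alpha> \<sigma> = exchange \<phi> (\<alpha> (inv\<^bsub>G\<^esub> \<sigma>) x, \<alpha> (inv\<^bsub>G\<^esub> \<sigma>) y) (\<eta> \<circ> \<alpha> \<sigma>)"
    using act_exchange[OF s] by (simp add: e act_inv s)
  moreover have "(\<alpha> (inv\<^bsub>G\<^esub> \<sigma>) x, \<alpha> (inv\<^bsub>G\<^esub> \<sigma>) y) \<in> E" by (rule act_edge[OF i e(1)])
  moreover have "\<eta> \<circ> \<alpha> \<sigma> \<in> fin" unfolding act_fin[OF s] by (rule e(2))
  ultimately show ?thesis unfolding fin_transitions_iff by blast
qed

lemma act_transition_iff:
  assumes s: "\<sigma> \<in> carrier G"
  shows "(\<eta> \<circ> \<alpha> \<sigma>, \<eta>' \<circ> \<alpha> \<sigma>) \<in> T \<longleftrightarrow> (\<eta>, \<eta>') \<in> T"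
proof
  assume "(\<eta> \<circ> \<alpha> \<sigma>, \<eta>' \<circ> \<alpha> \<sigma>) \<in> T"
  then have "(\<eta> \<circ> \<alpha> \<sigma> \<circ> \<alpha> (inv\<^bsub>G\<^esub> \<sigma>), \<eta>' \<circ> \<alpha> \<sigma> \<circ> \<alpha> (inv\<^bsub>G\<^esub> \<sigma>)) \<in> T"
    by (rule act_transition[rotated]) (simp add: s)
  moreover have "\<eta> \<circ> \<alpha> \<sigma> \<circ> \<alpha> (inv\<^bsub>G\<^esub> \<sigma>) = \<eta>" for \<eta> :: "'x \<Rightarrow> 's"
    by (simp add: fun_eq_iff act_inv s)
  ultimately show "(\<eta>, \<eta>') \<in> T" by simp
qed (rule act_transition[OF s])

lemma act_differential:
  assumes "\<sigma> \<in> carrier G"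
  shows "differential b E \<phi> (\<lambda>\<eta>. f (\<eta> \<circ> \<alpha> \<sigma>)) =
    (\<lambda>(\<eta>, \<eta>'). differential b E \<phi> f (\<eta> \<circ> \<alpha> \<sigma>, \<eta>' \<circ> \<alpha> \<sigma>))"
  by (rule ext) (auto simp: differential_def act_transition_iff[OF assms])

text \<open>The expansion is transported by the action, which preserves diameters.\<close>

lemma act_C0_unif:
  assumes s: "\<sigma> \<in> carrier G" and f: "f \<in> C0_unif b E"
  shows "(\<lambda>\<eta>. f (\<eta> \<circ> \<alpha> \<sigma>)) \<in> C0_unif b E"
proof -
  define j where "j = \<alpha> (inv\<^bsub>G\<^esub> \<sigma>)"
  have i: "inv\<^bsub>G\<^esub> \<sigma> \<in> carrier G" using s by simp
  obtain F R where F: "is_expansion b f F" "R > 0"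
    and far: "\<And>A. finite A \<Longrightarrow> real (graph_diam E A) > R \<Longrightarrow> F A = 0"
    using f unfolding C0_unif_def uniform_fun_def by blast
  define F' where "F' = (\<lambda>A \<eta>. F (j ` A) (\<eta> \<circ> \<alpha> \<sigma>))"
  have \<alpha>j: "\<alpha> \<sigma> (j x) = x" for x using s by (simp add: j_def act_inv)
  have "is_expansion b (\<lambda>\<eta>. f (\<eta> \<circ> \<alpha> \<sigma>)) F'"
    unfolding is_expansion_def
  proof (intro conjI allI impI ballI)
    fix A :: "'x set" assume "finite A"
    then have FA: "F (j ` A) \<in> exact_local_funs b (j ` A)" using F(1)
      by (simp add: is_expansion_def)
    then have loc: "F (j ` A) \<in> local_funs b (j ` A)" by (simp add: exact_local_funs_def)
    have "F' A \<in> local_funs b A"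
    proof (rule local_funsI)
      show "F' A \<eta> = 0" if "\<eta> \<notin> fin" for \<eta>
        unfolding F'_def by (rule local_fun_outside[OF loc]) (use that act_fin[OF s] in simp)
      show "F' A \<eta> = F' A \<zeta>" if "\<eta> \<in> fin" "\<zeta> \<in> fin" "\<And>x. x \<in> A \<Longrightarrow> \<eta> x = \<zeta> x" for \<eta> \<zeta>
        unfolding F'_def by (rule local_fun_cong[OF loc]) (use that act_fin[OF s] \<alpha>j in auto)
    qed
    moreover have "F' A \<eta> = 0" if "\<exists>x\<in>A. \<eta> x = b" for \<eta>
    proof -
      have "\<exists>x\<in>j ` A. (\<eta> \<circ> \<alpha> \<sigma>) x = b" using that \<alpha>j by auto
      then show ?thesis using FA unfolding F'_def exact_local_funs_def by blast
    qed
    ultimately show "F' A \<in> exact_local_funs b A" unfolding exact_local_funs_def by blast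
  next
    fix \<eta> :: "'x \<Rightarrow> 's" assume \<eta>: "\<eta> \<in> fin"
    have "f (\<eta> \<circ> \<alpha> \<sigma>) = (\<Sum>A\<in>Pow (supp (\<eta> \<circ> \<alpha> \<sigma>)). F A (\<eta> \<circ> \<alpha> \<sigma>))"
      using F(1) act_fin[OF s, of \<eta>] \<eta> unfolding is_expansion_def by blast
    also have "Pow (supp (\<eta> \<circ> \<alpha> \<sigma>)) = (`) j ` Pow (supp \<eta>)"
      unfolding act_supp[OF s] j_def by (rule image_Pow_surj[symmetric]) simp
    also have "(\<Sum>A\<in>(`) j ` Pow (supp \<eta>). F A (\<eta> \<circ> \<alpha> \<sigma>)) = (\<Sum>A\<in>Pow (supp \<eta>). F' A \<eta>)"
    proof (subst sum.reindex)
      have "inj j" unfolding j_def using act_inj[OF i] by (intro injI) simp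
      then show "inj_on ((`) j) (Pow (supp \<eta>))" by (meson inj_on_image_eq_iff inj_onI subset_UNIV)
    qed (simp add: F'_def)
    finally show "f (\<eta> \<circ> \<alpha> \<sigma>) = (\<Sum>A\<in>Pow (supp \<eta>). F' A \<eta>)" .
  qed
  moreover have "\<forall>A. finite A \<and> real (graph_diam E A) > R \<longrightarrow> F' A = 0"
    using far act_diam[OF i] by (auto simp: F'_def j_def fun_eq_iff)
  ultimately have "uniform_fun b E (\<lambda>\<eta>. f (\<eta> \<circ> \<alpha> \<sigma>))" unfolding uniform_fun_def using F(2) by blast
  moreover have "(\<lambda>_. b) \<circ> \<alpha> \<sigma> = (\<lambda>_. b)" by auto
  ultimately show ?thesis using f act_fin[OF s] by (simp add: C0_unif_def)
qed

text \<open>The expansion only has terms at singletons, which have diameter \<open>0\<close>.\<close>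

lemma total_C0_unif:
  assumes u: "\<And>x. u x b = 0"
  shows "total b u \<in> C0_unif b E"
proof -
  define F where
    "F = (\<lambda>A \<eta>. if \<eta> \<in> fin \<and> is_singleton A then u (the_elem A) (\<eta> (the_elem A)) else 0)"
  have "is_expansion b (total b u) F"
    unfolding is_expansion_def
  proof (intro conjI allI impI ballI)
    fix A :: "'x set" assume "finite A"
    have "F A \<in> local_funs b A"
      by (rule local_funsI) (auto simp: F_def is_singleton_def)
    moreover have "F A \<eta> = 0" if "\<exists>x\<in>A. \<eta> x = b" for \<eta>
      using that u by (auto simp: F_def is_singleton_def)
    ultimately show "F A \<in> exact_local_funs b A" unfolding exact_local_funs_def by blast
  next
    fix \<eta> :: "'x \<Rightarrow> 's" assume \<eta>: "\<eta> \<in> fin"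
    have "(\<Sum>A\<in>(\<lambda>x. {x}) ` supp \<eta>. F A \<eta>) = (\<Sum>A\<in>Pow (supp \<eta>). F A \<eta>)"
      by (rule sum.mono_neutral_left) (use \<eta> in \<open>auto simp: fin_configs_finite F_def is_singleton_def\<close>)
    moreover have "(\<Sum>A\<in>(\<lambda>x. {x}) ` supp \<eta>. F A \<eta>) = (\<Sum>x\<in>supp \<eta>. u x (\<eta> x))"
      by (subst sum.reindex) (use \<eta> in \<open>auto simp: F_def\<close>)
    ultimately show "total b u \<eta> = (\<Sum>A\<in>Pow (supp \<eta>). F A \<eta>)" using \<eta> by (simp add: total_def)
  qed
  moreover have "F A = 0" if "real (graph_diam E A) > 1" for A
  proof -
    have "\<not> is_singleton A"
    proof
      assume "is_singleton A"
      then obtain x where "A = {x}" by (auto simp: is_singleton_def)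
      then show False using that by (simp add: graph_diam_def)
    qed
    then show ?thesis by (simp add: F_def fun_eq_iff)
  qed
  ultimately have "uniform_fun b E (total b u)"
    unfolding uniform_fun_def by (intro exI[of _ F] conjI exI[of _ "1::real"]) auto
  then show ?thesis by (simp add: C0_unif_def total_def)
qed

lemma total_act:
  assumes s: "\<sigma> \<in> carrier G"
  shows "total b u (\<eta> \<circ> \<alpha> \<sigma>) = total b (\<lambda>y. u (\<alpha> (inv\<^bsub>G\<^esub> \<sigma>) y)) \<eta>"
proof (cases "\<eta> \<in> fin")
  case True
  have "inj_on (\<alpha> (inv\<^bsub>G\<^esub> \<sigma>)) (supp \<eta>)" using s by (simp add: inj_on_def act_inj)
  then have "(\<Sum>x\<in>supp (\<eta> \<circ> \<alpha> \<sigma>). u x ((\<eta> \<circ> \<alpha> \<sigma>) x)) = (\<Sum>y\<in>supp \<eta>. u (\<alpha> (inv\<^bsub>G\<^esub> \<sigma>) y) (\<eta> y))"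
    unfolding act_supp[OF s] by (subst sum.reindex) (simp_all add: act_inv s)
  then show ?thesis using True act_fin[OF s, of \<eta>] by (simp add: total_def)
qed (simp add: total_def act_fin[OF s])

lemma differential_total_consv:
  assumes \<xi>: "\<xi> \<in> consv b \<phi>"
  shows "differential b E \<phi> (total b (\<lambda>_. \<xi>)) = 0"
proof
  fix t
  show "differential b E \<phi> (total b (\<lambda>_. \<xi>)) t = 0 t"
  proof (cases "t \<in> T")
    case True
    obtain \<eta> \<eta>' where t: "t = (\<eta>, \<eta>')" by (cases t)
    then have "\<eta> \<in> fin" "\<eta>' \<in> fin" using True by (auto simp: fin_transitions_def)
    moreover have "chg \<eta>' \<xi> = chg \<eta> \<xi>" using chg_transition True t by simp
    ultimately show ?thesis using True t \<xi> by (simp add: differential_def total_def charge_def)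
  qed (simp add: differential_def)
qed

lemma total_const_eq_0:
  assumes "total b (\<lambda>_. \<xi>) = (0 :: ('x \<Rightarrow> 's) \<Rightarrow> real)" "\<xi> b = 0"
  shows "\<xi> = 0"
proof
  fix s
  obtain x0 :: 'x where True by simp
  define \<eta> where "\<eta> = (\<lambda>_. b)(x0 := s)"
  have \<eta>: "\<eta> \<in> fin" unfolding \<eta>_def by (intro fin_configs_upd base_fin_config)
  have "(\<Sum>x\<in>supp \<eta>. \<xi> (\<eta> x)) = (\<Sum>x\<in>{x0}. \<xi> (\<eta> x))"
    by (rule sum.mono_neutral_left) (use assms(2) in \<open>auto simp: \<eta>_def\<close>)
  then have "total b (\<lambda>_. \<xi>) \<eta> = \<xi> s" using \<eta> by (simp add: total_def \<eta>_def)
  then show "\<xi> s = 0 s" using assms(1) by simp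
qed

end

section \<open>The decomposition given by a fundamental domain\<close>

locale acted_system_with_domain = acted_system E b \<phi> G \<alpha>
  for E :: "'x rel" and b :: 's and \<phi> :: "'s \<times> 's \<Rightarrow> 's \<times> 's"
    and G :: "('g, 'm) monoid_scheme" and \<alpha> :: "'g \<Rightarrow> 'x \<Rightarrow> 'x" +
  fixes D :: "'x set"
  assumes domain: "fundamental_domain G \<alpha> D"
begin

text \<open>The element that moves the representative of the orbit of \<open>x\<close> to \<open>x\<close>.\<close>

definition tau :: "'x \<Rightarrow> 'g" where
  "tau x = (THE \<tau>. \<tau> \<in> carrier G \<and> x \<in> \<alpha> \<tau> ` D)"

text \<open>The orbit of \<open>x\<close> meets \<open>D\<close> exactly once, and only one group element moves that point to \<open>x\<close>.\<close>

lemma tau_unique: "\<exists>!\<tau>. \<tau> \<in> carrier G \<and> x \<in> \<alpha> \<tau> ` D"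
proof -
  have "orbit G \<alpha> x \<in> orbits G UNIV \<alpha>" by (auto simp: orbits_def)
  then have ex1: "\<exists>!y. y \<in> D \<inter> orbit G \<alpha> x" using domain by (simp add: fundamental_domain_def)
  then obtain y where y: "y \<in> D" "y \<in> orbit G \<alpha> x" by blast
  then obtain g where g: "g \<in> carrier G" "y = \<alpha> g x" by (auto simp: orbit_def)
  have "x = \<alpha> (inv\<^bsub>G\<^esub> g) y" using g by (simp add: act_inv)
  then have "inv\<^bsub>G\<^esub> g \<in> carrier G \<and> x \<in> \<alpha> (inv\<^bsub>G\<^esub> g) ` D" using g y by auto
  moreover have "\<tau> = \<tau>'" if \<tau>: "\<tau> \<in> carrier G \<and> x \<in> \<alpha> \<tau> ` D" "\<tau>' \<in> carrier G \<and> x \<in> \<alpha> \<tau>' ` D"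
    for \<tau> \<tau>'
  proof -
    obtain z z' where z: "z \<in> D" "x = \<alpha> \<tau> z" "z' \<in> D" "x = \<alpha> \<tau>' z'" using \<tau> by auto
    have "z = \<alpha> (inv\<^bsub>G\<^esub> \<tau>) x" "z' = \<alpha> (inv\<^bsub>G\<^esub> \<tau>') x"
      using act_inv(1) \<tau> z(2,4) by metis+
    moreover have "inv\<^bsub>G\<^esub> \<tau> \<in> carrier G" "inv\<^bsub>G\<^esub> \<tau>' \<in> carrier G" using \<tau> by auto
    ultimately have "z \<in> orbit G \<alpha> x" "z' \<in> orbit G \<alpha> x" unfolding orbit_def by blast+
    then have "z = z'" using ex1 z by blast
    then show ?thesis using free_action z \<tau> unfolding free_action_def by metis
  qed
  ultimately show ?thesis by blast
qed

lemma tau: "tau x \<in> carrier G" "x \<in> \<alpha> (tau x) ` D"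
  using theI'[OF tau_unique[of x]] by (simp_all add: tau_def)

lemma tau_eq: "\<tau> \<in> carrier G \<Longrightarrow> x \<in> \<alpha> \<tau> ` D \<longleftrightarrow> tau x = \<tau>"
  using tau tau_unique[of x] by blast

lemma tau_act: 
  assumes s: "\<sigma> \<in> carrier G"
  shows "tau (\<alpha> \<sigma> x) = \<sigma> \<otimes>\<^bsub>G\<^esub> tau x"
proof -
  obtain z where z: "z \<in> D" "x = \<alpha> (tau x) z" using tau(2)[of x] by blast
  have "\<alpha> (\<sigma> \<otimes>\<^bsub>G\<^esub> tau x) z = \<alpha> \<sigma> x" unfolding act_mult[OF s tau(1)] by (simp flip: z(2))
  then have "\<alpha> \<sigma> x \<in> \<alpha> (\<sigma> \<otimes>\<^bsub>G\<^esub> tau x) ` D" using z(1) by force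
  then show ?thesis using s tau(1) tau_eq by (meson G.m_closed)
qed

lemma Hom_props:
  assumes "\<psi> \<in> Hom G (consv b \<phi>)"
  shows "\<And>\<sigma>. \<psi> \<sigma> \<in> consv b \<phi>"
    and "\<And>\<sigma> \<tau>. \<sigma> \<in> carrier G \<Longrightarrow> \<tau> \<in> carrier G \<Longrightarrow> \<psi> (\<sigma> \<otimes>\<^bsub>G\<^esub> \<tau>) = \<psi> \<sigma> + \<psi> \<tau>"
    and "\<And>\<sigma>. \<sigma> \<in> carrier G \<Longrightarrow> \<psi> (inv\<^bsub>G\<^esub> \<sigma>) = - \<psi> \<sigma>"
proof -
  have h: "\<psi> \<in> carrier G \<rightarrow> consv b \<phi>"
    "\<And>\<sigma> \<tau>. \<sigma> \<in> carrier G \<Longrightarrow> \<tau> \<in> carrier G \<Longrightarrow> \<psi> (\<sigma> \<otimes>\<^bsub>G\<^esub> \<tau>) = \<psi> \<sigma> + \<psi> \<tau>"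
    "\<And>\<sigma>. \<sigma> \<notin> carrier G \<Longrightarrow> \<psi> \<sigma> = 0"
    using assms by (auto simp: Hom_def hom_def additive_structure_def)
  have "0 \<in> consv b \<phi>" by (simp add: consv_def)
  then show "\<psi> \<sigma> \<in> consv b \<phi>" for \<sigma> using h(1) h(3)[of \<sigma>] by (cases "\<sigma> \<in> carrier G") auto
  show "\<psi> (\<sigma> \<otimes>\<^bsub>G\<^esub> \<tau>) = \<psi> \<sigma> + \<psi> \<tau>" if "\<sigma> \<in> carrier G" "\<tau> \<in> carrier G" for \<sigma> \<tau> by (rule h(2)[OF that])
  have "\<psi> \<one>\<^bsub>G\<^esub> = 0" using h(2)[of "\<one>\<^bsub>G\<^esub>" "\<one>\<^bsub>G\<^esub>"] by simp
  then show "\<psi> (inv\<^bsub>G\<^esub> \<sigma>) = - \<psi> \<sigma>" if "\<sigma> \<in> carrier G" for \<sigma>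
    using h(2)[of "inv\<^bsub>G\<^esub> \<sigma>" \<sigma>] that by (simp add: eq_neg_iff_add_eq_0)
qed

text \<open>The function \<open>\<Sum>\<^sub>\<tau> \<psi>(\<tau>)\<^bsub>\<tau>D\<^esub>\<close>, whose differential is \<open>\<omega>\<^sub>\<psi>\<close>. At the vertex \<open>x\<close> it contributes the value
  of \<open>\<psi> (tau x)\<close>, because \<open>x\<close> lies in the translate of \<open>D\<close> by \<open>tau x\<close> only.\<close>

abbreviation "twist \<psi> \<equiv> total b (\<lambda>x. \<psi> (tau x))"

lemma site_sum_finite:
  assumes "\<eta> \<in> fin" "\<xi> b = 0"
  shows "site_sum \<xi> W \<eta> = (\<Sum>x\<in>supp \<eta> \<inter> W. \<xi> (\<eta> x))"
proof -
  have "site_sum \<xi> W \<eta> = (\<Sum>\<^sub>\<infinity>x\<in>supp \<eta> \<inter> W. \<xi> (\<eta> x))"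
    unfolding site_sum_def by (rule infsum_cong_neutral) (use assms(2) in auto)
  then show ?thesis using assms(1) by (simp add: fin_configs_finite)
qed

lemma hom_form_twist:
  assumes \<psi>: "\<psi> \<in> Hom G (consv b \<phi>)"
  shows "hom_form b E \<phi> G \<alpha> D \<psi> = differential b E \<phi> (twist \<psi>)"
proof -
  have "(\<Sum>\<^sub>\<infinity>\<tau>\<in>carrier G. site_sum (\<psi> \<tau>) (\<alpha> \<tau> ` D) \<eta>) = twist \<psi> \<eta>" if \<eta>: "\<eta> \<in> fin" for \<eta>
  proof -
    have fin: "finite (supp \<eta>)" using \<eta> by (simp add: fin_configs_finite)
    have inner: "site_sum (\<psi> \<tau>) (\<alpha> \<tau> ` D) \<eta> = (\<Sum>x\<in>{x \<in> supp \<eta>. tau x = \<tau>}. \<psi> (tau x) (\<eta> x))"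
      if "\<tau> \<in> carrier G" for \<tau>
    proof -
      have "supp \<eta> \<inter> \<alpha> \<tau> ` D = {x \<in> supp \<eta>. tau x = \<tau>}" using tau_eq[OF that] by blast
      moreover have "\<psi> \<tau> b = 0" using consv_base[OF Hom_props(1)[OF \<psi>]] .
      ultimately have "site_sum (\<psi> \<tau>) (\<alpha> \<tau> ` D) \<eta> = (\<Sum>x\<in>{x \<in> supp \<eta>. tau x = \<tau>}. \<psi> \<tau> (\<eta> x))"
        using site_sum_finite[OF \<eta>] by simp
      also have "\<dots> = (\<Sum>x\<in>{x \<in> supp \<eta>. tau x = \<tau>}. \<psi> (tau x) (\<eta> x))" by (rule sum.cong) auto
      finally show ?thesis .
    qed
    have "(\<Sum>\<^sub>\<infinity>\<tau>\<in>carrier G. site_sum (\<psi> \<tau>) (\<alpha> \<tau> ` D) \<eta>)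
        = (\<Sum>\<^sub>\<infinity>\<tau>\<in>tau ` supp \<eta>. \<Sum>x\<in>{x \<in> supp \<eta>. tau x = \<tau>}. \<psi> (tau x) (\<eta> x))"
    proof (rule infsum_cong_neutral)
      fix \<tau> assume "\<tau> \<in> carrier G - tau ` supp \<eta>"
      then have "\<tau> \<in> carrier G" and e: "{x \<in> supp \<eta>. tau x = \<tau>} = {}" by auto
      then show "site_sum (\<psi> \<tau>) (\<alpha> \<tau> ` D) \<eta> = 0" using inner by (simp only: sum.empty)
    qed (use tau(1) inner in auto)
    also have "\<dots> = (\<Sum>x\<in>supp \<eta>. \<psi> (tau x) (\<eta> x))"
      using fin sum.image_gen[OF fin, of "\<lambda>x. \<psi> (tau x) (\<eta> x)" tau] by simp
    finally show ?thesis using \<eta> by (simp add: total_def)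
  qed
  then show ?thesis
    unfolding hom_form_def differential_def by (intro ext) (auto simp: fin_transitions_def)
qed

lemma twist_C0_unif: "\<psi> \<in> Hom G (consv b \<phi>) \<Longrightarrow> twist \<psi> \<in> C0_unif b E"
  by (rule total_C0_unif) (rule consv_base[OF Hom_props(1)])

text \<open>The function \<open>twist \<psi>\<close> is not invariant, but an element \<open>\<sigma>\<close> only changes it by the total
  conserved quantity \<open>\<psi> \<sigma>\<close>.\<close>

lemma twist_act:
  assumes \<psi>: "\<psi> \<in> Hom G (consv b \<phi>)" and s: "\<sigma> \<in> carrier G"
  shows "(\<lambda>\<eta>. twist \<psi> (\<eta> \<circ> \<alpha> \<sigma>)) = twist \<psi> - total b (\<lambda>_. \<psi> \<sigma>)"
proof -
  have "\<psi> (tau (\<alpha> (inv\<^bsub>G\<^esub> \<sigma>) y)) = \<psi> (tau y) + (- 1) *\<^sub>R \<psi> \<sigma>" for y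
    using s tau(1)[of y] Hom_props(2,3)[OF \<psi>] by (simp add: tau_act)
  then have "(\<lambda>\<eta>. twist \<psi> (\<eta> \<circ> \<alpha> \<sigma>)) = total b (\<lambda>y. \<psi> (tau y) + (- 1) *\<^sub>R \<psi> \<sigma>)"
    by (simp only: total_act[OF s])
  then show ?thesis by (simp only: total_add total_scale) simp
qed

end

section \<open>Invariant forms\<close>

lemma consv_subspace: "subspace (consv b \<phi>)"
proof (rule subspaceI)
  fix \<xi> \<zeta> assume *: "\<xi> \<in> consv b \<phi>" "\<zeta> \<in> consv b \<phi>"
  have "\<xi> s + \<zeta> s + (\<xi> t + \<zeta> t) = \<xi> (fst (\<phi> (s, t))) + \<zeta> (fst (\<phi> (s, t))) + (\<xi> (snd (\<phi> (s, t))) + \<zeta> (snd (\<phi> (s, t))))"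
    for s t
  proof -
    have "\<xi> s + \<xi> t = \<xi> (fst (\<phi> (s, t))) + \<xi> (snd (\<phi> (s, t)))"
      "\<zeta> s + \<zeta> t = \<zeta> (fst (\<phi> (s, t))) + \<zeta> (snd (\<phi> (s, t)))"
      using * unfolding consv_def by blast+
    then show ?thesis by linarith
  qed
  then show "\<xi> + \<zeta> \<in> consv b \<phi>" using consv_base[OF *(1)] consv_base[OF *(2)]
    by (simp add: consv_def)
next
  fix c \<xi> assume "\<xi> \<in> consv b \<phi>"
  then show "c *\<^sub>R \<xi> \<in> consv b \<phi>" by (simp add: consv_def scaleR_fun_def flip: distrib_left)
qed (simp add: consv_def)

lemma linear_differential: "linear (differential b E \<phi>)"
  by (rule linearI) (simp_all add: differential_add differential_scale)

lemma invariant_funs_subspace: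
  assumes "subspace U"
  shows "subspace (invariant_funs G \<alpha> U)"
  using assms by (auto simp: subspace_def invariant_funs_def fun_eq_iff scaleR_fun_def)

lemma invariant_forms_subspace:
  assumes "subspace U"
  shows "subspace (invariant_forms G \<alpha> U)"
  using assms by (auto simp: subspace_def invariant_forms_def fun_eq_iff scaleR_fun_def)

lemma inv_exact_forms_subspace: "subspace (inv_exact_forms b E \<phi> G \<alpha>)"
  unfolding inv_exact_forms_def
  by (intro linear_subspace_image linear_differential invariant_funs_subspace C0_unif_subspace)

context acted_system_with_domain
begin

lemma hom_form_add:
  assumes "\<psi> \<in> Hom G (consv b \<phi>)" "\<psi>' \<in> Hom G (consv b \<phi>)"
  shows "hom_form b E \<phi> G \<alpha> D (\<psi> + \<psi>') = hom_form b E \<phi> G \<alpha> D \<psi> + hom_form b E \<phi> G \<alpha> D \<psi>'"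
proof -
  have "\<psi> + \<psi>' \<in> Hom G (consv b \<phi>)"
    by (intro subspace_add Hom_subspace group_G consv_subspace assms)
  moreover have "twist (\<psi> + \<psi>') = twist \<psi> + twist \<psi>'" by (simp add: total_add)
  ultimately show ?thesis using assms by (simp add: hom_form_twist differential_add)
qed

lemma hom_form_scale:
  assumes "\<psi> \<in> Hom G (consv b \<phi>)"
  shows "hom_form b E \<phi> G \<alpha> D (c *\<^sub>R \<psi>) = c *\<^sub>R hom_form b E \<phi> G \<alpha> D \<psi>"
proof -
  have "c *\<^sub>R \<psi> \<in> Hom G (consv b \<phi>)"
    by (intro subspace_scale Hom_subspace group_G consv_subspace assms)
  moreover have "(\<lambda>x. (c *\<^sub>R \<psi>) (tau x)) = (\<lambda>x. c *\<^sub>R \<psi> (tau x))" by (simp add: scaleR_fun_def)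
  then have "twist (c *\<^sub>R \<psi>) = c *\<^sub>R twist \<psi>" by (simp only: total_scale)
  ultimately show ?thesis using assms by (simp add: hom_form_twist differential_scale)
qed

text \<open>\<open>twist \<psi>\<close> is invariant up to totals of conserved quantities, and these have differential \<open>0\<close>.\<close>

lemma hom_form_invariant:
  assumes \<psi>: "\<psi> \<in> Hom G (consv b \<phi>)"
  shows "hom_form b E \<phi> G \<alpha> D \<psi> \<in> inv_closed_forms b E \<phi> G \<alpha>"
proof -
  have "(\<lambda>(\<eta>, \<eta>'). hom_form b E \<phi> G \<alpha> D \<psi> (\<eta> \<circ> \<alpha> \<sigma>, \<eta>' \<circ> \<alpha> \<sigma>)) = hom_form b E \<phi> G \<alpha> D \<psi>"
    if s: "\<sigma> \<in> carrier G" for \<sigma>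
  proof -
    have "(\<lambda>(\<eta>, \<eta>'). hom_form b E \<phi> G \<alpha> D \<psi> (\<eta> \<circ> \<alpha> \<sigma>, \<eta>' \<circ> \<alpha> \<sigma>)) = differential b E \<phi> (\<lambda>\<eta>. twist \<psi> (\<eta> \<circ> \<alpha> \<sigma>))"
      unfolding hom_form_twist[OF \<psi>] act_differential[OF s] ..
    also have "\<dots> = differential b E \<phi> (twist \<psi>) - differential b E \<phi> (total b (\<lambda>_. \<psi> \<sigma>))"
      unfolding twist_act[OF \<psi> s] by (rule linear_diff[OF linear_differential])
    also have "\<dots> = hom_form b E \<phi> G \<alpha> D \<psi>"
      by (simp add: differential_total_consv[OF Hom_props(1)[OF \<psi>]] hom_form_twist[OF \<psi>])
    finally show ?thesis .
  qed
  moreover have "hom_form b E \<phi> G \<alpha> D \<psi> \<in> Z1_unif b E \<phi>"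
    unfolding hom_form_twist[OF \<psi>] by (intro differential_Z1_unif twist_C0_unif \<psi>)
  ultimately show ?thesis by (simp add: inv_closed_forms_def invariant_forms_def)
qed

lemma exact_invariant:
  assumes "\<epsilon> \<in> inv_exact_forms b E \<phi> G \<alpha>"
  shows "\<epsilon> \<in> inv_closed_forms b E \<phi> G \<alpha>"
proof -
  obtain f where f: "f \<in> C0_unif b E" "\<And>\<sigma>. \<sigma> \<in> carrier G \<Longrightarrow> (\<lambda>\<eta>. f (\<eta> \<circ> \<alpha> \<sigma>)) = f"
    "\<epsilon> = differential b E \<phi> f"
    using assms by (auto simp: inv_exact_forms_def invariant_funs_def)
  have "(\<lambda>(\<eta>, \<eta>'). \<epsilon> (\<eta> \<circ> \<alpha> \<sigma>, \<eta>' \<circ> \<alpha> \<sigma>)) = \<epsilon>" if "\<sigma> \<in> carrier G" for \<sigma>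
    using act_differential[OF that, of f] f(2)[OF that] f(3) by simp
  moreover have "\<epsilon> \<in> Z1_unif b E \<phi>" unfolding f(3) by (rule differential_Z1_unif[OF f(1)])
  ultimately show ?thesis by (simp add: inv_closed_forms_def invariant_forms_def)
qed

lemma kernel_is_total:
  assumes "f \<in> C0_unif b E" "differential b E \<phi> f = 0"
  obtains \<xi> where "\<xi> \<in> consv b \<phi>" "f = total b (\<lambda>_. \<xi>)"
proof -
  obtain \<xi> where \<xi>: "\<xi> \<in> consv b \<phi>" "\<And>\<eta>. \<eta> \<in> fin \<Longrightarrow> f \<eta> = (\<Sum>x\<in>supp \<eta>. \<xi> (\<eta> x))"
    by (rule kernel_of_differential[OF assms]) blast
  have "f = total b (\<lambda>_. \<xi>)"
  proof
    fix \<eta> :: "'x \<Rightarrow> 's"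
    show "f \<eta> = total b (\<lambda>_. \<xi>) \<eta>"
      using assms(1) \<xi>(2)[of \<eta>] by (cases "\<eta> \<in> fin") (simp_all add: total_def C0_unif_def)
  qed
  then show ?thesis using \<xi>(1) that by blast
qed

lemma total_consv_act: "\<sigma> \<in> carrier G \<Longrightarrow> total b (\<lambda>_. \<xi>) (\<eta> \<circ> \<alpha> \<sigma>) = total b (\<lambda>_. \<xi>) \<eta>"
  by (simp add: total_act)

text \<open>If \<open>\<partial>f + \<omega>\<^sub>\<psi> = 0\<close> with an invariant \<open>f\<close>, then \<open>f + twist \<psi>\<close> is a total conserved quantity and
  hence invariant. So \<open>twist \<psi>\<close> is invariant and \<open>\<psi>\<close> vanishes.\<close>

lemma exact_plus_hom_form_eq_0:
  assumes \<epsilon>: "\<epsilon> \<in> inv_exact_forms b E \<phi> G \<alpha>" and \<psi>: "\<psi> \<in> Hom G (consv b \<phi>)"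
    and zero: "\<epsilon> + hom_form b E \<phi> G \<alpha> D \<psi> = 0"
  shows "\<psi> = 0"
proof -
  obtain f where f: "f \<in> C0_unif b E" "\<And>\<sigma>. \<sigma> \<in> carrier G \<Longrightarrow> (\<lambda>\<eta>. f (\<eta> \<circ> \<alpha> \<sigma>)) = f"
    "\<epsilon> = differential b E \<phi> f"
    using \<epsilon> by (auto simp: inv_exact_forms_def invariant_funs_def)
  have "differential b E \<phi> (f + twist \<psi>) = 0"
    using zero by (simp add: f(3) hom_form_twist[OF \<psi>] differential_add)
  moreover have "f + twist \<psi> \<in> C0_unif b E"
    by (intro subspace_add C0_unif_subspace f(1) twist_C0_unif \<psi>)
  ultimately obtain \<xi> where \<xi>: "\<xi> \<in> consv b \<phi>" "f + twist \<psi> = total b (\<lambda>_. \<xi>)" using kernel_is_total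
    by metis
  have "\<psi> \<sigma> = 0" if s: "\<sigma> \<in> carrier G" for \<sigma>
  proof (rule total_const_eq_0)
    show "total b (\<lambda>_. \<psi> \<sigma>) = (0 :: ('x \<Rightarrow> 's) \<Rightarrow> real)"
    proof
      fix \<eta> :: "'x \<Rightarrow> 's"
      have "f (\<eta> \<circ> \<alpha> \<sigma>) + twist \<psi> (\<eta> \<circ> \<alpha> \<sigma>) = f \<eta> + twist \<psi> \<eta>"
        using fun_cong[OF \<xi>(2), of \<eta>] fun_cong[OF \<xi>(2), of "\<eta> \<circ> \<alpha> \<sigma>"] total_consv_act[OF s, of \<xi> \<eta>]
          by simp
      moreover have "f (\<eta> \<circ> \<alpha> \<sigma>) = f \<eta>" using fun_cong[OF f(2)[OF s], of \<eta>] .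
      moreover have "twist \<psi> (\<eta> \<circ> \<alpha> \<sigma>) = twist \<psi> \<eta> - total b (\<lambda>_. \<psi> \<sigma>) \<eta>"
        using fun_cong[OF twist_act[OF \<psi> s], of \<eta>] by simp
      ultimately show "total b (\<lambda>_. \<psi> \<sigma>) \<eta> = 0 \<eta>" by simp
    qed
    show "\<psi> \<sigma> b = 0" by (rule consv_base[OF Hom_props(1)[OF \<psi>]])
  qed
  moreover have "\<psi> \<sigma> = 0" if "\<sigma> \<notin> carrier G" for \<sigma> using \<psi> that by (simp add: Hom_iff)
  ultimately show ?thesis by (auto simp: fun_eq_iff)
qed

text \<open>A uniform potential \<open>f\<close> of an invariant form is invariant up to total conserved quantities, and
  these define a homomorphism \<open>\<psi>\<close>. Adding \<open>twist \<psi>\<close> makes \<open>f\<close> invariant.\<close>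

lemma invariant_form_decomposition:
  assumes hyp: "transferable E \<or> simple_interaction b \<phi> \<and> weakly_transferable E"
    and \<omega>: "\<omega> \<in> inv_closed_forms b E \<phi> G \<alpha>"
  obtains \<epsilon> \<psi> where "\<epsilon> \<in> inv_exact_forms b E \<phi> G \<alpha>" "\<psi> \<in> Hom G (consv b \<phi>)"
    "\<omega> = \<epsilon> + hom_form b E \<phi> G \<alpha> D \<psi>"
proof -
  have \<omega>Z: "\<omega> \<in> Z1_unif b E \<phi>" and inv: "\<And>\<sigma>. \<sigma> \<in> carrier G \<Longrightarrow> (\<lambda>(\<eta>, \<eta>'). \<omega> (\<eta> \<circ> \<alpha> \<sigma>, \<eta>' \<circ> \<alpha> \<sigma>)) = \<omega>"
    using \<omega> by (auto simp: inv_closed_forms_def invariant_forms_def)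
  obtain f where f: "f \<in> C0_unif b E" "differential b E \<phi> f = \<omega>"
    using closed_uniform_form_exact[OF hyp \<omega>Z] .
  have "\<exists>\<xi>. \<xi> \<in> consv b \<phi> \<and> (\<forall>\<eta>. f (\<eta> \<circ> \<alpha> \<sigma>) = f \<eta> + total b (\<lambda>_. \<xi>) \<eta>)" if s: "\<sigma> \<in> carrier G" for \<sigma>
  proof -
    let ?f = "\<lambda>\<eta>. f (\<eta> \<circ> \<alpha> \<sigma>)"
    have "differential b E \<phi> ?f = \<omega>" unfolding act_differential[OF s] f(2) by (rule inv[OF s])
    then have "differential b E \<phi> (?f - f) = 0"
      using linear_diff[OF linear_differential, of b E \<phi> ?f f] f(2) by simp
    moreover have "?f - f \<in> C0_unif b E"
      by (intro subspace_diff C0_unif_subspace act_C0_unif s f(1))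
    ultimately obtain \<xi> where \<xi>: "\<xi> \<in> consv b \<phi>" "?f - f = total b (\<lambda>_. \<xi>)" using kernel_is_total
      by metis
    have "f (\<eta> \<circ> \<alpha> \<sigma>) = f \<eta> + total b (\<lambda>_. \<xi>) \<eta>" for \<eta>
      using fun_cong[OF \<xi>(2), of \<eta>] by simp
    then show ?thesis using \<xi>(1) by blast
  qed
  then obtain \<psi>0
    where \<psi>0:
    "\<And>\<sigma>. \<sigma> \<in> carrier G \<Longrightarrow> \<psi>0 \<sigma> \<in> consv b \<phi> \<and> (\<forall>\<eta>. f (\<eta> \<circ> \<alpha> \<sigma>) = f \<eta> + total b (\<lambda>_. \<psi>0 \<sigma>) \<eta>)"
    by metis
  define \<psi> where "\<psi> = (\<lambda>\<sigma>. if \<sigma> \<in> carrier G then \<psi>0 \<sigma> else 0)"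
  have \<psi>c: "\<psi> \<sigma> \<in> consv b \<phi>" and \<psi>f: "f (\<eta> \<circ> \<alpha> \<sigma>) = f \<eta> + total b (\<lambda>_. \<psi> \<sigma>) \<eta>" if "\<sigma> \<in> carrier G"
    for \<sigma> \<eta>
    using \<psi>0[OF that] that by (simp_all add: \<psi>_def)
  have "\<psi> (\<sigma> \<otimes>\<^bsub>G\<^esub> \<tau>) = \<psi> \<sigma> + \<psi> \<tau>" if st: "\<sigma> \<in> carrier G" "\<tau> \<in> carrier G" for \<sigma> \<tau>
  proof -
    let ?\<rho> = "\<sigma> \<otimes>\<^bsub>G\<^esub> \<tau>" and ?\<xi> = "\<psi> (\<sigma> \<otimes>\<^bsub>G\<^esub> \<tau>) + (- 1) *\<^sub>R (\<psi> \<sigma> + \<psi> \<tau>)"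
    have rc: "?\<rho> \<in> carrier G" using st by simp
    have "total b (\<lambda>_. \<psi> ?\<rho>) \<eta> = total b (\<lambda>_. \<psi> \<sigma>) \<eta> + total b (\<lambda>_. \<psi> \<tau>) \<eta>" for \<eta> :: "'x \<Rightarrow> 's"
    proof -
      have "\<eta> \<circ> \<alpha> ?\<rho> = (\<eta> \<circ> \<alpha> \<sigma>) \<circ> \<alpha> \<tau>" by (simp add: fun_eq_iff act_mult[OF st])
      then have "f (\<eta> \<circ> \<alpha> ?\<rho>) = f (\<eta> \<circ> \<alpha> \<sigma>) + total b (\<lambda>_. \<psi> \<tau>) (\<eta> \<circ> \<alpha> \<sigma>)"
        using \<psi>f[OF st(2), of "\<eta> \<circ> \<alpha> \<sigma>"] by simp
      then show ?thesis
        using \<psi>f[OF rc, of \<eta>] \<psi>f[OF st(1), of \<eta>] total_consv_act[OF st(1), of "\<psi> \<tau>" \<eta>] by simp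
    qed
    then have "total b (\<lambda>_. ?\<xi>) = (0 :: ('x \<Rightarrow> 's) \<Rightarrow> real)"
      unfolding total_add total_scale by (simp add: fun_eq_iff scaleR_fun_def)
    moreover have "?\<xi> b = 0"
      using consv_base[OF \<psi>c[OF rc]] consv_base[OF \<psi>c[OF st(1)]] consv_base[OF \<psi>c[OF st(2)]]
      by (simp add: scaleR_fun_def)
    ultimately have "?\<xi> = 0" by (rule total_const_eq_0)
    moreover have "?\<xi> = \<psi> ?\<rho> - (\<psi> \<sigma> + \<psi> \<tau>)" by simp
    ultimately have "\<psi> ?\<rho> - (\<psi> \<sigma> + \<psi> \<tau>) = 0" by (simp only:)
    then show ?thesis unfolding right_minus_eq .
  qed
  then have \<psi>: "\<psi> \<in> Hom G (consv b \<phi>)" using \<psi>c by (simp add: Hom_iff \<psi>_def)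
  define g where "g = f + twist \<psi>"
  have "g \<in> C0_unif b E" unfolding g_def
    by (intro subspace_add C0_unif_subspace f(1) twist_C0_unif \<psi>)
  moreover have "(\<lambda>\<eta>. g (\<eta> \<circ> \<alpha> \<sigma>)) = g" if s: "\<sigma> \<in> carrier G" for \<sigma>
  proof
    fix \<eta> :: "'x \<Rightarrow> 's"
    have "twist \<psi> (\<eta> \<circ> \<alpha> \<sigma>) = twist \<psi> \<eta> - total b (\<lambda>_. \<psi> \<sigma>) \<eta>"
      using fun_cong[OF twist_act[OF \<psi> s], of \<eta>] by simp
    then show "g (\<eta> \<circ> \<alpha> \<sigma>) = g \<eta>" using \<psi>f[OF s, of \<eta>] by (simp add: g_def)
  qed
  ultimately have "differential b E \<phi> g \<in> inv_exact_forms b E \<phi> G \<alpha>"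
    by (simp add: inv_exact_forms_def invariant_funs_def)
  moreover have m\<psi>: "(- 1) *\<^sub>R \<psi> \<in> Hom G (consv b \<phi>)"
    by (intro subspace_scale Hom_subspace group_G consv_subspace \<psi>)
  moreover have "\<omega> = differential b E \<phi> g + hom_form b E \<phi> G \<alpha> D ((- 1) *\<^sub>R \<psi>)"
    unfolding hom_form_scale[OF \<psi>] g_def differential_add f(2) hom_form_twist[OF \<psi>] by simp
  ultimately show ?thesis by (rule that)
qed

lemma decomposition_iso:
  assumes hyp: "transferable E \<or> simple_interaction b \<phi> \<and> weakly_transferable E"
  shows "linear_iso_on (inv_exact_forms b E \<phi> G \<alpha> \<times> Hom G (consv b \<phi>)) (inv_closed_forms b E \<phi> G \<alpha>)
    (\<lambda>(\<epsilon>, \<psi>). \<epsilon> + hom_form b E \<phi> G \<alpha> D \<psi>)"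
proof -
  let ?A = "inv_exact_forms b E \<phi> G \<alpha>" and ?V = "Hom G (consv b \<phi>)"
    and ?C = "inv_closed_forms b E \<phi> G \<alpha>"
  let ?h = "hom_form b E \<phi> G \<alpha> D" and ?T = "\<lambda>(\<epsilon>, \<psi>). \<epsilon> + hom_form b E \<phi> G \<alpha> D \<psi>"
  have V: "subspace ?V" by (intro Hom_subspace group_G consv_subspace)
  have A: "subspace ?A" by (rule inv_exact_forms_subspace)
  have "Z1_unif b E \<phi> = differential b E \<phi> ` C0_unif b E"
  proof (intro subset_antisym subsetI)
    fix \<omega> assume "\<omega> \<in> Z1_unif b E \<phi>"
    then obtain f where "f \<in> C0_unif b E" "differential b E \<phi> f = \<omega>"
      by (rule closed_uniform_form_exact[OF hyp])
    then show "\<omega> \<in> differential b E \<phi> ` C0_unif b E" by blast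
  qed (use differential_Z1_unif in blast)
  then have C: "subspace ?C"
    unfolding inv_closed_forms_def
    by (simp add: invariant_forms_subspace linear_subspace_image[OF linear_differential C0_unif_subspace])
  have into: "?T p \<in> ?C" if p: "p \<in> ?A \<times> ?V" for p
  proof -
    obtain \<epsilon> \<psi> where "p = (\<epsilon>, \<psi>)" and e: "\<epsilon> \<in> ?A" "\<psi> \<in> ?V" using p by (elim SigmaE)
    then show ?thesis using subspace_add[OF C exact_invariant[OF e(1)] hom_form_invariant[OF e(2)]]
      by simp
  qed
  have add: "?T (p + q) = ?T p + ?T q" if p: "p \<in> ?A \<times> ?V" and q: "q \<in> ?A \<times> ?V" for p q
  proof -
    obtain \<epsilon> \<psi> \<epsilon>' \<psi>' where "p = (\<epsilon>, \<psi>)" "q = (\<epsilon>', \<psi>')" and e: "\<psi> \<in> ?V" "\<psi>' \<in> ?V"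
      using p q by (elim SigmaE)
    then show ?thesis using hom_form_add[OF e] by simp
  qed
  have scale: "?T (c *\<^sub>R p) = c *\<^sub>R ?T p" if p: "p \<in> ?A \<times> ?V" for c p
  proof -
    obtain \<epsilon> \<psi> where "p = (\<epsilon>, \<psi>)" and e: "\<psi> \<in> ?V" using p by (elim SigmaE)
    then show ?thesis using hom_form_scale[OF e] by (simp add: scaleR_add_right)
  qed
  have AV: "subspace (?A \<times> ?V)" by (rule subspace_Times[OF A V])
  have "inj_on ?T (?A \<times> ?V)"
  proof (rule inj_onI)
    fix p q assume pq: "p \<in> ?A \<times> ?V" "q \<in> ?A \<times> ?V" "?T p = ?T q"
    have mq: "(- 1) *\<^sub>R q \<in> ?A \<times> ?V" by (rule subspace_scale[OF AV pq(2)])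
    obtain \<epsilon> \<psi> where e: "p + (- 1) *\<^sub>R q = (\<epsilon>, \<psi>)" by (cases "p + (- 1) *\<^sub>R q")
    have in': "\<epsilon> \<in> ?A" "\<psi> \<in> ?V" using subspace_add[OF AV pq(1) mq] unfolding e by auto
    have "?T (p + (- 1) *\<^sub>R q) = ?T p + (- 1) *\<^sub>R ?T q"
      by (simp only: add[OF pq(1) mq] scale[OF pq(2)])
    then have zero: "\<epsilon> + ?h \<psi> = 0" using pq(3) unfolding e by simp
    then have \<psi>0: "\<psi> = 0" by (rule exact_plus_hom_form_eq_0[OF in'])
    have "?h \<psi> = 0" using hom_form_scale[OF in'(2), of 0] \<psi>0 by simp
    then have "p + (- 1) *\<^sub>R q = 0" using zero e \<psi>0 by (simp add: zero_prod_def)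
    then show "p = q" by simp
  qed
  moreover have "?C \<subseteq> ?T ` (?A \<times> ?V)"
  proof
    fix \<omega> assume "\<omega> \<in> ?C"
    then obtain \<epsilon> \<psi> where "\<epsilon> \<in> ?A" "\<psi> \<in> ?V" "\<omega> = \<epsilon> + ?h \<psi>"
      by (rule invariant_form_decomposition[OF hyp])
    then show "\<omega> \<in> ?T ` (?A \<times> ?V)" by (intro image_eqI[of _ _ "(\<epsilon>, \<psi>)"]) auto
  qed
  ultimately have "bij_betw ?T (?A \<times> ?V) ?C" using into unfolding bij_betw_def by blast
  then show ?thesis unfolding linear_iso_on_def using AV C add scale by blast
qed

end

lemma linear_iso_on_substitute:
  assumes T: "linear_iso_on (A \<times> V) C (\<lambda>(a, v). a + h v)" and S: "linear_iso_on V W S"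
    and A: "subspace A"
  shows "linear_iso_on (A \<times> W) C (\<lambda>(a, w). a + h (inv_into V S w))"
proof -
  let ?K = "inv_into V S" and ?T = "\<lambda>(a, v). a + h v" and ?P = "\<lambda>(a, w). (a, inv_into V S w)"
  have V: "subspace V" and W: "subspace W" and bij: "bij_betw S V W"
    and Sadd: "\<And>u v. u \<in> V \<Longrightarrow> v \<in> V \<Longrightarrow> S (u + v) = S u + S v"
    and Sscale: "\<And>c v. v \<in> V \<Longrightarrow> S (c *\<^sub>R v) = c *\<^sub>R S v"
    using S by (auto simp: linear_iso_on_def)
  have K: "?K w \<in> V" "S (?K w) = w" if "w \<in> W" for w
    using bij_betwE[OF bij_betw_inv_into[OF bij]] bij_betw_inv_into_right[OF bij that] that
      by blast+
  have KS: "?K (S v) = v" if "v \<in> V" for v by (rule bij_betw_inv_into_left[OF bij that])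
  have Kadd: "?K (w + w') = ?K w + ?K w'" if "w \<in> W" "w' \<in> W" for w w'
    using KS[OF subspace_add[OF V K(1)[OF that(1)] K(1)[OF that(2)]]] Sadd[OF K(1)[OF that(1)] K(1)[OF that(2)]]
      K(2)[OF that(1)] K(2)[OF that(2)] by simp
  have Kscale: "?K (c *\<^sub>R w) = c *\<^sub>R ?K w" if "w \<in> W" for c w
    using KS[OF subspace_scale[OF V K(1)[OF that]]] Sscale[OF K(1)[OF that]] K(2)[OF that] by simp
  have P: "?P p \<in> A \<times> V" if "p \<in> A \<times> W" for p using that K(1) by auto
  have TP: "(\<lambda>(a, w). a + h (?K w)) p = ?T (?P p)" for p by (simp add: case_prod_unfold)
  have "bij_betw ?P (A \<times> W) (A \<times> V)"
    by (rule bij_betw_byWitness[where f' =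
      "\<lambda>(a, v). (a, S v)"]) (use K KS bij_betwE[OF bij] in auto)
  moreover have "bij_betw ?T (A \<times> V) C" using T by (simp add: linear_iso_on_def)
  ultimately have "bij_betw (?T \<circ> ?P) (A \<times> W) C" by (rule bij_betw_trans)
  moreover have "?T \<circ> ?P = (\<lambda>(a, w). a + h (?K w))" by (simp add: fun_eq_iff)
  ultimately have "bij_betw (\<lambda>(a, w). a + h (?K w)) (A \<times> W) C" by simp
  moreover have "?P (p + q) = ?P p + ?P q" if "p \<in> A \<times> W" "q \<in> A \<times> W" for p q using that Kadd
    by auto
  then have "(\<lambda>(a, w). a + h (?K w)) (p + q) = (\<lambda>(a, w). a + h (?K w)) p + (\<lambda>(a, w). a + h (?K w)) q"
    if "p \<in> A \<times> W" "q \<in> A \<times> W" for p q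
    using T P[OF that(1)] P[OF that(2)] that unfolding TP linear_iso_on_def by metis
  moreover have "?P (c *\<^sub>R p) = c *\<^sub>R ?P p" if "p \<in> A \<times> W" for c p using that Kscale by auto
  then have "(\<lambda>(a, w). a + h (?K w)) (c *\<^sub>R p) = c *\<^sub>R (\<lambda>(a, w). a + h (?K w)) p" if "p \<in> A \<times> W"
    for c p
    using T P[OF that] that unfolding TP linear_iso_on_def by metis
  ultimately show ?thesis
    unfolding linear_iso_on_def using subspace_Times[OF A W] T[unfolded linear_iso_on_def] by blast
qed

theorem corollary2:
  fixes E :: "'x rel"
    and b :: 's
    and \<phi> :: "'s \<times> 's \<Rightarrow> 's \<times> 's"
    and G :: "('g, 'm) monoid_scheme"
    and \<alpha> :: "'g \<Rightarrow> 'x \<Rightarrow> 'x"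
    and d :: nat
    and \<gamma> :: "nat \<Rightarrow> 'g set"
  assumes "is_locale UNIV E"
    and "interaction \<phi>"
    and "irreducibly_quantified b \<phi>"
    and "group G"
    and "locale_action G E \<alpha>"
    and "free_action G \<alpha>"
    and "transferable E \<or> simple_interaction b \<phi> \<and> weakly_transferable E"
    and "has_rank (abelianization G) d"
    and "free_part_generators (abelianization G) d \<gamma>"
  shows "linear_iso_on (Hom G (consv b \<phi>)) (direct_power d (consv b \<phi>)) (eval_gens d \<gamma>) \<and>
    (\<forall>D. fundamental_domain G \<alpha> D \<longrightarrow>
       linear_iso_on
         (inv_exact_forms b E \<phi> G \<alpha> \<times> direct_power d (consv b \<phi>))
         (inv_closed_forms b E \<phi> G \<alpha>)
         (\<lambda>(\<epsilon>, v). \<epsilon> + hom_form b E \<phi> G \<alpha> D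
            (inv_into (Hom G (consv b \<phi>)) (eval_gens d \<gamma>) v)))"
proof (intro conjI allI impI)
  show iso: "linear_iso_on (Hom G (consv b \<phi>)) (direct_power d (consv b \<phi>)) (eval_gens d \<gamma>)"
    by (rule eval_gens_iso[OF assms(4) consv_subspace assms(8,9)])
  fix D assume D: "fundamental_domain G \<alpha> D"
  have wt: "weakly_transferable E" using assms(7) by (auto simp: transferable_def)
  interpret acted_system_with_domain E b \<phi> G \<alpha> D
    by (intro acted_system_with_domain.intro acted_system.intro interacting_system.intro
      weakly_transferable_graph.intro connected_graph.intro weakly_transferable_graph_axioms.intro
      interacting_system_axioms.intro acted_system_axioms.intro acted_system_with_domain_axioms.intro assms wt D)
  show "linear_iso_on (inv_exact_forms b E \<phi> G \<alpha> \<times> direct_power d (consv b \<phi>)) (inv_closed_forms b E \<phi> G \<alpha>)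
      (\<lambda>(\<epsilon>, v). \<epsilon> + hom_form b E \<phi> G \<alpha> D (inv_into (Hom G (consv b \<phi>)) (eval_gens d \<gamma>) v))"
    by (rule linear_iso_on_substitute[OF decomposition_iso[OF assms(7)] iso inv_exact_forms_subspace])
qed

end
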